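(* Let $m\in\mathbb N^+$ and let $V\in C^\infty(\mathbb T^2;\mathbb R)$ be resonantly unstable with respect to $m$, i.e. $\langle V\rangle_m$ has at least one zero and every zero $x_0$ of $\langle V\rangle_m$ satisfies $\langle V\rangle_m'(x_0)\neq 0$. Then there exist $\epsilon(V)>0$ and $\delta_1,\delta_2>0$ such that for every $0<\epsilon<\epsilon(V)$ and every $s>1$ there exists $u_0\in\mathcal H^s(\mathbb T)$, $u_0\neq 0$, such that the solution $u$ of $$\partial_t u=(m+\epsilon V(t,x))\partial_x u+\tfrac{\epsilon}{2}\partial_x V(t,x)\,u,\qquad u(0,\cdot)=u_0,$$ satisfies $$\|u(t)\|_s\ge \delta_1 e^{\epsilon\delta_2 t}\|u_0\|_s\qquad\text{for all } t>0.$$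
   Context: $\mathbb T:=\mathbb R/2\pi\mathbb Z$. For $s\in\mathbb R$, $\mathcal H^s(\mathbb T)$ is the space of $u$ with $\|u\|_s^2:=\sum_{k\in\mathbb Z}\langle k\rangle^{2s}|u_k|^2<\infty$, where $\langle k\rangle=(1+k^2)^{1/2}$ and $u_k$ are the Fourier coefficients of $u$. For $V\in C^\infty(\mathbb T^2;\mathbb C)$ with Fourier expansion $V(t,x)=\sum_{k,\ell\in\mathbb Z}v_{k,\ell}e^{i(kx+\ell t)}$, the resonant average of $V$ with respect to $m\in\mathbb N^+$ is $\langle V\rangle_m(x):=\sum_{k\in\mathbb Z}v_{k,mk}e^{ikx}$. *)

theory Defs
  imports "HOL-Analysis.Analysis"
begin

text \<open>Functions on the torus are represented as 2pi-periodic functions on the reals.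
  Points of the 2-torus are pairs (t, x).\<close>

fun Ck2 :: "nat \<Rightarrow> (real \<times> real \<Rightarrow> real) \<Rightarrow> bool" where
  "Ck2 0 f = continuous_on UNIV f"
| "Ck2 (Suc n) f = (\<exists>ft fx. (\<forall>p. (f has_derivative (\<lambda>h. ft p * fst h + fx p * snd h)) (at p))
                      \<and> Ck2 n ft \<and> Ck2 n fx)"

definition smooth2 :: "(real \<times> real \<Rightarrow> real) \<Rightarrow> bool" where
  "smooth2 f \<longleftrightarrow> (\<forall>n. Ck2 n f)"

definition periodic2 :: "(real \<times> real \<Rightarrow> real) \<Rightarrow> bool" where
  "periodic2 V \<longleftrightarrow> (\<forall>t x. V (t + 2*pi, x) = V (t, x) \<and> V (t, x + 2*pi) = V (t, x))"

definition vcoef :: "(real \<times> real \<Rightarrow> real) \<Rightarrow> int \<Rightarrow> int \<Rightarrow> complex" where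
  "vcoef V k l = (LINT p:{0..2*pi} \<times> {0..2*pi}|lborel.
      complex_of_real (V p) * exp (- \<i> * (of_int k * of_real (snd p) + of_int l * of_real (fst p))))
      / (4 * pi\<^sup>2)"

definition res_avg :: "nat \<Rightarrow> (real \<times> real \<Rightarrow> real) \<Rightarrow> real \<Rightarrow> complex" where
  "res_avg m V x = (\<Sum>\<^sub>\<infinity>k::int. vcoef V k (int m * k) * exp (\<i> * of_int k * of_real x))"

definition resonantly_unstable :: "nat \<Rightarrow> (real \<times> real \<Rightarrow> real) \<Rightarrow> bool" where
  "resonantly_unstable m V \<longleftrightarrow>
     (\<exists>x0. res_avg m V x0 = 0) \<and>
     (\<forall>x0. res_avg m V x0 = 0 \<longrightarrow> vector_derivative (res_avg m V) (at x0) \<noteq> 0)"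

definition fcoef :: "(real \<Rightarrow> complex) \<Rightarrow> int \<Rightarrow> complex" where
  "fcoef u k = (LINT x:{0..2*pi}|lborel. u x * exp (- \<i> * of_int k * of_real x)) / (2 * pi)"

definition japan :: "int \<Rightarrow> real" where
  "japan k = sqrt (1 + (real_of_int k)\<^sup>2)"

definition in_Hs :: "real \<Rightarrow> (real \<Rightarrow> complex) \<Rightarrow> bool" where
  "in_Hs s u \<longleftrightarrow> (\<forall>x. u (x + 2*pi) = u x) \<and> u \<in> borel_measurable lborel \<and>
     set_integrable lborel {0..2*pi} (\<lambda>x. (cmod (u x))\<^sup>2) \<and>
     ((\<lambda>k. (japan k powr (2 * s)) * (cmod (fcoef u k))\<^sup>2) summable_on UNIV)"

definition sob_norm :: "real \<Rightarrow> (real \<Rightarrow> complex) \<Rightarrow> real" where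
  "sob_norm s u = sqrt (\<Sum>\<^sub>\<infinity>k::int. (japan k powr (2 * s)) * (cmod (fcoef u k))\<^sup>2)"

text \<open>Solution of  d_t u = (m + eps V) d_x u + (eps/2) (d_x V) u,  u(0) = u0, for t >= 0,
  in the class C([0,inf), H^s), the equation holding weakly: for every Fourier mode
  phi(x) = e^{ikx}, the pairing t |-> int_0^{2pi} u(t,x) phi(x) dx is differentiable with
  derivative int u (- d_x((m + eps V) phi) + (eps/2) (d_x V) phi) dx (integration by parts).\<close>
definition is_solution ::
  "nat \<Rightarrow> real \<Rightarrow> (real \<times> real \<Rightarrow> real) \<Rightarrow> real \<Rightarrow> (real \<Rightarrow> complex) \<Rightarrow> (real \<Rightarrow> real \<Rightarrow> complex) \<Rightarrow> bool"
  where
  "is_solution m \<epsilon> V s u0 u \<longleftrightarrow>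
     u 0 = u0 \<and>
     (\<forall>t\<ge>0. in_Hs s (u t)) \<and>
     (\<forall>t0\<ge>0. ((\<lambda>t. sob_norm s (\<lambda>x. u t x - u t0 x)) \<longlongrightarrow> 0) (at t0 within {0..})) \<and>
     (\<forall>k::int. \<forall>t\<ge>0.
        ((\<lambda>\<tau>. LINT x:{0..2*pi}|lborel. u \<tau> x * exp (\<i> * of_int k * of_real x))
          has_vector_derivative
          (LINT x:{0..2*pi}|lborel. u t x *
              ( - complex_of_real (real m + \<epsilon> * V (t, x)) * (\<i> * of_int k * exp (\<i> * of_int k * of_real x))
                - complex_of_real (\<epsilon> * deriv (\<lambda>y. V (t, y)) x) * exp (\<i> * of_int k * of_real x)
                + complex_of_real (\<epsilon> / 2 * deriv (\<lambda>y. V (t, y)) x) * exp (\<i> * of_int k * of_real x))))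
        (at t within {0..}))"

end

theory Submission
  imports Defs
begin

text \<open>
  Put \<open>a = m + \<epsilon> V\<close>, let \<open>\<Phi>\<close> be the flow of \<open>x' = - a (t, x)\<close> and \<open>J = ln \<Phi>\<^sub>z\<close>. The solution
  starting from \<open>u0 = 1\<close> is \<open>u (t, \<Phi> (t, z)) = exp (- J (t, z) / 2)\<close>; it is smooth, so it lies in
  every Sobolev space.

  In the frame moving with speed \<open>m\<close> the characteristics obey a slow periodic equation whose average
  is \<open>y' = - \<epsilon> \<langle>V\<rangle>\<^sub>m (y)\<close>. A zero of \<open>\<langle>V\<rangle>\<^sub>m\<close> with positive derivative attracts, so for small \<open>\<epsilon>\<close> the
  characteristic starting there stays nearby, and along it \<open>J\<close> decreases at least linearly in \<open>\<epsilon> t\<close>.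
  Hence the supremum of \<open>|u (t)|\<close> grows exponentially; for \<open>s \<ge> 1\<close> it is bounded by the Sobolev norm
  with a constant independent of \<open>s\<close>, while the constant function \<open>1\<close> has norm \<open>1\<close> for every \<open>s\<close>.

  Weak solutions are unique: in Fourier space the equation is given by a skew-Hermitian matrix, and
  the energy of the difference of two solutions, restricted to a finite set of frequencies, has a
  time derivative that tends to \<open>0\<close> as this set grows, because \<open>s > 1\<close> makes
  \<open>\<Sum> \<langle>k\<rangle>\<^sup>1\<^sup>/\<^sup>2 |u\<^sub>k|\<close> finite.
\<close>

section \<open>Smooth functions of two variables\<close>

definition has_partials ::
  "(real \<times> real \<Rightarrow> real) \<Rightarrow> (real \<times> real \<Rightarrow> real) \<Rightarrow> (real \<times> real \<Rightarrow> real) \<Rightarrow> bool" where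
  "has_partials f ft fx \<longleftrightarrow> (\<forall>p. (f has_derivative (\<lambda>h. ft p * fst h + fx p * snd h)) (at p))"

lemma has_partialsD:
  "has_partials f ft fx \<Longrightarrow> (f has_derivative (\<lambda>h. ft p * fst h + fx p * snd h)) (at p)"
  unfolding has_partials_def by blast

lemma has_partials_continuous: "has_partials f ft fx \<Longrightarrow> continuous_on UNIV f"
  by (meson continuous_at_imp_continuous_on has_derivative_continuous has_partialsD)

lemma has_partials_add:
  assumes "has_partials f ft fx" "has_partials g gt gx"
  shows "has_partials (\<lambda>p. f p + g p) (\<lambda>p. ft p + gt p) (\<lambda>p. fx p + gx p)"
  unfolding has_partials_def
  by (auto intro!: derivative_eq_intros assms[THEN has_partialsD] simp: algebra_simps)

lemma has_partials_mult:
  assumes "has_partials f ft fx" "has_partials g gt gx"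
  shows "has_partials (\<lambda>p. f p * g p) (\<lambda>p. f p * gt p + ft p * g p) (\<lambda>p. f p * gx p + fx p * g p)"
  unfolding has_partials_def
  by (auto intro!: derivative_eq_intros assms[THEN has_partialsD] simp: algebra_simps)

lemma has_partials_exp:
  assumes "has_partials f ft fx"
  shows "has_partials (\<lambda>p. exp (f p)) (\<lambda>p. exp (f p) * ft p) (\<lambda>p. exp (f p) * fx p)"
  unfolding has_partials_def
  by (auto intro!: derivative_eq_intros has_partialsD[OF assms] simp: algebra_simps)

lemma has_partials_compose:
  assumes "has_partials f ft fx" "has_partials g gt gx" "has_partials h ht hx"
  shows "has_partials (\<lambda>p. f (g p, h p))
     (\<lambda>p. ft (g p, h p) * gt p + fx (g p, h p) * ht p)
     (\<lambda>p. ft (g p, h p) * gx p + fx (g p, h p) * hx p)"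
  unfolding has_partials_def
proof
  fix p
  have "((\<lambda>p. (g p, h p)) has_derivative
      (\<lambda>k. (gt p * fst k + gx p * snd k, ht p * fst k + hx p * snd k))) (at p)"
    by (intro has_derivative_Pair has_partialsD[OF assms(2)] has_partialsD[OF assms(3)])
  from has_derivative_compose[OF this has_partialsD[OF assms(1), of "(g p, h p)"]]
  show "((\<lambda>p. f (g p, h p)) has_derivative
      (\<lambda>k. (ft (g p, h p) * gt p + fx (g p, h p) * ht p) * fst k +
           (ft (g p, h p) * gx p + fx (g p, h p) * hx p) * snd k)) (at p)"
    by (rule has_derivative_eq_rhs) (auto simp: algebra_simps)
qed

lemma has_partialsI:
  assumes t: "\<And>t x. ((\<lambda>t. f (t, x)) has_real_derivative ft (t, x)) (at t)"
    and x: "\<And>t x. ((\<lambda>x. f (t, x)) has_real_derivative fx (t, x)) (at x)"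
    and cont: "continuous_on UNIV fx"
  shows "has_partials f ft fx"
  unfolding has_partials_def split_paired_All
proof (intro allI)
  fix t x
  have "((\<lambda>(t, x). f (t, x)) has_derivative
      (\<lambda>(k, l). ft (t, x) * k + blinfun_mult_right (fx (t, x)) l)) (at (t, x) within UNIV \<times> UNIV)"
  proof (rule has_derivative_partialsI)
    show "((\<lambda>t. f (t, x)) has_derivative (*) (ft (t, x))) (at t)"
      using t by (simp add: has_field_derivative_def)
    show "((\<lambda>y. f (t, y)) has_derivative blinfun_apply (blinfun_mult_right (fx (t, y)))) (at y)"
      for t y
      using x by (simp add: has_field_derivative_def)
    have "continuous_on UNIV (\<lambda>p. blinfun_mult_right (fx p))"
      by (intro continuous_intros cont)
    then have "isCont (\<lambda>p. blinfun_mult_right (fx p)) (t, x)"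
      unfolding continuous_on_eq_continuous_at[OF open_UNIV] by blast
    then show "continuous (at (t, x) within UNIV \<times> UNIV) (\<lambda>(t, x). blinfun_mult_right (fx (t, x)))"
      by (simp add: split_def)
  qed auto
  then show "(f has_derivative (\<lambda>h. ft (t, x) * fst h + fx (t, x) * snd h)) (at (t, x))"
    by (simp add: split_beta')
qed

lemma has_partials_DERIV_fst:
  assumes "has_partials f ft fx"
  shows "((\<lambda>t. f (t, x)) has_real_derivative ft (t, x)) (at t within S)"
proof -
  have "((\<lambda>t. (t, x)) has_derivative (\<lambda>h. (h, 0))) (at t within S)"
    by (auto intro!: derivative_eq_intros)
  from has_derivative_compose[OF this has_partialsD[OF assms]] show ?thesis
    by (simp add: has_field_derivative_def)
qed

lemma has_partials_DERIV_snd: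
  assumes "has_partials f ft fx"
  shows "((\<lambda>x. f (t, x)) has_real_derivative fx (t, x)) (at x within S)"
proof -
  have "((\<lambda>x. (t, x)) has_derivative (\<lambda>h. (0, h))) (at x within S)"
    by (auto intro!: derivative_eq_intros)
  from has_derivative_compose[OF this has_partialsD[OF assms]] show ?thesis
    by (simp add: has_field_derivative_def)
qed

lemma has_partials_DERIV_curve:
  assumes "has_partials f ft fx" "(y has_real_derivative y') (at t)"
  shows "((\<lambda>t. f (t, y t)) has_real_derivative ft (t, y t) + fx (t, y t) * y') (at t)"
proof -
  have "((\<lambda>t. (t, y t)) has_derivative (\<lambda>h. (h, y' * h))) (at t)"
    using assms(2) by (auto intro!: derivative_eq_intros simp: has_field_derivative_def)
  from has_derivative_compose[OF this has_partialsD[OF assms(1)]]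
  show ?thesis unfolding has_field_derivative_def
    by (rule has_derivative_eq_rhs) (auto simp: algebra_simps)
qed

lemma Ck2_Suc_iff: "Ck2 (Suc n) f \<longleftrightarrow> (\<exists>ft fx. has_partials f ft fx \<and> Ck2 n ft \<and> Ck2 n fx)"
  by (simp add: has_partials_def)

declare Ck2.simps(2) [simp del]

lemma Ck2_SucI: "has_partials f ft fx \<Longrightarrow> Ck2 n ft \<Longrightarrow> Ck2 n fx \<Longrightarrow> Ck2 (Suc n) f"
  by (auto simp: Ck2_Suc_iff)

lemma Ck2_continuous: "Ck2 n f \<Longrightarrow> continuous_on UNIV f"
  by (cases n) (auto simp: Ck2_Suc_iff has_partials_continuous)

lemma Ck2_SucD: "Ck2 (Suc n) f \<Longrightarrow> Ck2 n f"
proof (induction n arbitrary: f)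
  case 0
  then show ?case using Ck2_continuous by simp
next
  case (Suc n)
  then show ?case by (metis Ck2_Suc_iff)
qed

lemma Ck2_const [intro]: "Ck2 n (\<lambda>p. c)"
proof (induction n arbitrary: c)
  case (Suc n)
  show ?case by (rule Ck2_SucI[of _ "\<lambda>_. 0" "\<lambda>_. 0"]) (auto simp: has_partials_def Suc)
qed simp

lemma Ck2_fst [intro]: "Ck2 n fst"
proof (cases n)
  case (Suc k)
  have "has_partials fst (\<lambda>_. 1) (\<lambda>_. 0)"
    by (auto simp: has_partials_def intro!: derivative_eq_intros)
  then show ?thesis unfolding Suc by (rule Ck2_SucI) auto
qed (auto intro: continuous_intros)

lemma Ck2_snd [intro]: "Ck2 n snd"
proof (cases n)
  case (Suc k)
  have "has_partials snd (\<lambda>_. 0) (\<lambda>_. 1)"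
    by (auto simp: has_partials_def intro!: derivative_eq_intros)
  then show ?thesis unfolding Suc by (rule Ck2_SucI) auto
qed (auto intro: continuous_intros)

lemma Ck2_add [intro]: "Ck2 n f \<Longrightarrow> Ck2 n g \<Longrightarrow> Ck2 n (\<lambda>p. f p + g p)"
proof (induction n arbitrary: f g)
  case (Suc n)
  then show ?case unfolding Ck2_Suc_iff by (blast intro: has_partials_add)
qed (auto intro: continuous_intros)

lemma Ck2_mult [intro]: "Ck2 n f \<Longrightarrow> Ck2 n g \<Longrightarrow> Ck2 n (\<lambda>p. f p * g p)"
proof (induction n arbitrary: f g)
  case (Suc n)
  obtain ft fx gt gx where "has_partials f ft fx" "has_partials g gt gx"
    and partials: "Ck2 n ft" "Ck2 n fx" "Ck2 n gt" "Ck2 n gx"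
    using Suc.prems by (auto simp: Ck2_Suc_iff)
  from has_partials_mult[OF this(1,2)] show ?case
    by (rule Ck2_SucI) (intro Ck2_add Suc.IH partials Suc.prems[THEN Ck2_SucD])+
qed (auto intro: continuous_intros)

lemma Ck2_uminus [intro]: "Ck2 n f \<Longrightarrow> Ck2 n (\<lambda>p. - f p)"
  using Ck2_mult[OF Ck2_const[of n "-1"], of f] by simp

lemma Ck2_compose: "Ck2 n f \<Longrightarrow> Ck2 n g \<Longrightarrow> Ck2 n h \<Longrightarrow> Ck2 n (\<lambda>p. f (g p, h p))"
proof (induction n arbitrary: f g h)
  case 0
  then show ?case
    by (auto intro!: continuous_on_compose2[of UNIV f] continuous_intros)
next
  case (Suc n)
  obtain ft fx gt gx ht hx
    where "has_partials f ft fx" "has_partials g gt gx" "has_partials h ht hx"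
      and partials: "Ck2 n ft" "Ck2 n fx" "Ck2 n gt" "Ck2 n gx" "Ck2 n ht" "Ck2 n hx"
    using Suc.prems by (auto simp: Ck2_Suc_iff)
  from has_partials_compose[OF this(1-3)] show ?case
    by (rule Ck2_SucI) (intro Ck2_add Ck2_mult Suc.IH partials Suc.prems[THEN Ck2_SucD])+
qed

lemma Ck2_exp [intro]: "Ck2 n f \<Longrightarrow> Ck2 n (\<lambda>p. exp (f p))"
proof (induction n arbitrary: f)
  case 0
  then show ?case by (auto intro!: continuous_intros)
next
  case (Suc n)
  then obtain ft fx where "has_partials f ft fx" and partials: "Ck2 n ft" "Ck2 n fx"
    by (auto simp: Ck2_Suc_iff)
  from has_partials_exp[OF this(1)] show ?case
    by (rule Ck2_SucI) (intro Ck2_mult Suc.IH[OF Ck2_SucD[OF Suc.prems]] partials)+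
qed

definition dt2 :: "(real \<times> real \<Rightarrow> real) \<Rightarrow> real \<times> real \<Rightarrow> real" where
  "dt2 f p = frechet_derivative f (at p) (1, 0)"

definition dx2 :: "(real \<times> real \<Rightarrow> real) \<Rightarrow> real \<times> real \<Rightarrow> real" where
  "dx2 f p = frechet_derivative f (at p) (0, 1)"

lemma dt2_eq: "has_partials f ft fx \<Longrightarrow> dt2 f = ft"
  and dx2_eq: "has_partials f ft fx \<Longrightarrow> dx2 f = fx"
  using frechet_derivative_at[OF has_partialsD, symmetric] by (auto simp: dt2_def dx2_def)

lemma smooth2_has_partials: "smooth2 f \<Longrightarrow> has_partials f (dt2 f) (dx2 f)"
  unfolding smooth2_def using dt2_eq dx2_eq by (metis Ck2_Suc_iff)

lemma smooth2_dt2: "smooth2 f \<Longrightarrow> smooth2 (dt2 f)"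
  unfolding smooth2_def using dt2_eq by (metis Ck2_Suc_iff)

lemma smooth2_dx2: "smooth2 f \<Longrightarrow> smooth2 (dx2 f)"
  unfolding smooth2_def using dx2_eq by (metis Ck2_Suc_iff)

lemma smooth2_bootstrap:
  assumes f: "has_partials f ft fx"
    and partials: "\<And>n. Ck2 n f \<Longrightarrow> Ck2 n ft" "\<And>n. Ck2 n f \<Longrightarrow> Ck2 n fx"
  shows "smooth2 f"
  unfolding smooth2_def
proof
  fix n
  show "Ck2 n f"
  proof (induction n)
    case 0
    then show ?case using has_partials_continuous[OF f] by simp
  next
    case (Suc n)
    then show ?case by (intro Ck2_SucI[OF f] partials)
  qed
qed

lemma smooth2_continuous: "smooth2 f \<Longrightarrow> continuous_on UNIV f"
  by (auto simp: smooth2_def dest: Ck2_continuous)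

lemma continuous_on_UNIV_compose:
  "continuous_on UNIV f \<Longrightarrow> continuous_on S g \<Longrightarrow> continuous_on S (\<lambda>x. f (g x))"
  by (rule continuous_on_compose2) auto

lemma smooth2_continuous_compose:
  "smooth2 f \<Longrightarrow> continuous_on S g \<Longrightarrow> continuous_on S (\<lambda>x. f (g x))"
  by (rule continuous_on_UNIV_compose[OF smooth2_continuous])

lemma smooth2_DERIV_fst:
    "smooth2 f \<Longrightarrow> ((\<lambda>t. f (t, x)) has_real_derivative dt2 f (t, x)) (at t within S)"
  and smooth2_DERIV_snd:
    "smooth2 f \<Longrightarrow> ((\<lambda>x. f (t, x)) has_real_derivative dx2 f (t, x)) (at x within S)"
  by (blast intro: has_partials_DERIV_fst has_partials_DERIV_snd smooth2_has_partials)+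

lemma dx2_eqI:
  assumes "smooth2 f" "\<And>t x. ((\<lambda>x. f (t, x)) has_real_derivative g (t, x)) (at x)"
  shows "dx2 f = g"
  using DERIV_unique[OF smooth2_DERIV_snd[OF assms(1)] assms(2)] by fastforce

lemma smooth2_const: "smooth2 (\<lambda>p. c)"
  and smooth2_fst: "smooth2 fst"
  and smooth2_snd: "smooth2 snd"
  and smooth2_add: "smooth2 f \<Longrightarrow> smooth2 g \<Longrightarrow> smooth2 (\<lambda>p. f p + g p)"
  and smooth2_mult: "smooth2 f \<Longrightarrow> smooth2 g \<Longrightarrow> smooth2 (\<lambda>p. f p * g p)"
  and smooth2_uminus: "smooth2 f \<Longrightarrow> smooth2 (\<lambda>p. - f p)"
  and smooth2_exp: "smooth2 f \<Longrightarrow> smooth2 (\<lambda>p. exp (f p))"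
  and smooth2_compose:
    "smooth2 f \<Longrightarrow> smooth2 g \<Longrightarrow> smooth2 h \<Longrightarrow> smooth2 (\<lambda>p. f (g p, h p))"
  by (auto simp: smooth2_def intro: Ck2_compose)

lemma smooth2_diff: "smooth2 f \<Longrightarrow> smooth2 g \<Longrightarrow> smooth2 (\<lambda>p. f p - g p)"
  using smooth2_add[OF _ smooth2_uminus, of f g] by simp

lemmas smooth2_intros = smooth2_const smooth2_fst smooth2_snd smooth2_add smooth2_mult smooth2_exp
  smooth2_uminus smooth2_diff

lemma smooth2_affine: "smooth2 f \<Longrightarrow> smooth2 (\<lambda>p. c + d * f p)"
  by (intro smooth2_intros)

lemma dx2_affine: "smooth2 f \<Longrightarrow> dx2 (\<lambda>p. c + d * f p) = (\<lambda>p. d * dx2 f p)"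
  by (rule dx2_eqI[OF smooth2_affine]) (auto intro!: derivative_eq_intros smooth2_DERIV_snd)

lemma dx2_uminus: "smooth2 f \<Longrightarrow> dx2 (\<lambda>p. - f p) = (\<lambda>p. - dx2 f p)"
  by (rule dx2_eqI) (auto intro!: smooth2_uminus DERIV_minus smooth2_DERIV_snd)

section \<open>Primitives in the time variable\<close>

text \<open>Rescaling to a fixed interval of integration avoids a case distinction on the sign of the
  time.\<close>

definition primitive_t :: "(real \<times> real \<Rightarrow> real) \<Rightarrow> real \<times> real \<Rightarrow> real" where
  "primitive_t f p = fst p * integral {0..1} (\<lambda>\<sigma>. f (\<sigma> * fst p, snd p))"

lemma primitive_t_0 [simp]: "primitive_t f (0, x) = 0"
  by (simp add: primitive_t_def)

lemma primitive_t_uminus: "primitive_t (\<lambda>p. - f p) p = - primitive_t f p"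
  by (simp add: primitive_t_def)

lemma has_integral_derivative:
  fixes F f :: "real \<Rightarrow> real"
  assumes "\<And>t. (F has_real_derivative f t) (at t)" "a \<le> b"
  shows "(f has_integral F b - F a) {a..b}"
  using assms
  by (intro fundamental_theorem_of_calculus)
    (auto simp: has_real_derivative_iff_has_vector_derivative
      intro: has_vector_derivative_at_within)

lemma rescaled_integral_eq:
  fixes F f :: "real \<Rightarrow> real"
  assumes "\<And>t. (F has_real_derivative f t) (at t)"
  shows "t * integral {0..1} (\<lambda>\<sigma>. f (\<sigma> * t)) = F t - F 0"
proof -
  have "((\<lambda>\<sigma>. F (\<sigma> * t)) has_real_derivative t * f (\<sigma> * t)) (at \<sigma>)" for \<sigma>
    by (rule DERIV_chain2[OF assms, THEN DERIV_cong]) (auto intro!: derivative_eq_intros)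
  from has_integral_derivative[OF this, of 0 1] show ?thesis
    by (simp add: integral_unique flip: integral_mult_right)
qed

lemma antiderivative_exists:
  fixes f :: "real \<Rightarrow> 'a::euclidean_space"
  assumes "continuous_on UNIV f"
  obtains F where "\<And>x. (F has_vector_derivative f x) (at x)"
proof -
  have "\<exists>F. \<forall>x. -\<infinity> < ereal x \<longrightarrow> ereal x < \<infinity> \<longrightarrow> (F has_vector_derivative f x) (at x)"
    by (rule einterval_antiderivative) (auto intro!: continuous_on_interior[of UNIV] assms)
  then show ?thesis using that by auto
qed

lemma primitive_t_DERIV_fst:
  assumes "continuous_on UNIV f"
  shows "((\<lambda>t. primitive_t f (t, x)) has_real_derivative f (t, x)) (at t)"
proof -
  have "continuous_on UNIV (\<lambda>t. f (t, x))"
    by (intro continuous_on_UNIV_compose[OF assms] continuous_intros)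
  then obtain F where F: "\<And>t. (F has_real_derivative f (t, x)) (at t)"
    by (metis antiderivative_exists has_real_derivative_iff_has_vector_derivative)
  have "primitive_t f (t, x) = F t - F 0" for t
    using rescaled_integral_eq[OF F, of t] by (simp add: primitive_t_def)
  then show ?thesis using F by (auto intro!: derivative_eq_intros)
qed

lemma primitive_t_eq_integral:
  assumes "continuous_on UNIV f" "T \<ge> 0"
  shows "primitive_t f (T, x) = integral {0..T} (\<lambda>t. f (t, x))"
  using has_integral_derivative[OF primitive_t_DERIV_fst[OF assms(1)] assms(2), of x]
  by (simp add: integral_unique)

lemma continuous_on_primitive_t:
  assumes "continuous_on UNIV f"
  shows "continuous_on UNIV (primitive_t f)"
proof -
  have "continuous_on UNIV
      (\<lambda>p :: real \<times> real. integral (cbox 0 1) (\<lambda>\<sigma>::real. f (\<sigma> * fst p, snd p)))"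
    by (rule integral_continuous_on_param[where f="\<lambda>p \<sigma>. f (\<sigma> * fst p, snd p)"])
      (auto simp: split_beta intro!: continuous_on_UNIV_compose[OF assms] continuous_intros)
  then show ?thesis
    unfolding primitive_t_def[abs_def] by (intro continuous_intros) simp
qed

lemma primitive_t_DERIV_snd:
  assumes f: "continuous_on UNIV f"
    and fx: "\<And>t x. ((\<lambda>x. f (t, x)) has_real_derivative fx (t, x)) (at x)" "continuous_on UNIV fx"
  shows "((\<lambda>x. primitive_t f (t, x)) has_real_derivative primitive_t fx (t, x)) (at x)"
proof -
  have "((\<lambda>x. integral (cbox 0 1) (\<lambda>\<sigma>. f (\<sigma> * t, x))) has_real_derivative
      integral (cbox 0 1) (\<lambda>\<sigma>. fx (\<sigma> * t, x))) (at x within UNIV)"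
  proof (rule leibniz_rule_field_derivative)
    show "(\<lambda>\<sigma>. f (\<sigma> * t, y)) integrable_on cbox 0 1" for y
      by (intro integrable_continuous continuous_on_UNIV_compose[OF f] continuous_intros)
    show "continuous_on (UNIV \<times> cbox 0 1) (\<lambda>(x, \<sigma>). fx (\<sigma> * t, x))"
      by (auto simp: split_beta intro!: continuous_on_UNIV_compose[OF fx(2)] continuous_intros)
  qed (auto intro: fx)
  then show ?thesis
    by (auto simp: primitive_t_def cbox_interval intro!: derivative_eq_intros)
qed

lemma has_partials_primitive_t:
  assumes "has_partials f ft fx" "continuous_on UNIV fx"
  shows "has_partials (primitive_t f) f (primitive_t fx)"
  by (intro has_partialsI primitive_t_DERIV_fst primitive_t_DERIV_snd continuous_on_primitive_t
      has_partials_DERIV_snd[OF assms(1)] has_partials_continuous[OF assms(1)] assms)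

lemma Ck2_primitive_t [intro]: "Ck2 n f \<Longrightarrow> Ck2 n (primitive_t f)"
proof (induction n arbitrary: f)
  case (Suc n)
  then obtain ft fx where "has_partials f ft fx" and fx: "Ck2 n fx"
    by (auto simp: Ck2_Suc_iff)
  from has_partials_primitive_t[OF this(1) Ck2_continuous[OF fx]] show ?case
    by (rule Ck2_SucI) (auto intro: Suc.IH fx Ck2_SucD Suc.prems)
qed (simp add: continuous_on_primitive_t)

lemma smooth2_primitive_t: "smooth2 f \<Longrightarrow> smooth2 (primitive_t f)"
  by (auto simp: smooth2_def)

lemma smooth2_has_partials_primitive_t:
  "smooth2 f \<Longrightarrow> has_partials (primitive_t f) f (primitive_t (dx2 f))"
  by (intro has_partials_primitive_t[OF smooth2_has_partials] smooth2_continuous smooth2_dx2)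

lemma primitive_t_diff_le:
  assumes f: "continuous_on UNIV f" and g: "continuous_on UNIV g" and h: "continuous_on UNIV h"
    and H: "\<And>s. (H has_real_derivative h s) (at s)"
    and le: "\<And>s. \<bar>f (s, x) - g (s, x)\<bar> \<le> h \<bar>s\<bar>"
  shows "\<bar>primitive_t f (t, x) - primitive_t g (t, x)\<bar> \<le> H \<bar>t\<bar> - H 0"
proof -
  have "(\<lambda>\<sigma>. f (\<sigma> * t, x)) integrable_on {0..1}" "(\<lambda>\<sigma>. g (\<sigma> * t, x)) integrable_on {0..1}"
    by (intro integrable_continuous_interval continuous_on_UNIV_compose[OF f]
        continuous_on_UNIV_compose[OF g] continuous_intros)+
  note integrable = this
  have "norm (integral {0..1} (\<lambda>\<sigma>. f (\<sigma> * t, x) - g (\<sigma> * t, x)))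
      \<le> integral {0..1} (\<lambda>\<sigma>. h (\<sigma> * \<bar>t\<bar>))"
  proof (rule integral_norm_bound_integral)
    show "(\<lambda>\<sigma>. h (\<sigma> * \<bar>t\<bar>)) integrable_on {0..1}"
      by (intro integrable_continuous_interval continuous_on_UNIV_compose[OF h] continuous_intros)
    show "norm (f (\<sigma> * t, x) - g (\<sigma> * t, x)) \<le> h (\<sigma> * \<bar>t\<bar>)" if "\<sigma> \<in> {0..1}" for \<sigma>
      using le[of "\<sigma> * t"] that by (simp add: abs_mult)
  qed (intro integrable_diff integrable)
  then have "\<bar>t\<bar> * \<bar>integral {0..1} (\<lambda>\<sigma>. f (\<sigma> * t, x) - g (\<sigma> * t, x))\<bar>
      \<le> \<bar>t\<bar> * integral {0..1} (\<lambda>\<sigma>. h (\<sigma> * \<bar>t\<bar>))"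
    by (intro mult_left_mono) auto
  then show ?thesis
    using integrable rescaled_integral_eq[OF H]
    by (simp add: primitive_t_def integral_diff right_diff_distrib flip: abs_mult)
qed

section \<open>Periodic functions\<close>

lemma period_representative:
  obtains n :: int where "x + of_int n * (2 * pi) \<in> {0..2 * pi}"
proof
  have "of_int \<lfloor>x / (2 * pi)\<rfloor> * (2 * pi) \<le> x" "x \<le> (of_int \<lfloor>x / (2 * pi)\<rfloor> + 1) * (2 * pi)"
    using floor_divide_lower[of "2 * pi" x] floor_divide_upper[of "2 * pi" x] by auto
  then show "x + of_int (- \<lfloor>x / (2 * pi)\<rfloor>) * (2 * pi) \<in> {0..2 * pi}"
    by (auto simp: algebra_simps)
qed

lemma periodic2_shift:
  assumes "periodic2 f"
  shows "f (t + of_int n * (2 * pi), x + of_int k * (2 * pi)) = f (t, x)"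
proof -
  interpret t: periodic_fun_simple "\<lambda>t. f (t, x)" "2 * pi" for x
    using assms by unfold_locales (simp add: periodic2_def)
  interpret x: periodic_fun_simple "\<lambda>x. f (t, x)" "2 * pi" for t
    using assms by unfold_locales (simp add: periodic2_def)
  show ?thesis by (simp only: t.plus_of_int x.plus_of_int)
qed

lemma periodic2_bounded:
  assumes per: "periodic2 f" and f: "continuous_on UNIV f"
  obtains M where "M > 0" "\<And>p. \<bar>f p\<bar> \<le> M"
proof -
  let ?Q = "{0..2 * pi} \<times> {0..2 * pi}"
  have "compact (f ` ?Q)"
    by (intro compact_continuous_image continuous_on_subset[OF f] compact_Times) auto
  then have "bounded (f ` ?Q)" by (rule compact_imp_bounded)
  then obtain M where M: "M > 0" "\<And>p. p \<in> ?Q \<Longrightarrow> \<bar>f p\<bar> \<le> M"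
    unfolding bounded_pos by auto
  have "\<bar>f (t, x)\<bar> \<le> M" for t x
  proof -
    obtain n k where "t + of_int n * (2 * pi) \<in> {0..2 * pi}" "x + of_int k * (2 * pi) \<in> {0..2 * pi}"
      using period_representative by metis
    then have "\<bar>f (t + of_int n * (2 * pi), x + of_int k * (2 * pi))\<bar> \<le> M" by (intro M) simp
    then show ?thesis by (simp only: periodic2_shift[OF per])
  qed
  then show ?thesis using M(1) that by auto
qed

lemma periodic_derivative:
  fixes f f' :: "real \<Rightarrow> real"
  assumes "\<And>x. (f has_real_derivative f' x) (at x)" "\<And>x. f (x + c) = f x"
  shows "f' (x + c) = f' x"
proof -
  have "((\<lambda>x. f (x + c)) has_real_derivative f' (x + c)) (at x)"
    using assms(1)[of "x + c"] DERIV_shift[of f _ x c] by simp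
  then have "(f has_real_derivative f' (x + c)) (at x)" by (simp add: assms(2))
  then show ?thesis using assms(1) DERIV_unique by blast
qed

lemma periodic2_dx2:
  assumes f: "smooth2 f" and per: "periodic2 f"
  shows "periodic2 (dx2 f)"
  unfolding periodic2_def
proof (intro allI conjI)
  fix t x
  have "((\<lambda>x. f (t, x)) has_real_derivative dx2 f (t + 2 * pi, x)) (at x)"
    using smooth2_DERIV_snd[OF f, of "t + 2 * pi" x UNIV] per by (simp add: periodic2_def)
  then show "dx2 f (t + 2 * pi, x) = dx2 f (t, x)"
    using smooth2_DERIV_snd[OF f] DERIV_unique by blast
  show "dx2 f (t, x + 2 * pi) = dx2 f (t, x)"
    using per by (intro periodic_derivative[OF smooth2_DERIV_snd[OF f]]) (simp add: periodic2_def)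
qed

section \<open>The flow of a periodic vector field\<close>

locale bounded_lipschitz_field =
  fixes F :: "real \<times> real \<Rightarrow> real" and M L :: real
  assumes continuous_field: "continuous_on UNIV F"
    and bounded_field: "\<And>p. \<bar>F p\<bar> \<le> M"
    and Lipschitz_pos: "L > 0"
    and Lipschitz_field: "\<And>t x y. \<bar>F (t, x) - F (t, y)\<bar> \<le> L * \<bar>x - y\<bar>"
begin

definition weight :: "real \<times> real \<Rightarrow> real" where
  "weight p = exp (2 * L * \<bar>fst p\<bar>)"

definition displaced_field :: "(real \<times> real \<Rightarrow> real) \<Rightarrow> real \<times> real \<Rightarrow> real" where
  "displaced_field f p = F (fst p, snd p + weight p * f p)"

text \<open>The unknown is the displacement of the flow divided by the weight; the weight makes the
  Picard operator a contraction for all times at once.\<close>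

definition picard :: "(real \<times> real \<Rightarrow> real) \<Rightarrow> real \<times> real \<Rightarrow> real" where
  "picard f p = primitive_t (displaced_field f) p / weight p"

lemma weight_pos [simp]: "weight p > 0"
  by (simp add: weight_def)

lemma weight_nonzero [simp]: "weight p \<noteq> 0" and abs_weight [simp]: "\<bar>weight p\<bar> = weight p"
  by (simp_all add: weight_def)

lemma continuous_on_weight: "continuous_on S weight"
  unfolding weight_def[abs_def] by (intro continuous_intros)

lemma continuous_on_displaced_field:
  "continuous_on UNIV f \<Longrightarrow> continuous_on UNIV (displaced_field f)"
  unfolding displaced_field_def[abs_def]
  by (intro continuous_on_UNIV_compose[OF continuous_field] continuous_intros continuous_on_weight)

lemma continuous_on_picard: "continuous_on UNIV f \<Longrightarrow> continuous_on UNIV (picard f)"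
  unfolding picard_def[abs_def]
  by (intro continuous_intros continuous_on_primitive_t continuous_on_displaced_field
      continuous_on_weight) auto

lemma picard_bounded:
  assumes "continuous_on UNIV f"
  shows "\<bar>picard f p\<bar> \<le> M / (2 * L)"
proof -
  obtain t x where p: "p = (t, x)" by (cases p)
  have "\<bar>primitive_t (displaced_field f) (t, x) - primitive_t (\<lambda>_. 0) (t, x)\<bar> \<le> M * \<bar>t\<bar> - M * 0"
    by (rule primitive_t_diff_le[OF continuous_on_displaced_field[OF assms], where h="\<lambda>_. M"])
      (auto intro!: derivative_eq_intros bounded_field simp: displaced_field_def)
  then have "\<bar>primitive_t (displaced_field f) p\<bar> \<le> M * \<bar>t\<bar>"
    by (simp add: primitive_t_def p)
  also have "\<dots> \<le> M * (weight p / (2 * L))"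
  proof (rule mult_left_mono)
    have "2 * L * \<bar>t\<bar> \<le> weight p"
      using exp_ge_add_one_self[of "2 * L * \<bar>t\<bar>"] unfolding weight_def p fst_conv by linarith
    then show "\<bar>t\<bar> \<le> weight p / (2 * L)" using Lipschitz_pos by (simp add: field_simps)
    show "0 \<le> M" using bounded_field[of 0] by linarith
  qed
  finally show ?thesis using Lipschitz_pos by (simp add: picard_def field_simps)
qed

lemma picard_contraction:
  assumes f: "continuous_on UNIV f" and g: "continuous_on UNIV g" and D: "\<And>q. \<bar>f q - g q\<bar> \<le> D"
  shows "\<bar>picard f p - picard g p\<bar> \<le> D / 2"
proof -
  obtain t x where p: "p = (t, x)" by (cases p)
  have "\<bar>displaced_field f q - displaced_field g q\<bar> \<le> L * D * weight q" for q
  proof -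
    have "\<bar>displaced_field f q - displaced_field g q\<bar>
        \<le> L * \<bar>(snd q + weight q * f q) - (snd q + weight q * g q)\<bar>"
      unfolding displaced_field_def by (rule Lipschitz_field)
    also have "\<dots> = L * weight q * \<bar>f q - g q\<bar>"
      by (simp add: right_diff_distrib[symmetric] abs_mult)
    also have "\<dots> \<le> L * weight q * D"
      using Lipschitz_pos D by (intro mult_left_mono) (auto simp: less_imp_le)
    finally show ?thesis by (simp add: mult_ac)
  qed
  then have "\<bar>primitive_t (displaced_field f) (t, x) - primitive_t (displaced_field g) (t, x)\<bar>
      \<le> D / 2 * exp (2 * L * \<bar>t\<bar>) - D / 2 * exp (2 * L * 0)"
    by (intro primitive_t_diff_le[where h="\<lambda>s. L * D * exp (2 * L * s)"])
      (auto intro!: continuous_on_displaced_field f g continuous_intros derivative_eq_intros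
        simp: weight_def)
  also have "\<dots> \<le> D / 2 * weight p"
    using D[of p] by (simp add: weight_def p)
  finally show ?thesis
    using weight_pos[of p] by (simp add: picard_def p field_simps flip: diff_divide_distrib)
qed

lemma integral_equation_solvable:
  "\<exists>\<Phi>. continuous_on UNIV \<Phi> \<and> (\<forall>p. \<Phi> p = snd p + primitive_t (\<lambda>q. F (fst q, \<Phi> q)) p)"
proof -
  define P where "P f = Bcontfun (picard (apply_bcontfun f))" for f
  have P: "apply_bcontfun (P f) = picard f" for f
    unfolding P_def
    by (rule Bcontfun_inverse, rule bcontfun_normI)
      (auto intro: continuous_on_picard picard_bounded)
  have "dist (P f) (P g) \<le> 1/2 * dist f g" for f g
  proof (rule dist_bound)
    show "dist (P f p) (P g p) \<le> 1/2 * dist f g" for p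
      using picard_contraction[of f g "dist f g" p] dist_bounded[of f _ g]
      by (simp add: P dist_real_def)
  qed
  then obtain f where f: "P f = f"
    using banach_fix_type[of "1/2" P] by auto
  define \<Phi> where "\<Phi> p = snd p + weight p * f p" for p
  have "\<Phi> p = snd p + primitive_t (\<lambda>q. F (fst q, \<Phi> q)) p" for p
    using arg_cong[OF f, of "\<lambda>f. f p"]
    by (simp add: P picard_def \<Phi>_def displaced_field_def[abs_def] field_simps)
  moreover have "continuous_on UNIV \<Phi>"
    unfolding \<Phi>_def[abs_def] by (intro continuous_intros continuous_on_weight) auto
  ultimately show ?thesis by blast
qed

end

lemma linear_ode_solution:
  fixes d b B :: "real \<Rightarrow> real"
  assumes B: "\<And>t. (B has_real_derivative b t) (at t)"
    and d: "\<And>t. (d has_real_derivative b t * d t) (at t)"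
  shows "d t = d 0 * exp (B t - B 0)"
proof -
  have "((\<lambda>t. d t * exp (- B t)) has_real_derivative 0) (at t)" for t
    by (rule derivative_eq_intros d B refl)+ (simp add: algebra_simps)
  then have "d t * exp (- B t) = d 0 * exp (- B 0)"
    by (meson DERIV_isconst_all)
  then show ?thesis by (simp add: exp_minus exp_diff field_simps)
qed

definition mean_slope :: "(real \<times> real \<Rightarrow> real) \<Rightarrow> real \<Rightarrow> real \<Rightarrow> real \<Rightarrow> real" where
  "mean_slope F t y z = integral {0..1} (\<lambda>\<theta>. dx2 F (t, y + \<theta> * (z - y)))"

lemma mean_slope_same [simp]: "mean_slope F t y y = dx2 F (t, y)"
  by (simp add: mean_slope_def)

lemma mean_slope_eq:
  assumes "smooth2 F"
  shows "F (t, z) - F (t, y) = mean_slope F t y z * (z - y)"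
proof -
  have "((\<lambda>s. F (t, y + s)) has_real_derivative dx2 F (t, y + s)) (at s)" for s
    using smooth2_DERIV_snd[OF assms, of t "y + s" UNIV] DERIV_shift[of "\<lambda>x. F (t, x)" _ s y]
    by (simp add: add.commute)
  from rescaled_integral_eq[OF this, of "z - y"] show ?thesis
    by (simp add: mean_slope_def mult.commute)
qed

lemma continuous_on_mean_slope:
  fixes y z :: "real \<times> real \<Rightarrow> real"
  assumes F: "smooth2 F" and y: "continuous_on UNIV y" and z: "continuous_on UNIV z"
  shows "continuous_on UNIV (\<lambda>p. mean_slope F (fst p) (y p) (z p))"
proof -
  have "continuous_on UNIV
      (\<lambda>p. integral (cbox 0 1) (\<lambda>\<theta>. dx2 F (fst p, y p + \<theta> * (z p - y p))))"
    by (rule integral_continuous_on_param[where f="\<lambda>p \<theta>. dx2 F (fst p, y p + \<theta> * (z p - y p))"])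
      (auto simp: split_beta intro!: smooth2_continuous_compose[OF smooth2_dx2[OF F]]
        continuous_intros continuous_on_UNIV_compose[OF y] continuous_on_UNIV_compose[OF z])
  then show ?thesis by (simp add: mean_slope_def)
qed

lemma ode_solutions_difference:
  assumes F: "smooth2 F"
    and y: "\<And>t. (y has_real_derivative F (t, y t)) (at t)"
    and z: "\<And>t. (z has_real_derivative F (t, z t)) (at t)"
  shows "z t - y t =
    (z 0 - y 0) * exp (primitive_t (\<lambda>p. mean_slope F (fst p) (y (fst p)) (z (fst p))) (t, x))"
proof -
  let ?b = "\<lambda>p :: real \<times> real. mean_slope F (fst p) (y (fst p)) (z (fst p))"
  have yz: "continuous_on UNIV y" "continuous_on UNIV z"
    using y z by (meson DERIV_isCont continuous_at_imp_continuous_on)+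
  have "continuous_on UNIV ?b"
    by (intro continuous_on_mean_slope F continuous_on_UNIV_compose[OF yz(1)]
        continuous_on_UNIV_compose[OF yz(2)] continuous_intros)
  from primitive_t_DERIV_fst[OF this, of x]
  have "((\<lambda>t. primitive_t ?b (t, x)) has_real_derivative mean_slope F t (y t) (z t)) (at t)" for t
    by simp
  moreover have "((\<lambda>t. z t - y t) has_real_derivative
      mean_slope F t (y t) (z t) * (z t - y t)) (at t)" for t
    by (rule derivative_eq_intros y z)+ (simp add: mean_slope_eq[OF F])
  ultimately show ?thesis
    using linear_ode_solution[of "\<lambda>t. primitive_t ?b (t, x)" "\<lambda>t. mean_slope F t (y t) (z t)"
        "\<lambda>t. z t - y t" t] by simp
qed

definition flow :: "(real \<times> real \<Rightarrow> real) \<Rightarrow> real \<times> real \<Rightarrow> real" where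
  "flow F = (SOME \<Phi>. continuous_on UNIV \<Phi> \<and>
     (\<forall>p. \<Phi> p = snd p + primitive_t (\<lambda>q. F (fst q, \<Phi> q)) p))"

definition log_jacobian :: "(real \<times> real \<Rightarrow> real) \<Rightarrow> real \<times> real \<Rightarrow> real" where
  "log_jacobian F = primitive_t (\<lambda>p. dx2 F (fst p, flow F p))"

definition inverse_flow :: "(real \<times> real \<Rightarrow> real) \<Rightarrow> real \<times> real \<Rightarrow> real" where
  "inverse_flow F p = (THE z. flow F (fst p, z) = snd p)"

locale periodic_vector_field =
  fixes F :: "real \<times> real \<Rightarrow> real"
  assumes smooth_field: "smooth2 F" and periodic_field: "periodic2 F"
begin

lemma continuous_on_flow: "continuous_on UNIV (flow F)"
  and flow_integral_equation: "flow F p = snd p + primitive_t (\<lambda>q. F (fst q, flow F q)) p"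
proof -
  obtain M where M: "\<And>p. \<bar>F p\<bar> \<le> M"
    using periodic2_bounded[OF periodic_field smooth2_continuous[OF smooth_field]] by blast
  obtain L where L: "L > 0" "\<And>p. \<bar>dx2 F p\<bar> \<le> L"
    using periodic2_bounded periodic2_dx2 smooth2_dx2 smooth2_continuous smooth_field periodic_field
    by metis
  interpret bounded_lipschitz_field F M L
  proof
    show "\<bar>F (t, x) - F (t, y)\<bar> \<le> L * \<bar>x - y\<bar>" for t x y
      using field_differentiable_bound[of UNIV "\<lambda>x. F (t, x)" "\<lambda>x. dx2 F (t, x)" L x y] L
        smooth2_DERIV_snd[OF smooth_field] by auto
  qed (use M L smooth2_continuous[OF smooth_field] in auto)
  show "continuous_on UNIV (flow F)"
    "flow F p = snd p + primitive_t (\<lambda>q. F (fst q, flow F q)) p"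
    using someI_ex[OF integral_equation_solvable] unfolding flow_def by blast+
qed

lemma flow_0 [simp]: "flow F (0, z) = z"
  using flow_integral_equation[of "(0, z)"] by simp

lemma flow_DERIV_fst: "((\<lambda>t. flow F (t, z)) has_real_derivative F (t, flow F (t, z))) (at t)"
proof -
  have "continuous_on UNIV (\<lambda>q. F (fst q, flow F q))"
    by (intro smooth2_continuous_compose[OF smooth_field] continuous_intros continuous_on_flow)
  then show ?thesis
    by (subst flow_integral_equation)
      (auto intro!: derivative_eq_intros primitive_t_DERIV_fst[THEN DERIV_cong])
qed

lemma flow_DERIV_snd:
  "((\<lambda>z. flow F (t, z)) has_real_derivative exp (log_jacobian F (t, z))) (at z)"
proof -
  define b where "b = (\<lambda>p. mean_slope F (fst p) (flow F (fst p, z)) (flow F p))"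
  have "continuous_on UNIV b"
    unfolding b_def
    by (intro continuous_on_mean_slope smooth_field continuous_on_flow
        continuous_on_UNIV_compose[OF continuous_on_flow] continuous_intros)
  then have "isCont (\<lambda>z'. exp (primitive_t b (t, z'))) z"
    by (intro continuous_on_interior[of UNIV] continuous_intros
        continuous_on_UNIV_compose[OF continuous_on_primitive_t]) auto
  then have "(\<lambda>z'. exp (primitive_t b (t, z'))) \<midarrow>z\<rightarrow> exp (primitive_t b (t, z))"
    by (simp add: isCont_def)
  moreover have "flow F (t, z') - flow F (t, z) = (z' - z) * exp (primitive_t b (t, z'))" for z'
    using ode_solutions_difference[OF smooth_field flow_DERIV_fst flow_DERIV_fst, of t z' z z']
    by (simp add: b_def primitive_t_def)
  ultimately have "(\<lambda>z'. (flow F (t, z') - flow F (t, z)) / (z' - z))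
      \<midarrow>z\<rightarrow> exp (primitive_t b (t, z))"
    by (elim Lim_transform_eventually) (auto simp: eventually_at_filter)
  moreover have "primitive_t b (t, z) = log_jacobian F (t, z)"
    by (simp add: log_jacobian_def b_def primitive_t_def)
  ultimately show ?thesis by (simp add: has_field_derivative_iff)
qed

lemma has_partials_flow:
  "has_partials (flow F) (\<lambda>p. F (fst p, flow F p)) (\<lambda>p. exp (log_jacobian F p))"
proof (rule has_partialsI)
  show "continuous_on UNIV (\<lambda>p. exp (log_jacobian F p))"
    unfolding log_jacobian_def
    by (intro continuous_intros continuous_on_primitive_t
        smooth2_continuous_compose[OF smooth2_dx2[OF smooth_field]] continuous_on_flow)
qed (auto intro: flow_DERIV_fst flow_DERIV_snd)

lemma smooth2_flow: "smooth2 (flow F)"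
proof (rule smooth2_bootstrap[OF has_partials_flow])
  fix n assume flow: "Ck2 n (flow F)"
  have F: "Ck2 n F" "Ck2 n (dx2 F)"
    using smooth_field smooth2_dx2[OF smooth_field] by (auto simp: smooth2_def)
  show "Ck2 n (\<lambda>p. F (fst p, flow F p))"
    by (rule Ck2_compose[OF F(1) Ck2_fst flow])
  show "Ck2 n (\<lambda>p. exp (log_jacobian F p))"
    unfolding log_jacobian_def
    by (rule Ck2_exp, rule Ck2_primitive_t, rule Ck2_compose[OF F(2) Ck2_fst flow])
qed

lemma smooth2_along_flow: "smooth2 G \<Longrightarrow> smooth2 (\<lambda>p. G (fst p, flow F p))"
  by (rule smooth2_compose[OF _ smooth2_fst smooth2_flow])

lemma smooth2_log_jacobian: "smooth2 (log_jacobian F)"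
  unfolding log_jacobian_def
  by (rule smooth2_primitive_t, rule smooth2_along_flow, rule smooth2_dx2, rule smooth_field)

lemma log_jacobian_0 [simp]: "log_jacobian F (0, z) = 0"
  by (simp add: log_jacobian_def)

lemma log_jacobian_DERIV_fst:
  "((\<lambda>t. log_jacobian F (t, z)) has_real_derivative dx2 F (t, flow F (t, z))) (at t)"
proof -
  have "continuous_on UNIV (\<lambda>p. dx2 F (fst p, flow F p))"
    by (rule smooth2_continuous[OF smooth2_along_flow[OF smooth2_dx2[OF smooth_field]]])
  from primitive_t_DERIV_fst[OF this, of z t] show ?thesis by (simp add: log_jacobian_def)
qed

lemma flow_add_2pi: "flow F (t, z + 2 * pi) = flow F (t, z) + 2 * pi"
proof -
  have "F (t, flow F (t, z + 2 * pi) - 2 * pi) = F (t, flow F (t, z + 2 * pi))" for t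
    using periodic_field unfolding periodic2_def by (metis diff_add_cancel)
  then have "((\<lambda>t. flow F (t, z + 2 * pi) - 2 * pi) has_real_derivative
      F (t, flow F (t, z + 2 * pi) - 2 * pi)) (at t)" for t
    by (auto intro!: derivative_eq_intros flow_DERIV_fst[THEN DERIV_cong])
  from ode_solutions_difference[OF smooth_field flow_DERIV_fst[of z] this, of t 0]
  show ?thesis by simp
qed

lemma log_jacobian_periodic: "log_jacobian F (t, z + 2 * pi) = log_jacobian F (t, z)"
proof -
  have "dx2 F (\<tau>, flow F (\<tau>, z + 2 * pi)) = dx2 F (\<tau>, flow F (\<tau>, z))" for \<tau>
    using periodic2_dx2[OF smooth_field periodic_field] by (simp add: flow_add_2pi periodic2_def)
  then show ?thesis by (simp add: log_jacobian_def primitive_t_def)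
qed

lemma flow_eq_iff: "flow F (t, y) = flow F (t, z) \<longleftrightarrow> y = z"
proof -
  have "flow F (t, y) < flow F (t, z)" if "y < z" for y z
    using that
    by (rule DERIV_pos_imp_increasing[of y z "\<lambda>z. flow F (t, z)"]) (auto intro!: exI flow_DERIV_snd)
  then show ?thesis by (metis less_irrefl linorder_less_linear)
qed

lemma flow_surj: "\<exists>z. flow F (t, z) = x"
proof -
  interpret displacement: periodic_fun_simple "\<lambda>z. flow F (t, z) - z" "2 * pi"
    by unfold_locales (simp add: flow_add_2pi)
  have multiple: "flow F (t, of_int k * (2 * pi)) = flow F (t, 0) + of_int k * (2 * pi)" for k
    using displacement.plus_of_int[of 0 k] by simp
  obtain n :: int where n: "(x - flow F (t, 0)) + of_int n * (2 * pi) \<in> {0..2 * pi}"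
    using period_representative by blast
  have "\<exists>z\<ge>of_int (- n) * (2 * pi). z \<le> of_int (1 - n) * (2 * pi) \<and> flow F (t, z) = x"
  proof (rule IVT)
    show "flow F (t, of_int (- n) * (2 * pi)) \<le> x" "x \<le> flow F (t, of_int (1 - n) * (2 * pi))"
      unfolding multiple using n by (auto simp: algebra_simps)
    show "of_int (- n) * (2 * pi) \<le> of_int (1 - n) * (2 * pi)"
      by (intro mult_right_mono) auto
  qed (auto intro!: DERIV_isCont flow_DERIV_snd)
  then show ?thesis by blast
qed

lemma flow_inverse_flow [simp]: "flow F (t, inverse_flow F (t, x)) = x"
proof -
  have "\<exists>!z. flow F (t, z) = x" using flow_surj flow_eq_iff by metis
  from theI'[OF this] show ?thesis by (simp add: inverse_flow_def)
qed

lemma inverse_flow_flow [simp]: "inverse_flow F (t, flow F (t, z)) = z"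
  using flow_eq_iff flow_inverse_flow by blast

lemma inverse_flow_0 [simp]: "inverse_flow F (0, x) = x"
  using inverse_flow_flow[of 0 x] by simp

lemma inverse_flow_add_2pi: "inverse_flow F (t, x + 2 * pi) = inverse_flow F (t, x) + 2 * pi"
  by (metis flow_add_2pi flow_inverse_flow inverse_flow_flow)

lemma has_partials_inverse_flow:
  "has_partials (inverse_flow F)
     (\<lambda>p. - F p * exp (- log_jacobian F (fst p, inverse_flow F p)))
     (\<lambda>p. exp (- log_jacobian F (fst p, inverse_flow F p)))"
  unfolding has_partials_def split_paired_All
proof (intro allI)
  fix t x
  define z where "z = inverse_flow F (t, x)"
  define J where "J = log_jacobian F (t, z)"
  let ?G = "\<lambda>p. (fst p, flow F p)" and ?H = "\<lambda>p. (fst p, inverse_flow F p)"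
  have "(?G has_derivative (\<lambda>h. (fst h, F (t, x) * fst h + exp J * snd h))) (at (t, z))"
    using has_partialsD[OF has_partials_flow, of "(t, z)"]
    by (intro has_derivative_Pair has_derivative_fst) (auto simp: z_def J_def)
  then have "(?H has_derivative (\<lambda>h. (fst h, exp (- J) * (snd h - F (t, x) * fst h))))
      (at (?G (t, z)))"
    by (rule has_derivative_inverse_strong[OF open_UNIV UNIV_I, rotated 2])
      (auto simp: fun_eq_iff algebra_simps simp flip: exp_add
        intro!: continuous_intros smooth2_continuous smooth2_fst smooth2_flow)
  from has_derivative_snd[OF this]
  show "(inverse_flow F has_derivative
      (\<lambda>h. - F (t, x) * exp (- log_jacobian F (fst (t, x), inverse_flow F (t, x))) * fst h +
           exp (- log_jacobian F (fst (t, x), inverse_flow F (t, x))) * snd h)) (at (t, x))"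
    by (simp add: z_def J_def algebra_simps)
qed

lemma smooth2_inverse_flow: "smooth2 (inverse_flow F)"
proof (rule smooth2_bootstrap[OF has_partials_inverse_flow])
  fix n assume inverse_flow: "Ck2 n (inverse_flow F)"
  have F: "Ck2 n (\<lambda>p. - F p)" "Ck2 n (\<lambda>p. - log_jacobian F p)"
    using smooth_field smooth2_log_jacobian by (auto simp: smooth2_def intro: Ck2_uminus)
  show "Ck2 n (\<lambda>p. exp (- log_jacobian F (fst p, inverse_flow F p)))"
    by (rule Ck2_exp, rule Ck2_compose[OF F(2) Ck2_fst inverse_flow])
  then show "Ck2 n (\<lambda>p. - F p * exp (- log_jacobian F (fst p, inverse_flow F p)))"
    by (rule Ck2_mult[OF F(1)])
qed

end

section \<open>Fourier coefficients\<close>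

definition character :: "int \<Rightarrow> real \<Rightarrow> complex" where
  "character k x = cis (of_int k * x)"

lemma character_0 [simp]: "character 0 x = 1"
  by (simp add: character_def)

lemma norm_character [simp]: "cmod (character k x) = 1"
  by (simp add: character_def)

lemma character_nonzero [simp]: "character k x \<noteq> 0"
  by (simp add: character_def)

lemma character_add: "character (k + l) x = character k x * character l x"
  by (simp add: character_def cis_mult algebra_simps)

lemma character_add_right: "character k (x + y) = character k x * character k y"
  by (simp add: character_def cis_mult algebra_simps)

lemma character_2pi [simp]: "character k (2 * pi) = 1"
  using cis_multiple_2pi[of "of_int k"] by (simp add: character_def mult_ac)

lemma cnj_character: "cnj (character k x) = character (- k) x"
  by (simp add: character_def cis_cnj)

lemma character_pi_div:
  assumes "k \<noteq> 0"
  shows "character k (pi / \<bar>of_int k\<bar>) = - 1"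
  using assms by (cases "k > 0") (simp_all add: character_def complex_eq_iff)

lemma character_1_eq_iff: "character 1 x = character 1 y \<longleftrightarrow> (\<exists>n::int. x = y + of_int n * (2 * pi))"
proof -
  have "character 1 x = character 1 y
      \<longleftrightarrow> (\<exists>n::int. \<i> * of_real x = \<i> * of_real y + (of_int (2 * n) * of_real pi) * \<i>)"
    by (simp add: character_def cis_conv_exp exp_eq)
  also have "\<dots> \<longleftrightarrow> (\<exists>n::int. x = y + of_int n * (2 * pi))"
    by (simp add: complex_eq_iff mult_ac)
  finally show ?thesis .
qed

lemma continuous_on_character [continuous_intros]:
  "continuous_on S f \<Longrightarrow> continuous_on S (\<lambda>x. character k (f x))"
  unfolding character_def by (intro continuous_intros)

lemma character_has_vector_derivative:
  "(character k has_vector_derivative \<i> * of_int k * character k x) (at x within S)"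
proof -
  have "((\<lambda>x. exp (\<i> * of_int k * of_real x)) has_vector_derivative
      \<i> * of_int k * exp (\<i> * of_int k * of_real x)) (at x within S)"
    by (auto intro!: derivative_eq_intros has_vector_derivative_real_field)
  then show ?thesis
    by (simp add: character_def[abs_def] cis_conv_exp mult.assoc)
qed

lemma continuous_imp_set_integrable:
  fixes f :: "real \<Rightarrow> 'a::{banach, second_countable_topology}"
  shows "continuous_on UNIV f \<Longrightarrow> set_integrable lborel {a..b} f"
  by (intro borel_integrable_atLeastAtMost') (blast intro: continuous_on_subset)

lemma set_integrable_continuous_mult:
  fixes A w :: "real \<Rightarrow> complex"
  assumes A: "continuous_on UNIV A" and w: "set_integrable lborel {a..b} w"
  shows "set_integrable lborel {a..b} (\<lambda>x. A x * w x)"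
proof -
  have "bounded (A ` {a..b})"
    by (intro compact_imp_bounded compact_continuous_image continuous_on_subset[OF A]) auto
  then obtain M where M: "\<And>x. x \<in> {a..b} \<Longrightarrow> cmod (A x) \<le> M"
    unfolding bounded_iff by (metis imageI)
  have "set_integrable lborel {a..b} (\<lambda>x. of_real M * w x)"
    using w by simp
  then show ?thesis
  proof (rule set_integrable_bound)
    have "A \<in> borel_measurable lborel"
      using borel_measurable_continuous_onI[OF A] by simp
    moreover have "(\<lambda>x. A x * (indicator {a..b} x *\<^sub>R w x))
        = (\<lambda>x. indicator {a..b} x *\<^sub>R (A x * w x))"
      by auto
    ultimately show "set_borel_measurable lborel {a..b} (\<lambda>x. A x * w x)"
      using borel_measurable_times[of A lborel "\<lambda>x. indicator {a..b} x *\<^sub>R w x"] w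
      unfolding set_borel_measurable_def set_integrable_def by simp
    show "AE x in lborel. x \<in> {a..b} \<longrightarrow> norm (A x * w x) \<le> norm (of_real M * w x)"
      using M by (auto simp: norm_mult intro!: mult_right_mono order_trans[OF _ abs_ge_self])
  qed
qed

lemma fcoef_eq: "fcoef u k = (LINT x:{0..2*pi}|lborel. character (- k) x * u x) / (2 * pi)"
  by (simp add: fcoef_def character_def cis_conv_exp mult_ac)

lemma fcoef_eq_integral:
  assumes "continuous_on UNIV u"
  shows "fcoef u k = integral {0..2*pi} (\<lambda>x. character (- k) x * u x) / (2 * pi)"
proof -
  have "set_integrable lborel {0..2*pi} (\<lambda>x. character (- k) x * u x)"
    by (intro continuous_imp_set_integrable continuous_intros assms)
  then show ?thesis by (simp add: fcoef_eq set_borel_integral_eq_integral(2))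
qed

lemma set_integrable_character_mult:
  "set_integrable lborel {a..b} w \<Longrightarrow> set_integrable lborel {a..b} (\<lambda>x. character k x * w x)"
  by (intro set_integrable_continuous_mult continuous_intros)

lemma fcoef_add:
  assumes "set_integrable lborel {0..2*pi} u" "set_integrable lborel {0..2*pi} v"
  shows "fcoef (\<lambda>x. u x + v x) k = fcoef u k + fcoef v k"
  unfolding fcoef_eq distrib_left
  using assms[THEN set_integrable_character_mult] by (simp add: add_divide_distrib)

lemma fcoef_diff:
  assumes "set_integrable lborel {0..2*pi} u" "set_integrable lborel {0..2*pi} v"
  shows "fcoef (\<lambda>x. u x - v x) k = fcoef u k - fcoef v k"
  unfolding fcoef_eq right_diff_distrib
  using assms[THEN set_integrable_character_mult] by (simp add: diff_divide_distrib)

lemma fcoef_cmult: "fcoef (\<lambda>x. c * u x) k = c * fcoef u k"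
  unfolding fcoef_eq mult.left_commute[of _ c] by simp

lemma set_integrable_sum:
  fixes f :: "'i \<Rightarrow> 'a \<Rightarrow> 'b::{banach, second_countable_topology}"
  assumes "\<And>i. i \<in> I \<Longrightarrow> set_integrable M A (f i)"
  shows "set_integrable M A (\<lambda>x. \<Sum>i\<in>I. f i x)"
  using assms unfolding set_integrable_def scaleR_sum_right
  by (intro Bochner_Integration.integrable_sum)

lemma fcoef_sum:
  assumes "finite I" "\<And>i. i \<in> I \<Longrightarrow> set_integrable lborel {0..2*pi} (u i)"
  shows "fcoef (\<lambda>x. \<Sum>i\<in>I. u i x) k = (\<Sum>i\<in>I. fcoef (u i) k)"
  using assms
proof (induction I rule: finite_induct)
  case (insert i I)
  then show ?case by (simp add: fcoef_add set_integrable_sum)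
qed (simp add: fcoef_eq)

lemma fcoef_character_mult: "fcoef (\<lambda>x. character l x * w x) k = fcoef w (k - l)"
  using character_add[of "- k" l] by (simp add: fcoef_eq add.commute mult.assoc[symmetric])

lemma norm_fcoef_le:
  assumes f: "continuous_on UNIV f" and M: "\<And>x. x \<in> {0..2*pi} \<Longrightarrow> cmod (f x) \<le> M"
  shows "cmod (fcoef f k) \<le> M"
proof -
  have "cmod (integral {0..2*pi} (\<lambda>x. character (- k) x * f x)) \<le> M * (2 * pi - 0)"
    by (rule integral_bound)
      (auto simp: norm_mult M intro!: continuous_intros continuous_on_subset[OF f])
  then show ?thesis by (simp add: fcoef_eq_integral[OF f] norm_divide field_simps)
qed

lemma norm_fcoef_mult_le:
  assumes A: "continuous_on UNIV A" and M: "\<And>x. cmod (A x) \<le> M"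
    and w: "set_integrable lborel {0..2*pi} w"
  shows "cmod (fcoef (\<lambda>x. A x * w x) k) \<le> M * (LINT x:{0..2*pi}|lborel. cmod (w x))"
proof -
  have Aw: "set_integrable lborel {0..2*pi} (\<lambda>x. character (- k) x * (A x * w x))"
    by (intro set_integrable_character_mult set_integrable_continuous_mult A w)
  have "cmod (LINT x:{0..2*pi}|lborel. character (- k) x * (A x * w x))
      \<le> (LINT x:{0..2*pi}|lborel. cmod (character (- k) x * (A x * w x)))"
    unfolding set_lebesgue_integral_def
    by (rule order_trans[OF integral_norm_bound]) simp
  also have "\<dots> \<le> (LINT x:{0..2*pi}|lborel. M * cmod (w x))"
    using set_integrable_norm[OF Aw] set_integrable_norm[OF w] M
    by (intro set_integral_mono) (auto simp: norm_mult intro!: mult_right_mono)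
  also have "\<dots> = M * (LINT x:{0..2*pi}|lborel. cmod (w x))" by simp
  finally have "cmod (fcoef (\<lambda>x. A x * w x) k) * (2 * pi)
      \<le> M * (LINT x:{0..2*pi}|lborel. cmod (w x))"
    by (simp add: fcoef_eq norm_divide norm_mult)
  moreover have "cmod (fcoef (\<lambda>x. A x * w x) k) * 1 \<le> cmod (fcoef (\<lambda>x. A x * w x) k) * (2 * pi)"
    using pi_gt3 by (intro mult_left_mono) auto
  ultimately show ?thesis by linarith
qed

lemma cnj_fcoef:
  assumes "continuous_on UNIV u"
  shows "cnj (fcoef u k) = fcoef (\<lambda>x. cnj (u x)) (- k)"
proof -
  have "continuous_on UNIV (\<lambda>x. cnj (u x))" by (intro continuous_intros assms)
  from fcoef_eq_integral[OF this] fcoef_eq_integral[OF assms] show ?thesis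
    by (simp add: integral_cnj cnj_character)
qed

lemma fcoef_derivative:
  assumes f: "\<And>x. (f has_vector_derivative f' x) (at x)" "f (2 * pi) = f 0"
    and f': "continuous_on UNIV f'"
  shows "fcoef f' k = \<i> * of_int k * fcoef f k"
proof -
  let ?e = "character (- k)"
  have cont: "continuous_on UNIV f"
    using f(1) by (meson continuous_at_imp_continuous_on has_vector_derivative_continuous)
  have "((\<lambda>x. ?e x * f' x + \<i> * of_int (- k) * ?e x * f x) has_integral
      ?e (2 * pi) * f (2 * pi) - ?e 0 * f 0) {0..2*pi}"
    by (intro fundamental_theorem_of_calculus has_vector_derivative_mult
        character_has_vector_derivative has_vector_derivative_at_within[OF f(1)]) auto
  moreover have "?e 0 = 1" by (simp add: character_def)
  ultimately have "((\<lambda>x. ?e x * f' x - \<i> * of_int k * (?e x * f x)) has_integral 0) {0..2*pi}"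
    by (simp add: f(2) mult.assoc)
  then have "integral {0..2*pi} (\<lambda>x. ?e x * f' x - \<i> * of_int k * (?e x * f x)) = 0"
    by (rule integral_unique)
  then have "integral {0..2*pi} (\<lambda>x. ?e x * f' x)
      = \<i> * of_int k * integral {0..2*pi} (\<lambda>x. ?e x * f x)"
    by (subst (asm) integral_diff)
      (auto intro!: integrable_continuous_interval continuous_intros integrable_on_mult_right
        continuous_on_subset[OF f'] continuous_on_subset[OF cont])
  then show ?thesis by (simp add: fcoef_eq_integral f' cont)
qed

lemma integral_periodic_shift:
  fixes f :: "real \<Rightarrow> 'a::euclidean_space"
  assumes f: "continuous_on UNIV f" and per: "\<And>x. f (x + 2 * pi) = f x"
  shows "integral {0..2 * pi} (\<lambda>x. f (x + c)) = integral {0..2 * pi} f"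
proof -
  obtain F where F: "\<And>x. (F has_vector_derivative f x) (at x)"
    using antiderivative_exists[OF f] by blast
  have F_shift: "((\<lambda>x. F (x + c)) has_vector_derivative f (x + c)) (at x)" for c x
    using vector_diff_chain_at[of "\<lambda>x. x + c" 1 x F "f (x + c)", OF _ F]
    by (simp add: o_def has_vector_derivative_add_const)
  have integral: "integral {0..2 * pi} (\<lambda>x. f (x + c)) = F (2 * pi + c) - F (0 + c)" for c
    by (intro integral_unique fundamental_theorem_of_calculus
        has_vector_derivative_at_within[OF F_shift]) simp
  have "((\<lambda>c. F (c + 2 * pi) - F c) has_vector_derivative f (x + 2 * pi) - f x) (at x)" for x
    by (intro has_vector_derivative_diff F F_shift)
  then have "F (c + 2 * pi) - F c = F (0 + 2 * pi) - F 0"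
    by (intro has_derivative_zero_unique[of UNIV "\<lambda>c. F (c + 2 * pi) - F c"])
      (auto simp: has_vector_derivative_def per)
  then show ?thesis
    using integral[of c] integral[of 0] by (simp add: add.commute)
qed

lemma fcoef_shift:
  assumes f: "continuous_on UNIV f" and per: "\<And>x. f (x + 2 * pi) = f x"
  shows "fcoef (\<lambda>x. f (x + c)) k = character k c * fcoef f k"
proof -
  have shifted: "continuous_on UNIV (\<lambda>x. f (x + c))"
    by (intro continuous_on_UNIV_compose[OF f] continuous_intros)
  have "character k c * character (- k) (x + c) = character (- k) x" for x
    using character_add[of k "- k" c] by (simp add: character_add_right mult.left_commute)
  then have "integral {0..2*pi} (\<lambda>x. character (- k) x * f (x + c))
      = integral {0..2*pi} (\<lambda>x. character k c * (character (- k) (x + c) * f (x + c)))"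
    by (simp add: mult.assoc[symmetric])
  also have "\<dots> = character k c * integral {0..2*pi} (\<lambda>x. character (- k) (x + c) * f (x + c))"
    by simp
  also have "integral {0..2*pi} (\<lambda>x. character (- k) (x + c) * f (x + c))
      = integral {0..2*pi} (\<lambda>x. character (- k) x * f x)"
    by (intro integral_periodic_shift)
      (auto simp: per character_add_right intro!: continuous_intros f)
  finally show ?thesis by (simp add: fcoef_eq_integral f shifted)
qed

lemma fcoef_const: "fcoef (\<lambda>x. c) k = (if k = 0 then c else 0)"
proof (cases "k = 0")
  case True
  then show ?thesis by (simp add: fcoef_eq_integral scaleR_conv_of_real)
next
  case False
  have "fcoef (\<lambda>x. 0) k = \<i> * of_int k * fcoef (\<lambda>x. c) k"
    by (rule fcoef_derivative) auto
  moreover have "fcoef (\<lambda>x. 0) k = 0" by (simp add: fcoef_eq)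
  ultimately show ?thesis using False by simp
qed

section \<open>Pointwise Fourier inversion\<close>

lemma riemann_lebesgue:
  assumes f: "continuous_on UNIV f" and per: "\<And>x. f (x + 2 * pi) = f x"
  shows "(fcoef f \<longlongrightarrow> 0) cofinite"
proof (rule tendstoI)
  fix e :: real assume "e > 0"
  have "uniformly_continuous_on {0..3 * pi} f"
    by (intro compact_uniformly_continuous continuous_on_subset[OF f]) auto
  then obtain d where "d > 0"
    and d: "\<And>x y. x \<in> {0..3 * pi} \<Longrightarrow> y \<in> {0..3 * pi} \<Longrightarrow> dist y x < d \<Longrightarrow> dist (f y) (f x) < e"
    using \<open>e > 0\<close> unfolding uniformly_continuous_on_def by metis
  have small: "dist (fcoef f k) 0 < e" if k: "\<bar>k\<bar> > \<lceil>pi / d\<rceil>" "k \<noteq> 0" for k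
  proof -
    define r where "r = pi / \<bar>of_int k\<bar>"
    have "pi / d < \<bar>of_int k\<bar>" "\<bar>real_of_int k\<bar> \<ge> 1" using k by linarith+
    then have r: "0 < r" "r < d" "r \<le> pi" using \<open>d > 0\<close> by (auto simp: r_def field_simps)
    have shifted: "continuous_on UNIV (\<lambda>x. f (x + r))"
      by (intro continuous_on_UNIV_compose[OF f] continuous_intros)
    have "fcoef (\<lambda>x. f x - f (x + r)) k = 2 * fcoef f k"
      using fcoef_diff[OF continuous_imp_set_integrable continuous_imp_set_integrable, OF f shifted]
        character_pi_div[OF k(2)]
      by (simp add: fcoef_shift[OF f per] r_def)
    moreover have "cmod (fcoef (\<lambda>x. f x - f (x + r)) k) \<le> e"
    proof (rule norm_fcoef_le)
      fix x assume "x \<in> {0..2*pi}"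
      then have "dist (f x) (f (x + r)) < e" using r by (intro d) (auto simp: dist_real_def)
      then show "cmod (f x - f (x + r)) \<le> e" by (simp add: dist_norm)
    qed (intro continuous_intros f shifted)
    ultimately show ?thesis using \<open>e > 0\<close> by (simp add: norm_mult)
  qed
  have "{k. \<not> dist (fcoef f k) 0 < e} \<subseteq> {- \<lceil>pi / d\<rceil>..\<lceil>pi / d\<rceil>} \<union> {0}"
    using small by force
  then show "\<forall>\<^sub>F k in cofinite. dist (fcoef f k) 0 < e"
    unfolding eventually_cofinite by (rule finite_subset) simp
qed

lemma tendsto_vector_derivative_quotient:
  fixes f :: "real \<Rightarrow> complex"
  assumes "(f has_vector_derivative D) (at a)"
  shows "((\<lambda>x. (f x - f a) / of_real (x - a)) \<longlongrightarrow> D) (at a)"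
proof -
  have "((\<lambda>x. Re (f x)) has_real_derivative Re D) (at a)"
    "((\<lambda>x. Im (f x)) has_real_derivative Im D) (at a)"
    using assms by (auto simp: has_vector_derivative_complex_iff)
  then show ?thesis
    by (simp add: tendsto_complex_iff has_field_derivative_iff Re_divide_of_real Im_divide_of_real
        del: of_real_diff)
qed

lemma tendsto_character_quotient:
  assumes "(f has_vector_derivative D) (at a)"
  shows "((\<lambda>x. (f x - f a) / (character 1 x - character 1 a)) \<longlongrightarrow> D / (\<i> * character 1 a)) (at a)"
proof (rule Lim_transform_eventually)
  let ?quotient = "\<lambda>f x. (f x - f a) / of_real (x - a)"
  show "((\<lambda>x. ?quotient f x / ?quotient (character 1) x) \<longlongrightarrow> D / (\<i> * character 1 a)) (at a)"
    using character_has_vector_derivative[of 1 a UNIV]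
    by (intro tendsto_divide tendsto_vector_derivative_quotient assms) auto
  show "\<forall>\<^sub>F x in at a. ?quotient f x / ?quotient (character 1) x
      = (f x - f a) / (character 1 x - character 1 a)"
    by (auto simp: eventually_at_filter)
qed

lemma eventually_character_1_neq: "\<forall>\<^sub>F x in at a. character 1 x \<noteq> character 1 a"
proof -
  have "\<forall>\<^sub>F x in at a. x \<in> ball a (2 * pi) - {a}"
    by (intro eventually_at_in_open) auto
  then show ?thesis
  proof eventually_elim
    case (elim x)
    show ?case
    proof
      assume "character 1 x = character 1 a"
      then obtain n :: int where n: "x = a + of_int n * (2 * pi)"
        by (auto simp: character_1_eq_iff)
      then have "\<bar>of_int n :: real\<bar> < 1" using elim by (auto simp: dist_real_def abs_mult)
      then have "n = 0" by linarith
      then show False using n elim by simp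
    qed
  qed
qed

lemma continuous_character_quotient:
  assumes f: "continuous_on UNIV f" "\<And>x. f (x + 2 * pi) = f x"
    and D: "(f has_vector_derivative D) (at a)"
  defines "g \<equiv> (\<lambda>x. if character 1 x = character 1 a then D / (\<i> * character 1 a)
     else (f x - f a) / (character 1 x - character 1 a))"
  shows "continuous_on UNIV g"
proof (intro continuous_at_imp_continuous_on ballI)
  fix x
  interpret g: periodic_fun_simple g "2 * pi"
    by unfold_locales (simp add: g_def f(2) character_add_right)
  have "\<forall>\<^sub>F x in at a. (f x - f a) / (character 1 x - character 1 a) = g x"
    using eventually_character_1_neq by eventually_elim (simp add: g_def)
  with tendsto_character_quotient[OF D] have continuous_at_a: "isCont g a"
    unfolding isCont_def
    by (rule Lim_transform_eventually[THEN tendsto_eq_rhs]) (simp add: g_def)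
  show "isCont g x"
  proof (cases "character 1 x = character 1 a")
    case True
    then obtain n :: int where "x = a + of_int n * (2 * pi)" by (auto simp: character_1_eq_iff)
    with continuous_at_a have "isCont (\<lambda>y. g (y + of_int (- n) * (2 * pi))) x"
      by (intro continuous_at_compose[of x "\<lambda>y. y + of_int (- n) * (2 * pi)" g, unfolded o_def]
          continuous_intros) auto
    then show ?thesis by (simp only: g.plus_of_int)
  next
    case False
    have "open {y. character 1 y \<noteq> character 1 a}"
      by (intro open_Collect_neq continuous_intros)
    moreover have "continuous_on {y. character 1 y \<noteq> character 1 a} g"
      by (rule continuous_on_eq[where f="\<lambda>x. (f x - f a) / (character 1 x - character 1 a)"])
        (auto simp: g_def intro!: continuous_intros continuous_on_subset[OF f(1)])
    ultimately show ?thesis using False continuous_on_eq_continuous_at by blast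
  qed
qed

lemma character_quotient_factorization:
  assumes f: "continuous_on UNIV f" "\<And>x. f (x + 2 * pi) = f x"
    and D: "(f has_vector_derivative D) (at a)"
  obtains g where "continuous_on UNIV g" "\<And>x. g (x + 2 * pi) = g x"
    "\<And>x. f x = f a + (character 1 x * g x - character 1 a * g x)"
proof -
  define g where "g = (\<lambda>x. if character 1 x = character 1 a then D / (\<i> * character 1 a)
     else (f x - f a) / (character 1 x - character 1 a))"
  interpret f: periodic_fun_simple f "2 * pi" using f(2) by unfold_locales
  have "f x = f a + (character 1 x * g x - character 1 a * g x)" for x
  proof (cases "character 1 x = character 1 a")
    case True
    then have "f x = f a" by (auto simp: character_1_eq_iff f.plus_of_int)
    with True show ?thesis by simp
  next
    case False
    then have "(character 1 x - character 1 a) * g x = f x - f a" by (simp add: g_def)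
    then show ?thesis by (simp add: left_diff_distrib)
  qed
  moreover have "continuous_on UNIV g"
    unfolding g_def by (rule continuous_character_quotient[OF f D])
  moreover have "g (x + 2 * pi) = g x" for x
    by (simp add: g_def f(2) character_add_right)
  ultimately show ?thesis using that by blast
qed

lemma sum_symmetric_telescope:
  fixes T :: "int \<Rightarrow> 'a::ab_group_add"
  shows "(\<Sum>k\<in>{- int N..int N}. T (k - 1) - T k) = T (- int N - 1) - T (int N)"
proof (induction N)
  case (Suc N)
  have "{- int (Suc N)..int (Suc N)} = insert (- int N - 1) (insert (int N + 1) {- int N..int N})"
    by auto
  then show ?case using Suc by (simp add: algebra_simps)
qed simp

lemma filterlim_inj_cofinite: "inj f \<Longrightarrow> filterlim f cofinite cofinite"
  unfolding filterlim_iff eventually_cofinite by (auto dest: finite_vimageI simp: vimage_def)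

text \<open>Dividing \<open>f - f a\<close> by \<open>e\<^sup>i\<^sup>x - e\<^sup>i\<^sup>a\<close> leaves a continuous function, so that the
  symmetric partial sums of the Fourier series at \<open>a\<close> telescope and the Riemann--Lebesgue lemma
  applies to the two remaining terms.\<close>

lemma fourier_inversion:
  assumes f: "continuous_on UNIV f" "\<And>x. f (x + 2 * pi) = f x"
    and D: "(f has_vector_derivative D) (at a)"
  shows "(\<lambda>N. \<Sum>k\<in>{- int N..int N}. fcoef f k * character k a) \<longlonglongrightarrow> f a"
proof -
  obtain g where g: "continuous_on UNIV g" "\<And>x. g (x + 2 * pi) = g x"
    and f_eq: "\<And>x. f x = f a + (character 1 x * g x - character 1 a * g x)"
    using character_quotient_factorization[OF f D] by blast
  define T where "T k = fcoef g k * character (k + 1) a" for k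
  have "fcoef f k = (if k = 0 then f a else 0) + (fcoef g (k - 1) - character 1 a * fcoef g k)"
    for k
  proof -
    have "fcoef f k = fcoef (\<lambda>x. f a + (character 1 x * g x - character 1 a * g x)) k"
      using f_eq by (rule arg_cong[OF ext])
    then show ?thesis
      by (simp add: fcoef_add fcoef_diff fcoef_const fcoef_cmult fcoef_character_mult
          continuous_imp_set_integrable continuous_intros g(1))
  qed
  then have "fcoef f k * character k a = (if k = 0 then f a else 0) + (T (k - 1) - T k)" for k
    by (cases "k = 0")
      (simp_all add: T_def character_add left_diff_distrib right_diff_distrib mult_ac)
  then have partial_sum:
    "(\<Sum>k\<in>{- int N..int N}. fcoef f k * character k a) = f a + (T (- int N - 1) - T (int N))" for N
    by (simp add: sum.distrib sum_symmetric_telescope)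
  have "((\<lambda>k. cmod (T k)) \<longlongrightarrow> 0) cofinite"
    using riemann_lebesgue[OF g] by (simp add: T_def norm_mult tendsto_norm_zero_iff)
  then have "(T \<longlongrightarrow> 0) cofinite" by (rule tendsto_norm_zero_cancel)
  moreover have "filterlim (\<lambda>N. - int N - 1) cofinite cofinite" "filterlim int cofinite cofinite"
    by (auto intro!: filterlim_inj_cofinite simp: inj_on_def)
  ultimately have "(\<lambda>N. T (- int N - 1)) \<longlonglongrightarrow> 0" "(\<lambda>N. T (int N)) \<longlonglongrightarrow> 0"
    unfolding cofinite_eq_sequentially by (auto intro: filterlim_compose)
  then have "(\<lambda>N. f a + (T (- int N - 1) - T (int N))) \<longlonglongrightarrow> f a + (0 - 0)"
    by (intro tendsto_intros)
  then show ?thesis unfolding partial_sum by simp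
qed

lemma has_sum_imp_symmetric_partial_sums:
  assumes "(c has_sum S) (UNIV :: int set)"
  shows "(\<lambda>N. \<Sum>k\<in>{- int N..int N}. c k) \<longlonglongrightarrow> S"
proof -
  have "(sum c \<longlongrightarrow> S) (finite_subsets_at_top UNIV)" using assms by (simp add: has_sum_def)
  moreover have "filterlim (\<lambda>N. {- int N..int N}) (finite_subsets_at_top UNIV) sequentially"
    unfolding filterlim_finite_subsets_at_top
  proof safe
    fix X :: "int set" assume "finite X"
    have "X \<subseteq> {- int N..int N}" if N: "N \<ge> Max (insert 0 ((\<lambda>k. nat \<bar>k\<bar>) ` X))" for N
    proof
      fix k assume "k \<in> X"
      then have "nat \<bar>k\<bar> \<le> Max (insert 0 ((\<lambda>k. nat \<bar>k\<bar>) ` X))"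
        using \<open>finite X\<close> by (intro Max_ge) auto
      then show "k \<in> {- int N..int N}" using N by auto
    qed
    then show "\<forall>\<^sub>F N in sequentially.
        finite {- int N..int N} \<and> X \<subseteq> {- int N..int N} \<and> {- int N..int N} \<subseteq> UNIV"
      using eventually_sequentially by auto
  qed
  ultimately show ?thesis by (rule filterlim_compose)
qed

lemma fourier_has_sum:
  assumes f: "continuous_on UNIV f" "\<And>x. f (x + 2 * pi) = f x"
    and D: "(f has_vector_derivative D) (at a)"
    and summable: "(\<lambda>k. norm (fcoef f k)) summable_on UNIV"
  shows "((\<lambda>k. fcoef f k * character k a) has_sum f a) UNIV"
proof -
  have "(\<lambda>k. norm (fcoef f k * character k a)) summable_on UNIV"
    using summable by (simp add: norm_mult)
  then have has_sum: "((\<lambda>k. fcoef f k * character k a) has_sum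
      (\<Sum>\<^sub>\<infinity>k. fcoef f k * character k a)) UNIV"
    by (rule has_sum_infsum[OF abs_summable_summable])
  then have "(\<Sum>\<^sub>\<infinity>k. fcoef f k * character k a) = f a"
    by (rule LIMSEQ_unique[OF has_sum_imp_symmetric_partial_sums fourier_inversion[OF f D]])
  with has_sum show ?thesis by simp
qed

section \<open>Convolution\<close>

lemma infsum_Compl_tendsto_0:
  fixes f :: "'a \<Rightarrow> real"
  assumes "f summable_on UNIV"
  shows "((\<lambda>F. infsum f (- F)) \<longlongrightarrow> 0) (finite_subsets_at_top UNIV)"
proof (rule Lim_transform_eventually)
  have "(sum f \<longlongrightarrow> infsum f UNIV) (finite_subsets_at_top UNIV)"
    using has_sum_infsum[OF assms] by (simp add: has_sum_def)
  from tendsto_diff[OF tendsto_const[of "infsum f UNIV"] this]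
  show "((\<lambda>F. infsum f UNIV - sum f F) \<longlongrightarrow> 0) (finite_subsets_at_top UNIV)" by simp
  show "\<forall>\<^sub>F F in finite_subsets_at_top UNIV. infsum f UNIV - sum f F = infsum f (- F)"
  proof (rule eventually_finite_subsets_at_top_weakI)
    fix F :: "'a set" assume "finite F"
    then show "infsum f UNIV - sum f F = infsum f (- F)"
      unfolding Compl_eq_Diff_UNIV using assms by (subst infsum_Diff) auto
  qed
qed

lemma norm_has_sum_tail_le:
  fixes c :: "'a \<Rightarrow> 'b::banach"
  assumes "(c has_sum S) UNIV" "(\<lambda>k. norm (c k)) summable_on UNIV" "finite F"
  shows "norm (S - sum c F) \<le> (\<Sum>\<^sub>\<infinity>k\<in>- F. norm (c k))"
proof -
  have "c summable_on UNIV" using assms(2) by (rule abs_summable_summable)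
  then have "infsum c (- F) = S - sum c F"
    unfolding Compl_eq_Diff_UNIV using assms by (subst infsum_Diff) (auto simp: infsumI)
  moreover have "(\<lambda>k. norm (c k)) summable_on (- F)"
    using assms(2) summable_on_subset_banach by blast
  ultimately show ?thesis by (metis norm_infsum_bound)
qed

lemma fcoef_mult_has_sum:
  assumes A: "continuous_on UNIV A" "\<And>x. ((\<lambda>l. a l * character l x) has_sum A x) UNIV"
    and a: "(\<lambda>l. norm (a l)) summable_on UNIV"
    and w: "set_integrable lborel {0..2*pi} w"
  shows "((\<lambda>l. a l * fcoef w (k - l)) has_sum fcoef (\<lambda>x. A x * w x) k) UNIV"
proof -
  define R where "R F x = A x - (\<Sum>l\<in>F. a l * character l x)" for F x
  define W where "W = (LINT x:{0..2*pi}|lborel. cmod (w x))"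
  have R: "continuous_on UNIV (R F)" for F
    unfolding R_def by (intro continuous_intros A(1))
  have term_integrable: "set_integrable lborel {0..2*pi} (\<lambda>x. a l * (character l x * w x))" for l
    using set_integrable_character_mult[OF w] by simp
  have remainder: "fcoef (\<lambda>x. A x * w x) k - (\<Sum>l\<in>F. a l * fcoef w (k - l))
      = fcoef (\<lambda>x. R F x * w x) k" if "finite F" for F
  proof -
    have "(\<lambda>x. R F x * w x) = (\<lambda>x. A x * w x - (\<Sum>l\<in>F. a l * (character l x * w x)))"
      by (simp add: R_def left_diff_distrib sum_distrib_right mult.assoc)
    moreover have "set_integrable lborel {0..2*pi} (\<lambda>x. \<Sum>l\<in>F. a l * (character l x * w x))"
      using that term_integrable by (intro set_integrable_sum) auto
    ultimately show ?thesis
      using that term_integrable set_integrable_continuous_mult[OF A(1) w]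
      by (simp add: fcoef_diff fcoef_sum fcoef_cmult fcoef_character_mult)
  qed
  have bound: "norm (fcoef (\<lambda>x. R F x * w x) k) \<le> (\<Sum>\<^sub>\<infinity>l\<in>- F. norm (a l)) * W"
    if "finite F" for F
    unfolding W_def
  proof (rule norm_fcoef_mult_le[OF R _ w])
    show "cmod (R F x) \<le> (\<Sum>\<^sub>\<infinity>l\<in>- F. norm (a l))" for x
      using norm_has_sum_tail_le[OF A(2)[of x] _ that] a by (simp add: R_def norm_mult)
  qed
  have "((\<lambda>F. fcoef (\<lambda>x. A x * w x) k - (\<Sum>l\<in>F. a l * fcoef w (k - l))) \<longlongrightarrow> 0)
      (finite_subsets_at_top UNIV)"
  proof (rule Lim_null_comparison)
    show "\<forall>\<^sub>F F in finite_subsets_at_top UNIV.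
        norm (fcoef (\<lambda>x. A x * w x) k - (\<Sum>l\<in>F. a l * fcoef w (k - l)))
        \<le> (\<Sum>\<^sub>\<infinity>l\<in>- F. norm (a l)) * W"
      using remainder bound by (intro eventually_finite_subsets_at_top_weakI) simp
    show "((\<lambda>F. (\<Sum>\<^sub>\<infinity>l\<in>- F. norm (a l)) * W) \<longlongrightarrow> 0) (finite_subsets_at_top UNIV)"
      using tendsto_mult_left_zero[OF infsum_Compl_tendsto_0[OF a]] .
  qed
  from tendsto_diff[OF tendsto_const[of "fcoef (\<lambda>x. A x * w x) k"] this] show ?thesis
    by (simp add: has_sum_def)
qed

section \<open>Smooth families of periodic functions\<close>

definition periodic_snd :: "(real \<times> real \<Rightarrow> real) \<Rightarrow> bool" where
  "periodic_snd f \<longleftrightarrow> (\<forall>t x. f (t, x + 2 * pi) = f (t, x))"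

definition slice_coef :: "(real \<times> real \<Rightarrow> real) \<Rightarrow> real \<Rightarrow> int \<Rightarrow> complex" where
  "slice_coef f t k = fcoef (\<lambda>x. of_real (f (t, x))) k"

lemma periodic2_imp_periodic_snd: "periodic2 f \<Longrightarrow> periodic_snd f"
  by (simp add: periodic2_def periodic_snd_def)

lemma periodic_snd_dx2:
  assumes "smooth2 f" "periodic_snd f"
  shows "periodic_snd (dx2 f)"
  using assms(2) periodic_derivative[OF smooth2_DERIV_snd[OF assms(1)]]
  unfolding periodic_snd_def by blast

lemma periodic_snd_dt2:
  assumes f: "smooth2 f" and per: "periodic_snd f"
  shows "periodic_snd (dt2 f)"
  unfolding periodic_snd_def
proof (intro allI)
  fix t x
  have "((\<lambda>t. f (t, x)) has_real_derivative dt2 f (t, x + 2 * pi)) (at t)"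
    using smooth2_DERIV_fst[OF f, of "x + 2 * pi" t UNIV] per by (simp add: periodic_snd_def)
  then show "dt2 f (t, x + 2 * pi) = dt2 f (t, x)"
    using smooth2_DERIV_fst[OF f] DERIV_unique by blast
qed

lemma continuous_on_slice: "smooth2 f \<Longrightarrow> continuous_on S (\<lambda>x. complex_of_real (f (t, x)))"
  by (intro continuous_intros smooth2_continuous_compose[of f])

lemma slice_has_vector_derivative:
  assumes "smooth2 f"
  shows "((\<lambda>x. complex_of_real (f (t, x))) has_vector_derivative of_real (dx2 f (t, x))) (at x)"
  by (intro has_vector_derivative_of_real smooth2_DERIV_snd assms)

lemma cnj_slice_coef: "smooth2 f \<Longrightarrow> cnj (slice_coef f t k) = slice_coef f t (- k)"
  by (simp add: slice_coef_def cnj_fcoef[OF continuous_on_slice])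

lemma slice_coef_dx2:
  assumes "smooth2 f" "periodic_snd f"
  shows "slice_coef (dx2 f) t k = \<i> * of_int k * slice_coef f t k"
  unfolding slice_coef_def
proof (rule fcoef_derivative)
  show "complex_of_real (f (t, 2 * pi)) = of_real (f (t, 0))"
    using assms(2) unfolding periodic_snd_def by (metis add_0)
  show "continuous_on UNIV (\<lambda>x. complex_of_real (dx2 f (t, x)))"
    by (intro continuous_on_slice smooth2_dx2 assms)
qed (rule slice_has_vector_derivative[OF assms(1)])

lemma slice_coef_has_vector_derivative:
  assumes f: "smooth2 f"
  shows "((\<lambda>t. slice_coef f t k) has_vector_derivative slice_coef (dt2 f) t k) (at t within S)"
proof -
  let ?g = "\<lambda>f t x. character (- k) x * complex_of_real (f (t, x))"
  have coef: "slice_coef f t k = integral (cbox 0 (2*pi)) (?g f t) / (2 * pi)"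
    if "smooth2 f" for f t
    by (simp add: slice_coef_def fcoef_eq_integral[OF continuous_on_slice[OF that]])
  have "((\<lambda>t. integral (cbox 0 (2*pi)) (?g f t)) has_vector_derivative
      integral (cbox 0 (2*pi)) (?g (dt2 f) t)) (at t within UNIV)"
  proof (rule leibniz_rule_vector_derivative)
    show "((\<lambda>t. ?g f t x) has_vector_derivative ?g (dt2 f) t x) (at t within UNIV)" for t x
      by (intro bounded_linear.has_vector_derivative[OF bounded_linear_mult_right]
          has_vector_derivative_of_real smooth2_DERIV_fst f)
    show "?g f t integrable_on cbox 0 (2 * pi)" for t
      by (intro integrable_continuous continuous_intros continuous_on_slice f)
    show "continuous_on (UNIV \<times> cbox 0 (2 * pi)) (\<lambda>(t, x). ?g (dt2 f) t x)"
      unfolding split_beta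
      by (intro continuous_intros smooth2_continuous_compose[OF smooth2_dt2[OF f]])
  qed auto
  from bounded_linear.has_vector_derivative[OF bounded_linear_divide this, of "2 * pi"]
  have "((\<lambda>t. slice_coef f t k) has_vector_derivative slice_coef (dt2 f) t k) (at t)"
    using f smooth2_dt2[OF f] by (simp add: coef)
  then show ?thesis by (rule has_vector_derivative_at_within)
qed

lemma japan_ge_1: "japan k \<ge> 1"
  by (simp add: japan_def)

lemma japan_ge_abs: "japan k \<ge> \<bar>real_of_int k\<bar>"
  unfolding japan_def by (rule real_le_rsqrt) simp

lemma japan_pos [simp]: "japan k > 0" and japan_nonneg [simp]: "japan k \<ge> 0"
  and japan_nonzero [simp]: "japan k \<noteq> 0"
  using japan_ge_1[of k] by linarith+

lemma japan_0 [simp]: "japan 0 = 1"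
  by (simp add: japan_def)

lemma japan_minus [simp]: "japan (- k) = japan k"
  by (simp add: japan_def)

lemma japan_le_twice_abs:
  assumes "k \<noteq> 0"
  shows "japan k \<le> 2 * \<bar>real_of_int k\<bar>"
proof -
  have "1 \<le> \<bar>real_of_int k\<bar>" using assms by linarith
  then have "1 \<le> (real_of_int k)\<^sup>2" using power_mono[of 1 "\<bar>real_of_int k\<bar>" 2] by simp
  then show ?thesis unfolding japan_def by (intro real_le_lsqrt) (auto simp: power_mult_distrib)
qed

lemma japan_powr_square: "(japan k powr r)\<^sup>2 = japan k powr (2 * r)"
  by (simp add: power2_eq_square flip: powr_add)

lemma summable_on_int:
  fixes f :: "int \<Rightarrow> 'a::banach"
  assumes "summable (\<lambda>n. norm (f (int n)))" "summable (\<lambda>n. norm (f (- int n)))"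
  shows "f summable_on UNIV"
proof -
  have nonneg: "f summable_on range int" and nonpos: "f summable_on range (\<lambda>n. - int n)"
    using assms
    by (auto simp: summable_on_reindex o_def inj_on_def intro!: norm_summable_imp_summable_on)
  have "f summable_on (range (\<lambda>n. - int n) - range int)"
    by (rule summable_on_subset_banach[OF nonpos]) auto
  then have "f summable_on (range int \<union> (range (\<lambda>n. - int n) - range int))"
    by (intro summable_on_Un_disjoint nonneg) auto
  moreover have "k \<in> range int \<or> k \<in> range (\<lambda>n. - int n)" for k
    by (cases k rule: int_cases2) auto
  then have "range int \<union> (range (\<lambda>n. - int n) - range int) = UNIV" by blast
  ultimately show ?thesis by simp
qed

lemma summable_on_japan:
  assumes "p > 1"
  shows "(\<lambda>k. japan k powr (- p)) summable_on UNIV"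
proof -
  have "summable (\<lambda>n. norm (japan (int n) powr (- p)))"
  proof (rule summable_comparison_test_ev)
    show "summable (\<lambda>n. real n powr (- p))" using assms by (simp add: summable_real_powr_iff)
    show "\<forall>\<^sub>F n in sequentially. norm (norm (japan (int n) powr (- p))) \<le> real n powr (- p)"
      using eventually_gt_at_top[of 0]
    proof eventually_elim
      case (elim n)
      then show ?case using assms japan_ge_abs[of "int n"] by (auto intro!: powr_mono2')
    qed
  qed
  then show ?thesis by (intro summable_on_int) auto
qed

lemma slice_coef_power_decay:
  assumes "smooth2 f" "periodic_snd f"
  shows "\<exists>C. \<forall>t\<in>{a..b}. \<forall>k. \<bar>real_of_int k\<bar> ^ N * cmod (slice_coef f t k) \<le> C"
  using assms
proof (induction N arbitrary: f)
  case 0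
  have "bounded (f ` ({a..b} \<times> {0..2*pi}))"
    by (intro compact_imp_bounded compact_continuous_image compact_Times
        continuous_on_subset[OF smooth2_continuous[OF 0(1)]]) auto
  then obtain C where C: "\<And>t x. t \<in> {a..b} \<Longrightarrow> x \<in> {0..2*pi} \<Longrightarrow> \<bar>f (t, x)\<bar> \<le> C"
    unfolding bounded_iff by fastforce
  have "cmod (slice_coef f t k) \<le> C" if "t \<in> {a..b}" for t k
    unfolding slice_coef_def using C[OF that] by (intro norm_fcoef_le continuous_on_slice 0) auto
  then show ?case by (intro exI[of _ C]) simp
next
  case (Suc N)
  obtain C where "\<And>t k. t \<in> {a..b} \<Longrightarrow> \<bar>real_of_int k\<bar> ^ N * cmod (slice_coef (dx2 f) t k) \<le> C"
    using Suc.IH[OF smooth2_dx2 periodic_snd_dx2] Suc.prems by blast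
  then show ?case
    by (intro exI[of _ C]) (simp add: slice_coef_dx2 Suc.prems norm_mult mult_ac)
qed

lemma slice_coef_decay:
  assumes "smooth2 f" "periodic_snd f"
  obtains C where "\<And>t k. t \<in> {a..b} \<Longrightarrow> japan k powr r * cmod (slice_coef f t k) \<le> C"
proof -
  define N where "N = nat \<lceil>r\<rceil>"
  have "real N \<ge> r" unfolding N_def by linarith
  obtain C where C: "\<And>t k. t \<in> {a..b} \<Longrightarrow> \<bar>real_of_int k\<bar> ^ N * cmod (slice_coef f t k) \<le> C"
    using slice_coef_power_decay[OF assms] by blast
  obtain C0 where C0: "\<And>t k. t \<in> {a..b} \<Longrightarrow> \<bar>real_of_int k\<bar> ^ 0 * cmod (slice_coef f t k) \<le> C0"
    using slice_coef_power_decay[OF assms] by blast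
  have "japan k powr r * cmod (slice_coef f t k) \<le> max C0 (2 ^ N * C)" if t: "t \<in> {a..b}" for t k
  proof (cases "k = 0")
    case True
    then show ?thesis using C0[OF t, of 0] by simp
  next
    case False
    have "japan k powr r \<le> japan k powr real N"
      using \<open>real N \<ge> r\<close> japan_ge_1 by (intro powr_mono) auto
    also have "\<dots> = japan k ^ N" by (simp add: powr_realpow)
    also have "\<dots> \<le> (2 * \<bar>real_of_int k\<bar>) ^ N" by (intro power_mono japan_le_twice_abs False) simp
    finally have "japan k powr r * cmod (slice_coef f t k)
        \<le> 2 ^ N * (\<bar>real_of_int k\<bar> ^ N * cmod (slice_coef f t k))"
      by (simp add: power_mult_distrib mult_right_mono flip: mult.assoc)
    also have "\<dots> \<le> 2 ^ N * C" using C[OF t, of k] by simp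
    finally show ?thesis by simp
  qed
  then show ?thesis using that by blast
qed

lemma norm_slice_coef_summable:
  assumes "smooth2 f" "periodic_snd f"
  shows "(\<lambda>k. norm (slice_coef f t k)) summable_on UNIV"
proof -
  obtain C where C: "\<And>\<tau> k. \<tau> \<in> {t..t} \<Longrightarrow> japan k powr 2 * cmod (slice_coef f \<tau> k) \<le> C"
    using slice_coef_decay[OF assms] by blast
  have "cmod (slice_coef f t k) \<le> C * japan k powr (- 2)" for k
    using C[of t k] by (simp add: powr_minus_divide field_simps)
  then show ?thesis
    by (intro summable_on_comparison_test[OF summable_on_cmult_right[OF summable_on_japan[of 2]]])
      auto
qed

lemma slice_has_sum:
  assumes "smooth2 f" "periodic_snd f"
  shows "((\<lambda>k. slice_coef f t k * character k x) has_sum of_real (f (t, x))) UNIV"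
  unfolding slice_coef_def
proof (rule fourier_has_sum)
  show "(\<lambda>k. norm (fcoef (\<lambda>x. of_real (f (t, x))) k)) summable_on UNIV"
    using norm_slice_coef_summable[OF assms] by (simp add: slice_coef_def)
qed (use assms in \<open>auto simp: periodic_snd_def simp del: continuous_on_of_real_o_iff
    intro: slice_has_vector_derivative continuous_on_slice\<close>)

section \<open>Sobolev norms\<close>

definition sob_coef :: "real \<Rightarrow> (real \<Rightarrow> complex) \<Rightarrow> int \<Rightarrow> real" where
  "sob_coef s u k = japan k powr s * cmod (fcoef u k)"

lemma sob_coef_nonneg [simp]: "sob_coef s u k \<ge> 0"
  by (simp add: sob_coef_def)

lemma sob_coef_square: "(sob_coef s u k)\<^sup>2 = japan k powr (2 * s) * (cmod (fcoef u k))\<^sup>2"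
  by (simp add: sob_coef_def power_mult_distrib japan_powr_square)

lemma sob_norm_eq: "sob_norm s u = sqrt (\<Sum>\<^sub>\<infinity>k. (sob_coef s u k)\<^sup>2)"
  by (simp add: sob_norm_def sob_coef_square)

lemma sob_norm_nonneg [simp]: "sob_norm s u \<ge> 0"
  by (simp add: sob_norm_eq infsum_nonneg)

lemma in_Hs_iff:
  "in_Hs s u \<longleftrightarrow> (\<forall>x. u (x + 2*pi) = u x) \<and> u \<in> borel_measurable lborel \<and>
     set_integrable lborel {0..2*pi} (\<lambda>x. (cmod (u x))\<^sup>2) \<and>
     (\<lambda>k. (sob_coef s u k)\<^sup>2) summable_on UNIV"
  by (simp add: in_Hs_def sob_coef_square)

lemma in_Hs_set_integrable:
  assumes "in_Hs s u"
  shows "set_integrable lborel {0..2*pi} u"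
proof -
  have u: "u \<in> borel_measurable lborel" "set_integrable lborel {0..2*pi} (\<lambda>x. (cmod (u x))\<^sup>2)"
    using assms by (auto simp: in_Hs_def)
  have "set_integrable lborel {0..2*pi} (\<lambda>x. 1 + (cmod (u x))\<^sup>2)"
    by (intro set_integral_add(1) continuous_imp_set_integrable u continuous_intros)
  then show ?thesis
  proof (rule set_integrable_bound)
    show "set_borel_measurable lborel {0..2*pi} u"
      using u(1) unfolding set_borel_measurable_def by measurable
    have "cmod z \<le> 1 + (cmod z)\<^sup>2" for z
      using sum_squares_bound[of "cmod z" 1] norm_ge_zero[of z] by (simp del: norm_ge_zero)
    then show "AE x in lborel. x \<in> {0..2*pi} \<longrightarrow> norm (u x) \<le> norm (1 + (cmod (u x))\<^sup>2)"
      by simp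
  qed
qed

lemma L2_set_sob_coef_le:
  assumes "in_Hs s u" "finite F"
  shows "L2_set (sob_coef s u) F \<le> sob_norm s u"
  unfolding L2_set_def sob_norm_eq
  using assms by (intro real_sqrt_le_mono finite_sum_le_infsum) (auto simp: in_Hs_iff)

lemma
  assumes le: "\<And>F. finite F \<Longrightarrow> L2_set (sob_coef s u) F \<le> C"
  shows sob_coef_summableI: "(\<lambda>k. (sob_coef s u k)\<^sup>2) summable_on UNIV"
    and sob_norm_leI: "sob_norm s u \<le> C"
proof -
  have sum_le: "(\<Sum>k\<in>F. (sob_coef s u k)\<^sup>2) \<le> C\<^sup>2" if "finite F" for F
    using le[OF that] by (simp add: L2_set_def sqrt_le_D)
  then show summable: "(\<lambda>k. (sob_coef s u k)\<^sup>2) summable_on UNIV"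
    by (intro nonneg_bdd_above_summable_on) (auto intro!: bdd_aboveI2)
  have "(\<Sum>\<^sub>\<infinity>k. (sob_coef s u k)\<^sup>2) \<le> C\<^sup>2"
    by (intro infsum_le_finite_sums summable sum_le)
  then show "sob_norm s u \<le> C"
    using le[of "{}"] by (simp add: sob_norm_eq real_le_lsqrt infsum_nonneg)
qed

lemma L2_set_sob_coef_add_le:
  assumes "in_Hs s u" "in_Hs s v" "finite F"
  shows "L2_set (sob_coef s (\<lambda>x. u x + v x)) F \<le> sob_norm s u + sob_norm s v"
proof -
  have "sob_coef s (\<lambda>x. u x + v x) k \<le> sob_coef s u k + sob_coef s v k" for k
    using norm_triangle_ineq[of "fcoef u k" "fcoef v k"]
    by (simp add: sob_coef_def fcoef_add assms(1,2)[THEN in_Hs_set_integrable] mult_left_mono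
        flip: distrib_left)
  then have "L2_set (sob_coef s (\<lambda>x. u x + v x)) F \<le> L2_set (\<lambda>k. sob_coef s u k + sob_coef s v k) F"
    by (intro L2_set_mono) auto
  also have "\<dots> \<le> L2_set (sob_coef s u) F + L2_set (sob_coef s v) F"
    by (rule L2_set_triangle_ineq)
  also have "\<dots> \<le> sob_norm s u + sob_norm s v"
    using assms by (intro add_mono L2_set_sob_coef_le)
  finally show ?thesis .
qed

lemma in_Hs_add:
  assumes u: "in_Hs s u" and v: "in_Hs s v"
  shows "in_Hs s (\<lambda>x. u x + v x)"
  unfolding in_Hs_iff
proof (intro conjI allI)
  show "u (x + 2 * pi) + v (x + 2 * pi) = u x + v x" for x
    using u v by (simp add: in_Hs_def)
  show measurable: "(\<lambda>x. u x + v x) \<in> borel_measurable lborel"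
    using u v by (auto simp: in_Hs_def)
  have "set_integrable lborel {0..2*pi} (\<lambda>x. 2 * (cmod (u x))\<^sup>2 + 2 * (cmod (v x))\<^sup>2)"
    using u v by (intro set_integral_add(1)) (auto simp: in_Hs_def)
  then show "set_integrable lborel {0..2*pi} (\<lambda>x. (cmod (u x + v x))\<^sup>2)"
  proof (rule set_integrable_bound)
    show "set_borel_measurable lborel {0..2*pi} (\<lambda>x. (cmod (u x + v x))\<^sup>2)"
      using measurable unfolding set_borel_measurable_def by measurable
    have "(cmod (a + b))\<^sup>2 \<le> 2 * (cmod a)\<^sup>2 + 2 * (cmod b)\<^sup>2" for a b
      using power_mono[OF norm_triangle_ineq[of a b], of 2] sum_squares_bound[of "cmod a" "cmod b"]
      by (simp add: power2_sum)
    then show "AE x in lborel. x \<in> {0..2*pi} \<longrightarrow>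
        norm ((cmod (u x + v x))\<^sup>2) \<le> norm (2 * (cmod (u x))\<^sup>2 + 2 * (cmod (v x))\<^sup>2)"
      by simp
  qed
  show "(\<lambda>k. (sob_coef s (\<lambda>x. u x + v x) k)\<^sup>2) summable_on UNIV"
    by (rule sob_coef_summableI[OF L2_set_sob_coef_add_le[OF u v]])
qed

lemma sob_norm_triangle_ineq:
  "in_Hs s u \<Longrightarrow> in_Hs s v \<Longrightarrow> sob_norm s (\<lambda>x. u x + v x) \<le> sob_norm s u + sob_norm s v"
  by (rule sob_norm_leI[OF L2_set_sob_coef_add_le])

lemma sob_coef_uminus: "sob_coef s (\<lambda>x. - u x) k = sob_coef s u k"
  using fcoef_cmult[of "- 1" u k] by (simp add: sob_coef_def)

lemma in_Hs_uminus: "in_Hs s u \<Longrightarrow> in_Hs s (\<lambda>x. - u x)"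
  by (simp add: in_Hs_iff sob_coef_uminus)

lemma sob_norm_uminus: "sob_norm s (\<lambda>x. - u x) = sob_norm s u"
  by (simp add: sob_norm_eq sob_coef_uminus)

lemma in_Hs_diff: "in_Hs s u \<Longrightarrow> in_Hs s v \<Longrightarrow> in_Hs s (\<lambda>x. u x - v x)"
  using in_Hs_add[OF _ in_Hs_uminus, of s u v] by simp

lemma sob_norm_triangle_ineq4:
  "in_Hs s u \<Longrightarrow> in_Hs s v \<Longrightarrow> sob_norm s (\<lambda>x. u x - v x) \<le> sob_norm s u + sob_norm s v"
  using sob_norm_triangle_ineq[OF _ in_Hs_uminus, of s u v] by (simp add: sob_norm_uminus)

lemma sob_norm_minus_commute: "sob_norm s (\<lambda>x. u x - v x) = sob_norm s (\<lambda>x. v x - u x)"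
  using sob_norm_uminus[of s "\<lambda>x. v x - u x"] by simp

lemma abs_sob_norm_diff_le:
  assumes "in_Hs s u" "in_Hs s v"
  shows "\<bar>sob_norm s u - sob_norm s v\<bar> \<le> sob_norm s (\<lambda>x. u x - v x)"
  using sob_norm_triangle_ineq[OF in_Hs_diff[OF assms] assms(2)]
    sob_norm_triangle_ineq[OF in_Hs_diff[OF assms(2,1)] assms(1)]
  by (simp add: sob_norm_minus_commute[of s v u])

lemma sob_norm_cong: "(\<And>k. fcoef u k = fcoef v k) \<Longrightarrow> sob_norm s u = sob_norm s v"
  by (simp add: sob_norm_def)

lemma weighted_fcoef_sum_le:
  assumes "in_Hs s u" "finite F"
  shows "(\<Sum>k\<in>F. japan k powr r * cmod (fcoef u k))
    \<le> sqrt (\<Sum>k\<in>F. japan k powr (- 2 * (s - r))) * sob_norm s u"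
proof -
  have "japan k powr r * cmod (fcoef u k) = japan k powr (r - s) * sob_coef s u k" for k
    by (simp add: sob_coef_def flip: powr_add mult.assoc)
  then have "(\<Sum>k\<in>F. japan k powr r * cmod (fcoef u k))
      \<le> L2_set (\<lambda>k. japan k powr (r - s)) F * L2_set (sob_coef s u) F"
    using L2_set_mult_ineq[of "\<lambda>k. japan k powr (r - s)" "sob_coef s u" F] by simp
  also have "\<dots> \<le> L2_set (\<lambda>k. japan k powr (r - s)) F * sob_norm s u"
    by (intro mult_left_mono L2_set_sob_coef_le assms) simp
  finally show ?thesis by (simp add: L2_set_def japan_powr_square algebra_simps)
qed

lemma
  assumes u: "in_Hs s u" and r: "2 * (s - r) > 1"
  shows weighted_fcoef_summable: "(\<lambda>k. japan k powr r * cmod (fcoef u k)) summable_on A"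
    and weighted_fcoef_infsum_le: "(\<Sum>\<^sub>\<infinity>k\<in>A. japan k powr r * cmod (fcoef u k))
      \<le> sqrt (\<Sum>\<^sub>\<infinity>k\<in>A. japan k powr (- 2 * (s - r))) * sob_norm s u"
proof -
  have "(\<lambda>k. japan k powr (- 2 * (s - r))) summable_on A"
    using summable_on_subset_banach[OF summable_on_japan[OF r], of A] by (simp add: algebra_simps)
  then have partial_sum: "(\<Sum>k\<in>F. japan k powr r * cmod (fcoef u k))
      \<le> sqrt (\<Sum>\<^sub>\<infinity>k\<in>A. japan k powr (- 2 * (s - r))) * sob_norm s u"
    if "finite F" "F \<subseteq> A" for F
    using weighted_fcoef_sum_le[OF u that(1), of r] that
    by (elim order_trans) (intro mult_right_mono real_sqrt_le_mono finite_sum_le_infsum, auto)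
  then show summable: "(\<lambda>k. japan k powr r * cmod (fcoef u k)) summable_on A"
    by (intro nonneg_bdd_above_summable_on) (auto intro!: bdd_aboveI2)
  show "(\<Sum>\<^sub>\<infinity>k\<in>A. japan k powr r * cmod (fcoef u k))
      \<le> sqrt (\<Sum>\<^sub>\<infinity>k\<in>A. japan k powr (- 2 * (s - r))) * sob_norm s u"
    by (intro infsum_le_finite_sums summable partial_sum)
qed

definition sobolev_const :: real where
  "sobolev_const = sqrt (\<Sum>\<^sub>\<infinity>k. japan k powr (- 2))"

lemma sobolev_const_pos: "sobolev_const > 0"
proof -
  have "(\<Sum>k\<in>{0}. japan k powr (- 2)) \<le> (\<Sum>\<^sub>\<infinity>k. japan k powr (- 2))"
    by (intro finite_sum_le_infsum summable_on_japan) auto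
  then show ?thesis by (simp add: sobolev_const_def)
qed

lemma sobolev_embedding:
  assumes f: "in_Hs s f" "continuous_on UNIV f" "(f has_vector_derivative D) (at a)" and s: "s \<ge> 1"
  shows "cmod (f a) \<le> sobolev_const * sob_norm s f"
proof -
  have abs_summable: "(\<lambda>k. cmod (fcoef f k)) summable_on UNIV"
    using weighted_fcoef_summable[OF f(1), of 0 UNIV] s by simp
  have "((\<lambda>k. fcoef f k * character k a) has_sum f a) UNIV"
    using f(1) abs_summable by (intro fourier_has_sum[OF f(2) _ f(3)]) (simp_all add: in_Hs_def)
  then have "cmod (f a) \<le> (\<Sum>\<^sub>\<infinity>k. cmod (fcoef f k))"
    using norm_infsum_bound[of "\<lambda>k. fcoef f k * character k a" UNIV] abs_summable
    by (simp add: infsumI norm_mult)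
  also have "\<dots> \<le> sqrt (\<Sum>\<^sub>\<infinity>k. japan k powr (- 2 * s)) * sob_norm s f"
    using weighted_fcoef_infsum_le[OF f(1), of 0 UNIV] s by simp
  also have "sqrt (\<Sum>\<^sub>\<infinity>k. japan k powr (- 2 * s)) \<le> sobolev_const"
    unfolding sobolev_const_def
  proof (intro real_sqrt_le_mono infsum_mono summable_on_japan)
    show "(\<lambda>k. japan k powr (- 2 * s)) summable_on UNIV"
      using summable_on_japan[of "2 * s"] s by simp
    show "japan k powr (- 2 * s) \<le> japan k powr (- 2)" for k
      using s japan_ge_1 by (intro powr_mono) auto
  qed simp
  finally show ?thesis by (simp add: mult_right_mono)
qed

lemma
  assumes C: "\<And>k. japan k powr (s + 1) * cmod (fcoef u k) \<le> C"
  shows fcoef_decay_imp_sob_coef_summable: "(\<lambda>k. (sob_coef s u k)\<^sup>2) summable_on UNIV"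
    and fcoef_decay_imp_sob_norm_le: "sob_norm s u \<le> C * sobolev_const"
proof -
  have C_nonneg: "0 \<le> C"
    using C[of 0] norm_ge_zero[of "fcoef u 0"] by (simp del: norm_ge_zero)
  have sob_coef_le: "sob_coef s u k \<le> C * japan k powr (- 1)" for k
    using C[of k] by (simp add: sob_coef_def powr_add powr_minus_divide field_simps)
  have bound: "L2_set (sob_coef s u) F \<le> C * sobolev_const" if F: "finite F" for F
  proof -
    have "L2_set (sob_coef s u) F \<le> L2_set (\<lambda>k. C * japan k powr (- 1)) F"
      using sob_coef_le by (intro L2_set_mono) auto
    also have "\<dots> = C * L2_set (\<lambda>k. japan k powr (- 1)) F"
      using C_nonneg by (rule L2_set_right_distrib[symmetric])
    also have "\<dots> \<le> C * sobolev_const"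
      using F C_nonneg unfolding L2_set_def sobolev_const_def japan_powr_square
      by (intro mult_left_mono real_sqrt_le_mono)
        (auto intro!: finite_sum_le_infsum summable_on_japan)
    finally show ?thesis .
  qed
  show "(\<lambda>k. (sob_coef s u k)\<^sup>2) summable_on UNIV" by (rule sob_coef_summableI[OF bound])
  show "sob_norm s u \<le> C * sobolev_const" by (rule sob_norm_leI[OF bound])
qed

lemma slice_in_Hs:
  assumes "smooth2 f" "periodic_snd f"
  shows "in_Hs s (\<lambda>x. of_real (f (t, x)))"
  unfolding in_Hs_iff
proof (intro conjI)
  show "(\<lambda>x. complex_of_real (f (t, x))) \<in> borel_measurable lborel"
    using borel_measurable_continuous_onI[OF continuous_on_slice[OF assms(1)]] by simp
  show "set_integrable lborel {0..2 * pi} (\<lambda>x. (cmod (of_real (f (t, x))))\<^sup>2)"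
    by (intro continuous_imp_set_integrable continuous_intros continuous_on_slice assms)
  obtain C where C:
    "\<And>\<tau> k. \<tau> \<in> {t..t} \<Longrightarrow> japan k powr (s + 1) * cmod (slice_coef f \<tau> k) \<le> C"
    using slice_coef_decay[OF assms] by blast
  show "(\<lambda>k. (sob_coef s (\<lambda>x. of_real (f (t, x))) k)\<^sup>2) summable_on UNIV"
    using C[of t] by (intro fcoef_decay_imp_sob_coef_summable) (simp add: slice_coef_def)
qed (use assms(2) in \<open>simp add: periodic_snd_def\<close>)

lemma vector_differentiable_bound:
  fixes f :: "real \<Rightarrow> 'a::real_normed_vector"
  assumes "convex S" "\<And>x. x \<in> S \<Longrightarrow> (f has_vector_derivative f' x) (at x within S)"
    and "\<And>x. x \<in> S \<Longrightarrow> norm (f' x) \<le> B" "x \<in> S" "y \<in> S"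
  shows "norm (f x - f y) \<le> B * \<bar>x - y\<bar>"
proof -
  have "onorm (\<lambda>h. h *\<^sub>R f' z) \<le> B" if "z \<in> S" for z
    using assms(3)[OF that] by (intro onorm_le) (simp add: mult.commute[of B] mult_left_mono)
  then have "norm (f x - f y) \<le> B * norm (x - y)"
    using assms unfolding has_vector_derivative_def
    by (intro differentiable_bound[of S f "\<lambda>x h. h *\<^sub>R f' x"]) auto
  then show ?thesis by simp
qed

lemma slice_Lipschitz_in_Hs:
  assumes f: "smooth2 f" "periodic_snd f"
  obtains C where "\<And>t t'. t \<in> {a..b} \<Longrightarrow> t' \<in> {a..b} \<Longrightarrow>
     sob_norm s (\<lambda>x. of_real (f (t, x)) - of_real (f (t', x))) \<le> C * \<bar>t - t'\<bar>"
proof -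
  obtain C where C: "\<And>t k. t \<in> {a..b} \<Longrightarrow> japan k powr (s + 1) * cmod (slice_coef (dt2 f) t k) \<le> C"
    using slice_coef_decay[OF smooth2_dt2 periodic_snd_dt2] f by blast
  have "sob_norm s (\<lambda>x. of_real (f (t, x)) - of_real (f (t', x))) \<le> C * sobolev_const * \<bar>t - t'\<bar>"
    if t: "t \<in> {a..b}" "t' \<in> {a..b}" for t t'
  proof -
    let ?c = "\<lambda>k t. japan k powr (s + 1) *\<^sub>R slice_coef f t k"
    have "norm (?c k t - ?c k t') \<le> C * \<bar>t - t'\<bar>" for k
      using C t
      by (intro vector_differentiable_bound[where S="{a..b}"
            and f'="\<lambda>t. japan k powr (s + 1) *\<^sub>R slice_coef (dt2 f) t k"]
          bounded_linear.has_vector_derivative[OF bounded_linear_scaleR_right]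
          slice_coef_has_vector_derivative f) auto
    moreover have "fcoef (\<lambda>x. of_real (f (t, x)) - of_real (f (t', x))) k
        = slice_coef f t k - slice_coef f t' k" for k
      unfolding slice_coef_def
      by (intro fcoef_diff continuous_imp_set_integrable continuous_on_slice f)
    ultimately have "japan k powr (s + 1)
        * cmod (fcoef (\<lambda>x. of_real (f (t, x)) - of_real (f (t', x))) k) \<le> C * \<bar>t - t'\<bar>" for k
      by (simp flip: scaleR_diff_right)
    from fcoef_decay_imp_sob_norm_le[OF this] show ?thesis by (simp add: mult_ac)
  qed
  then show ?thesis using that by blast
qed

lemma slice_continuous_in_Hs:
  assumes f: "smooth2 f" "periodic_snd f"
  shows "((\<lambda>t. sob_norm s (\<lambda>x. of_real (f (t, x)) - of_real (f (t0, x)))) \<longlongrightarrow> 0) (at t0 within S)"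
proof -
  obtain C where C: "\<And>t t'. t \<in> {t0 - 1..t0 + 1} \<Longrightarrow> t' \<in> {t0 - 1..t0 + 1} \<Longrightarrow>
     sob_norm s (\<lambda>x. of_real (f (t, x)) - of_real (f (t', x))) \<le> C * \<bar>t - t'\<bar>"
    using slice_Lipschitz_in_Hs[OF f] by blast
  have "\<forall>\<^sub>F t in at t0 within S. t \<in> ball t0 1"
    unfolding eventually_at_filter
    by (rule eventually_mono[OF eventually_nhds_in_open[of "ball t0 1"]]) auto
  then have "\<forall>\<^sub>F t in at t0 within S.
      norm (sob_norm s (\<lambda>x. of_real (f (t, x)) - of_real (f (t0, x)))) \<le> C * \<bar>t - t0\<bar>"
  proof eventually_elim
    case (elim t)
    then have "t \<in> {t0 - 1..t0 + 1}" by (auto simp: dist_real_def)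
    then show ?case using C[of t t0] by simp
  qed
  moreover have "((\<lambda>t. C * \<bar>t - t0\<bar>) \<longlongrightarrow> C * \<bar>t0 - t0\<bar>) (at t0 within S)"
    by (intro tendsto_intros)
  then have "((\<lambda>t. C * \<bar>t - t0\<bar>) \<longlongrightarrow> 0) (at t0 within S)" by simp
  ultimately show ?thesis by (rule Lim_null_comparison)
qed

lemma sob_norm_one [simp]: "sob_norm s (\<lambda>x. 1) = 1"
proof -
  have "(\<Sum>\<^sub>\<infinity>k. (sob_coef s (\<lambda>x. 1) k)\<^sup>2) = (\<Sum>\<^sub>\<infinity>k\<in>{0}. (sob_coef s (\<lambda>x. 1) k)\<^sup>2)"
    by (intro infsum_cong_neutral) (auto simp: sob_coef_def fcoef_const)
  then show ?thesis by (simp add: sob_norm_eq sob_coef_def fcoef_const)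
qed

section \<open>The transport equation\<close>

text \<open>The Fourier coefficients of \<open>a \<partial>\<^sub>x w + (\<partial>\<^sub>x a) w / 2\<close> in the sense of distributions, obtained
  by writing it as \<open>\<partial>\<^sub>x (a w) - (\<partial>\<^sub>x a) w / 2\<close>.\<close>

definition weak_generator ::
  "(real \<times> real \<Rightarrow> real) \<Rightarrow> real \<Rightarrow> (real \<Rightarrow> complex) \<Rightarrow> int \<Rightarrow> complex" where
  "weak_generator a t w k = \<i> * of_int k * fcoef (\<lambda>x. of_real (a (t, x)) * w x) k
     - fcoef (\<lambda>x. of_real (dx2 a (t, x)) * w x) k / 2"

definition weak_solution ::
  "(real \<times> real \<Rightarrow> real) \<Rightarrow> real \<Rightarrow> (real \<Rightarrow> complex) \<Rightarrow> (real \<Rightarrow> real \<Rightarrow> complex) \<Rightarrow> bool" where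
  "weak_solution a s u0 u \<longleftrightarrow> u 0 = u0 \<and> (\<forall>t\<ge>0. in_Hs s (u t)) \<and>
     (\<forall>t0\<ge>0. ((\<lambda>t. sob_norm s (\<lambda>x. u t x - u t0 x)) \<longlongrightarrow> 0) (at t0 within {0..})) \<and>
     (\<forall>k. \<forall>t\<ge>0. ((\<lambda>t. fcoef (u t) k) has_vector_derivative weak_generator a t (u t) k)
        (at t within {0..}))"

lemma slice_mult_integrable:
  assumes "smooth2 a" "set_integrable lborel {0..2*pi} w"
  shows "set_integrable lborel {0..2*pi} (\<lambda>x. complex_of_real (a (t, x)) * w x)"
  by (rule set_integrable_continuous_mult[OF continuous_on_slice[OF assms(1)] assms(2)])

lemma weak_generator_diff:
  assumes "smooth2 a" "set_integrable lborel {0..2*pi} v" "set_integrable lborel {0..2*pi} w"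
  shows "weak_generator a t (\<lambda>x. v x - w x) k = weak_generator a t v k - weak_generator a t w k"
  unfolding weak_generator_def right_diff_distrib
  by (simp add: fcoef_diff slice_mult_integrable assms smooth2_dx2 right_diff_distrib
      diff_divide_distrib)

lemma has_vector_derivative_cmult_iff:
  fixes f :: "real \<Rightarrow> 'a::real_normed_field"
  assumes "c \<noteq> 0"
  shows "((\<lambda>x. c * f x) has_vector_derivative c * f') F \<longleftrightarrow> (f has_vector_derivative f') F"
proof
  assume "((\<lambda>x. c * f x) has_vector_derivative c * f') F"
  from bounded_linear.has_vector_derivative[OF bounded_linear_mult_right[of "inverse c"] this]
  show "(f has_vector_derivative f') F" using assms by (simp add: mult.assoc[symmetric])
qed (rule bounded_linear.has_vector_derivative[OF bounded_linear_mult_right])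

lemma weak_solution_initial_in_Hs: "weak_solution a s u0 u \<Longrightarrow> in_Hs s u0"
  by (auto simp: weak_solution_def)

lemma weak_pairing_eq_generator:
  fixes m :: nat
  assumes V: "smooth2 V" and w: "set_integrable lborel {0..2*pi} w"
  shows "(LINT x:{0..2*pi}|lborel. w x *
      (- complex_of_real (real m + \<epsilon> * V (t, x)) * (\<i> * of_int k * exp (\<i> * of_int k * of_real x))
       - complex_of_real (\<epsilon> * deriv (\<lambda>y. V (t, y)) x) * exp (\<i> * of_int k * of_real x)
       + complex_of_real (\<epsilon> / 2 * deriv (\<lambda>y. V (t, y)) x) * exp (\<i> * of_int k * of_real x)))
    = 2 * pi * weak_generator (\<lambda>p. real m + \<epsilon> * V p) t w (- k)"
    (is "?L = _")
proof -
  define a where "a p = real m + \<epsilon> * V p" for p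
  have a: "smooth2 a" unfolding a_def[abs_def] by (rule smooth2_affine[OF V])
  have dx2_a: "dx2 a = (\<lambda>p. \<epsilon> * dx2 V p)"
    unfolding a_def[abs_def] by (rule dx2_affine[OF V])
  have "deriv (\<lambda>y. V (t, y)) x = dx2 V (t, x)" for x
    by (rule DERIV_imp_deriv) (rule smooth2_DERIV_snd[OF V])
  then have "?L = (LINT x:{0..2*pi}|lborel.
      - \<i> * of_int k * (character k x * (of_real (a (t, x)) * w x))
      - 1 / 2 * (character k x * (of_real (dx2 a (t, x)) * w x)))"
    by (simp add: a_def dx2_a character_def cis_conv_exp algebra_simps)
  also have "\<dots> = - \<i> * of_int k *
        (LINT x:{0..2*pi}|lborel. character k x * (of_real (a (t, x)) * w x))
      - 1 / 2 * (LINT x:{0..2*pi}|lborel. character k x * (of_real (dx2 a (t, x)) * w x))"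
    unfolding set_integral_mult_right[symmetric]
    by (intro set_integral_diff(2) set_integrable_mult_right set_integrable_character_mult
        slice_mult_integrable a smooth2_dx2 w)
  also have "\<dots> = 2 * pi * weak_generator a t w (- k)"
    by (simp add: weak_generator_def fcoef_eq field_simps)
  finally show ?thesis by (simp add: a_def[abs_def])
qed

lemma is_solution_iff_weak_solution:
  assumes V: "smooth2 V"
  shows "is_solution m \<epsilon> V s u0 u \<longleftrightarrow> weak_solution (\<lambda>p. real m + \<epsilon> * V p) s u0 u"
proof -
  let ?deriv = "\<lambda>t k. ((\<lambda>t. fcoef (u t) k) has_vector_derivative
      weak_generator (\<lambda>p. real m + \<epsilon> * V p) t (u t) k) (at t within {0..})"
  have pairing: "(LINT x:{0..2*pi}|lborel. u \<tau> x * exp (\<i> * of_int k * of_real x))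
      = 2 * pi * fcoef (u \<tau>) (- k)" for \<tau> k
    by (simp add: fcoef_def)
  have "is_solution m \<epsilon> V s u0 u \<longleftrightarrow> u 0 = u0 \<and> (\<forall>t\<ge>0. in_Hs s (u t)) \<and>
      (\<forall>t0\<ge>0. ((\<lambda>t. sob_norm s (\<lambda>x. u t x - u t0 x)) \<longlongrightarrow> 0) (at t0 within {0..})) \<and>
      (\<forall>k. \<forall>t\<ge>0. ?deriv t (- k))"
    unfolding is_solution_def pairing
  proof (intro conj_cong refl all_cong1 imp_cong)
    fix k and t :: real
    assume "\<forall>t\<ge>0. in_Hs s (u t)" "t \<ge> 0"
    then have "set_integrable lborel {0..2*pi} (u t)" using in_Hs_set_integrable by blast
    note pairing_eq = weak_pairing_eq_generator[OF V this, of m \<epsilon> t k]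
    show "((\<lambda>\<tau>. 2 * pi * fcoef (u \<tau>) (- k)) has_vector_derivative
       (LINT x:{0..2*pi}|lborel. u t x *
          (- complex_of_real (real m + \<epsilon> * V (t, x))
             * (\<i> * of_int k * exp (\<i> * of_int k * of_real x))
           - complex_of_real (\<epsilon> * deriv (\<lambda>y. V (t, y)) x) * exp (\<i> * of_int k * of_real x)
           + complex_of_real (\<epsilon> / 2 * deriv (\<lambda>y. V (t, y)) x) * exp (\<i> * of_int k * of_real x))))
       (at t within {0..}) \<longleftrightarrow> ?deriv t (- k)"
      unfolding pairing_eq by (rule has_vector_derivative_cmult_iff) simp
  qed
  also have "(\<forall>k. \<forall>t\<ge>0. ?deriv t (- k)) \<longleftrightarrow> (\<forall>k. \<forall>t\<ge>0. ?deriv t k)"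
    by (metis minus_minus)
  finally show ?thesis by (simp add: weak_solution_def)
qed

locale transport =
  fixes a :: "real \<times> real \<Rightarrow> real"
  assumes smooth_coeff: "smooth2 a" and periodic_coeff: "periodic2 a"

lemma transport_affine: "smooth2 V \<Longrightarrow> periodic2 V \<Longrightarrow> transport (\<lambda>p. c + d * V p)"
  by unfold_locales (auto simp: periodic2_def intro: smooth2_affine)

context transport
begin

sublocale periodic_vector_field "\<lambda>p. - a p"
proof
  show "periodic2 (\<lambda>p. - a p)" using periodic_coeff by (simp add: periodic2_def)
qed (rule smooth2_uminus[OF smooth_coeff])

definition classical_solution :: "real \<times> real \<Rightarrow> real" where
  "classical_solution p =
     exp (- 1 / 2 * log_jacobian (\<lambda>p. - a p) (fst p, inverse_flow (\<lambda>p. - a p) p))"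

lemma classical_solution_0: "classical_solution (0, x) = 1"
  by (simp add: classical_solution_def)

lemma classical_solution_flow:
  "classical_solution (t, flow (\<lambda>p. - a p) (t, z)) = exp (- log_jacobian (\<lambda>p. - a p) (t, z) / 2)"
  by (simp add: classical_solution_def)

lemma smooth2_classical_solution: "smooth2 classical_solution"
  unfolding classical_solution_def[abs_def]
  by (intro smooth2_exp smooth2_mult smooth2_const
      smooth2_compose[OF smooth2_log_jacobian smooth2_fst smooth2_inverse_flow])

lemma periodic_snd_classical_solution: "periodic_snd classical_solution"
  by (simp add: periodic_snd_def classical_solution_def inverse_flow_add_2pi log_jacobian_periodic)

lemma classical_solution_transport:
  "dt2 classical_solution p
    = a p * dx2 classical_solution p + dx2 a p / 2 * classical_solution p"
proof -
  obtain t x where p: "p = (t, x)" by (cases p)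
  obtain z where x: "flow (\<lambda>p. - a p) (t, z) = x" using flow_surj by blast
  have "((\<lambda>t. classical_solution (t, flow (\<lambda>p. - a p) (t, z))) has_real_derivative
      dt2 classical_solution p + dx2 classical_solution p * - a p) (at t)"
    using has_partials_DERIV_curve[OF smooth2_has_partials[OF smooth2_classical_solution]
        flow_DERIV_fst[of z t]]
    by (simp add: x p)
  moreover have "((\<lambda>t. exp (- log_jacobian (\<lambda>p. - a p) (t, z) / 2)) has_real_derivative
      dx2 a p / 2 * classical_solution p) (at t)"
    using log_jacobian_DERIV_fst[of z t] classical_solution_flow[of t z]
    by (auto intro!: derivative_eq_intros simp: x p dx2_uminus[OF smooth_coeff])
  ultimately have "dt2 classical_solution p + dx2 classical_solution p * - a p
      = dx2 a p / 2 * classical_solution p"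
    unfolding classical_solution_flow by (rule DERIV_unique)
  then show ?thesis by (simp add: algebra_simps)
qed

lemma slice_coef_dt2_classical_solution:
  "slice_coef (dt2 classical_solution) t k
    = weak_generator a t (\<lambda>x. of_real (classical_solution (t, x))) k"
proof -
  let ?u = classical_solution
  define au where "au p = a p * ?u p" for p
  have au: "smooth2 au" "periodic_snd au"
    unfolding au_def[abs_def]
    using periodic_snd_classical_solution periodic_coeff
    by (auto intro: smooth2_mult smooth_coeff smooth2_classical_solution
        simp: periodic_snd_def periodic2_def)
  have "dx2 au = (\<lambda>p. a p * dx2 ?u p + dx2 a p * ?u p)"
    unfolding au_def[abs_def]
    by (rule dx2_eq[OF has_partials_mult[OF smooth2_has_partials smooth2_has_partials]])
      (rule smooth_coeff smooth2_classical_solution)+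
  then have "dt2 ?u (t, x) = dx2 au (t, x) - dx2 a (t, x) * ?u (t, x) / 2" for x
    by (simp add: classical_solution_transport)
  then have "slice_coef (dt2 ?u) t k = fcoef (\<lambda>x. of_real (dx2 au (t, x))
      - 1 / 2 * (of_real (dx2 a (t, x)) * of_real (?u (t, x)))) k"
    by (simp add: slice_coef_def)
  also have "\<dots> = slice_coef (dx2 au) t k
      - 1 / 2 * fcoef (\<lambda>x. of_real (dx2 a (t, x)) * of_real (?u (t, x))) k"
    unfolding slice_coef_def fcoef_cmult[symmetric]
    by (intro fcoef_diff continuous_imp_set_integrable continuous_intros continuous_on_slice
        smooth2_dx2 au smooth_coeff smooth2_classical_solution)
  finally show ?thesis
    unfolding slice_coef_dx2[OF au] by (simp add: weak_generator_def slice_coef_def au_def)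
qed

lemma weak_solution_classical:
  "weak_solution a s (\<lambda>x. 1) (\<lambda>t x. of_real (classical_solution (t, x)))"
  unfolding weak_solution_def slice_coef_dt2_classical_solution[symmetric] slice_coef_def[symmetric]
  by (auto simp: classical_solution_0 intro: slice_in_Hs slice_continuous_in_Hs
      slice_coef_has_vector_derivative smooth2_classical_solution periodic_snd_classical_solution)

end

section \<open>Uniqueness of weak solutions\<close>

lemma Re_skew_form_eq_0:
  fixes B :: "'i \<Rightarrow> 'i \<Rightarrow> complex"
  assumes skew: "\<And>j k. cnj (B j k) = - B k j"
  shows "Re (\<Sum>k\<in>I. \<Sum>j\<in>I. cnj (U k) * (B k j * U j)) = 0" (is "Re ?S = 0")
proof -
  have "cnj ?S = - (\<Sum>k\<in>I. \<Sum>j\<in>I. cnj (U j) * (B j k * U k))"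
    by (simp add: skew mult_ac flip: sum_negf)
  also have "(\<Sum>k\<in>I. \<Sum>j\<in>I. cnj (U j) * (B j k * U k)) = ?S"
    by (rule sum.swap)
  finally have "Re (cnj ?S) = Re (- ?S)" by (rule arg_cong)
  then show ?thesis unfolding cnj.simps uminus_complex.simps by linarith
qed

lemma weighted_row_tail_le:
  fixes b U :: "'i \<Rightarrow> complex" and \<omega> :: "'i \<Rightarrow> real"
  assumes b: "\<And>j. cmod (b j) \<le> C * \<omega> j"
    and summable: "(\<lambda>j. \<omega> j * cmod (U j)) summable_on UNIV"
    and D: "((\<lambda>j. b j * U j) has_sum D) UNIV" and I: "finite I"
  shows "cmod (D - (\<Sum>j\<in>I. b j * U j)) \<le> C * (\<Sum>\<^sub>\<infinity>j\<in>- I. \<omega> j * cmod (U j))"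
proof -
  have le: "norm (b j * U j) \<le> C * (\<omega> j * cmod (U j))" for j
    using mult_right_mono[OF b[of j] norm_ge_zero[of "U j"]] by (simp add: norm_mult mult_ac)
  have majorant: "(\<lambda>j. C * (\<omega> j * cmod (U j))) summable_on A" for A
    using summable_on_subset_banach[OF summable] by (intro summable_on_cmult_right) auto
  have norm_summable: "(\<lambda>j. norm (b j * U j)) summable_on UNIV"
    by (rule summable_on_comparison_test[OF majorant]) (use le in auto)
  have "cmod (D - (\<Sum>j\<in>I. b j * U j)) \<le> (\<Sum>\<^sub>\<infinity>j\<in>- I. norm (b j * U j))"
    by (rule norm_has_sum_tail_le[OF D norm_summable I])
  also have "\<dots> \<le> (\<Sum>\<^sub>\<infinity>j\<in>- I. C * (\<omega> j * cmod (U j)))"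
    using summable_on_subset_banach[OF norm_summable] by (intro infsum_mono majorant le) auto
  also have "\<dots> = C * (\<Sum>\<^sub>\<infinity>j\<in>- I. \<omega> j * cmod (U j))" by (simp add: infsum_cmult_right')
  finally show ?thesis .
qed

text \<open>By skew-Hermitian symmetry, only interactions between indices inside and outside of \<open>I\<close>
  contribute.\<close>

lemma skew_form_truncation_bound:
  fixes B :: "'i \<Rightarrow> 'i \<Rightarrow> complex" and \<omega> :: "'i \<Rightarrow> real"
  assumes skew: "\<And>j k. cnj (B j k) = - B k j"
    and bound: "\<And>k j. cmod (B k j) \<le> C * (\<omega> k * \<omega> j)" "C \<ge> 0" "\<And>k. \<omega> k \<ge> 0"
    and summable: "(\<lambda>k. \<omega> k * cmod (U k)) summable_on UNIV"
    and D: "\<And>k. ((\<lambda>j. B k j * U j) has_sum D k) UNIV" and I: "finite I"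
  shows "\<bar>\<Sum>k\<in>I. Re (cnj (U k) * D k)\<bar>
    \<le> C * (\<Sum>\<^sub>\<infinity>k. \<omega> k * cmod (U k)) * (\<Sum>\<^sub>\<infinity>k\<in>- I. \<omega> k * cmod (U k))"
proof -
  define \<tau> where "\<tau> = (\<Sum>\<^sub>\<infinity>k\<in>- I. \<omega> k * cmod (U k))"
  define R where "R k = D k - (\<Sum>j\<in>I. B k j * U j)" for k
  have R: "cmod (R k) \<le> C * \<omega> k * \<tau>" for k
    unfolding R_def \<tau>_def using bound(1)[of k] summable D I
    by (intro weighted_row_tail_le) (simp_all add: mult.assoc)
  have "cnj (U k) * D k = (\<Sum>j\<in>I. cnj (U k) * (B k j * U j)) + cnj (U k) * R k" for k
    unfolding R_def sum_distrib_left[symmetric] by (simp add: algebra_simps)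
  then have "(\<Sum>k\<in>I. Re (cnj (U k) * D k))
      = Re (\<Sum>k\<in>I. \<Sum>j\<in>I. cnj (U k) * (B k j * U j)) + (\<Sum>k\<in>I. Re (cnj (U k) * R k))"
    by (simp only: plus_complex.simps sum.distrib Re_sum)
  also have "\<dots> = (\<Sum>k\<in>I. Re (cnj (U k) * R k))"
    by (simp only: Re_skew_form_eq_0[OF skew] add_0_left)
  also have "\<bar>\<dots>\<bar> \<le> (\<Sum>k\<in>I. C * \<tau> * (\<omega> k * cmod (U k)))"
  proof (rule order_trans[OF sum_abs], rule sum_mono)
    fix k
    have "\<bar>Re (cnj (U k) * R k)\<bar> \<le> cmod (U k) * cmod (R k)"
      using abs_Re_le_cmod[of "cnj (U k) * R k"] by (simp add: norm_mult)
    also have "\<dots> \<le> cmod (U k) * (C * \<omega> k * \<tau>)" by (intro mult_left_mono R) simp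
    finally show "\<bar>Re (cnj (U k) * R k)\<bar> \<le> C * \<tau> * (\<omega> k * cmod (U k))" by (simp add: mult_ac)
  qed
  also have "\<dots> = C * \<tau> * (\<Sum>k\<in>I. \<omega> k * cmod (U k))" by (simp add: sum_distrib_left)
  also have "\<dots> \<le> C * \<tau> * (\<Sum>\<^sub>\<infinity>k. \<omega> k * cmod (U k))"
    using bound(2,3) I summable unfolding \<tau>_def
    by (intro mult_left_mono finite_sum_le_infsum mult_nonneg_nonneg infsum_nonneg) auto
  finally show ?thesis by (simp add: \<tau>_def mult_ac)
qed

lemma japan_peetre: "japan k \<le> 2 * japan j * japan (k - j)"
proof -
  define x y where "x = real_of_int j" and "y = real_of_int (k - j)"
  have k: "real_of_int k = x + y" by (simp add: x_def y_def)
  have "(x + y)\<^sup>2 \<le> 2 * x\<^sup>2 + 2 * y\<^sup>2"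
    using sum_squares_bound[of x y] by (simp add: power2_sum)
  then have "1 + (x + y)\<^sup>2 \<le> 4 * ((1 + x\<^sup>2) * (1 + y\<^sup>2))"
    by (simp add: algebra_simps) (smt (verit) zero_le_power2 mult_nonneg_nonneg)
  then have "sqrt (1 + (x + y)\<^sup>2) \<le> sqrt (4 * ((1 + x\<^sup>2) * (1 + y\<^sup>2)))" by (rule real_sqrt_le_mono)
  then show ?thesis by (simp add: japan_def k real_sqrt_mult flip: x_def y_def)
qed

lemma abs_le_japan_half_powers:
  "\<bar>real_of_int k\<bar> \<le> 2 * (japan k powr (1/2) * japan j powr (1/2)) * japan (k - j)"
proof -
  have "sqrt (2 * japan (k - j)) \<le> 2 * japan (k - j)"
    using japan_ge_1[of "k - j"] by (intro real_le_lsqrt) (auto simp: power2_eq_square)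
  then have "sqrt (2 * japan j * japan (k - j)) \<le> 2 * sqrt (japan j) * japan (k - j)"
    by (simp add: real_sqrt_mult mult_left_mono mult.left_commute)
  then have "sqrt (japan k) \<le> 2 * sqrt (japan j) * japan (k - j)"
    using real_sqrt_le_mono[OF japan_peetre[of k j]] by linarith
  from mult_left_mono[OF this, of "sqrt (japan k)"]
  have "japan k \<le> 2 * (sqrt (japan k) * sqrt (japan j)) * japan (k - j)"
    by (simp add: mult_ac)
  then show ?thesis
    using japan_ge_abs[of k] by (simp add: powr_half_sqrt)
qed

lemma abs_mean_le_japan_half_powers:
  "\<bar>real_of_int (k + j) / 2\<bar> \<le> 2 * (japan k powr (1/2) * japan j powr (1/2)) * japan (k - j)"
proof -
  have "japan (j - k) = japan (k - j)" using japan_minus[of "k - j"] by simp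
  then show ?thesis
    using abs_le_japan_half_powers[of k j] abs_le_japan_half_powers[of j k] by (simp add: mult_ac)
qed

context transport
begin

definition coupling :: "real \<Rightarrow> int \<Rightarrow> int \<Rightarrow> complex" where
  "coupling t k j = \<i> * of_real (of_int (k + j) / 2) * slice_coef a t (k - j)"

lemma coupling_skew: "cnj (coupling t j k) = - coupling t k j"
  using cnj_slice_coef[OF smooth_coeff, of t "j - k"] by (simp add: coupling_def add.commute)

lemma coupling_bound:
  obtains C where "C \<ge> 0" "\<And>t k j. t \<in> {0..T} \<Longrightarrow>
    cmod (coupling t k j) \<le> C * (japan k powr (1/2) * japan j powr (1/2))"
proof -
  obtain C where C: "\<And>t l. t \<in> {0..T} \<Longrightarrow> japan l powr 1 * cmod (slice_coef a t l) \<le> C"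
    using slice_coef_decay[OF smooth_coeff periodic2_imp_periodic_snd[OF periodic_coeff]] by blast
  have "cmod (coupling t k j) \<le> 2 * max 0 C * (japan k powr (1/2) * japan j powr (1/2))"
    if t: "t \<in> {0..T}" for t k j
  proof -
    have "cmod (coupling t k j) = \<bar>real_of_int (k + j) / 2\<bar> * cmod (slice_coef a t (k - j))"
      by (simp add: coupling_def norm_mult norm_divide flip: of_int_add)
    also have "\<dots> \<le> 2 * (japan k powr (1/2) * japan j powr (1/2)) * japan (k - j)
        * cmod (slice_coef a t (k - j))"
      by (intro mult_right_mono abs_mean_le_japan_half_powers) simp
    also have "\<dots> = 2 * (japan k powr (1/2) * japan j powr (1/2))
        * (japan (k - j) powr 1 * cmod (slice_coef a t (k - j)))"
      by (simp add: mult.assoc)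
    also have "\<dots> \<le> 2 * (japan k powr (1/2) * japan j powr (1/2)) * max 0 C"
      using C[OF t, of "k - j"] by (intro mult_left_mono) auto
    finally show ?thesis by (simp add: mult_ac)
  qed
  then show ?thesis using that[of "2 * max 0 C"] by auto
qed

lemma weak_generator_has_sum:
  assumes w: "set_integrable lborel {0..2*pi} w"
  shows "((\<lambda>j. coupling t k j * fcoef w j) has_sum weak_generator a t w k) UNIV"
proof -
  have product_coef: "((\<lambda>l. slice_coef f t l * fcoef w (k - l)) has_sum
      fcoef (\<lambda>x. of_real (f (t, x)) * w x) k) UNIV" if f: "smooth2 f" "periodic_snd f" for f
    by (rule fcoef_mult_has_sum[OF continuous_on_slice[OF f(1)] slice_has_sum[OF f]
          norm_slice_coef_summable[OF f] w])
  have a: "periodic_snd a" "smooth2 (dx2 a)" "periodic_snd (dx2 a)"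
    by (intro periodic2_imp_periodic_snd periodic_coeff smooth2_dx2 smooth_coeff
        periodic2_dx2)+
  have "((\<lambda>l. \<i> * of_int k * (slice_coef a t l * fcoef w (k - l))
      + - 1 / 2 * (slice_coef (dx2 a) t l * fcoef w (k - l))) has_sum
      \<i> * of_int k * fcoef (\<lambda>x. of_real (a (t, x)) * w x) k
      + - 1 / 2 * fcoef (\<lambda>x. of_real (dx2 a (t, x)) * w x) k) UNIV"
    by (intro has_sum_add has_sum_cmult_right product_coef smooth_coeff a)
  moreover have "\<i> * of_int k * (slice_coef a t l * fcoef w (k - l))
      + - 1 / 2 * (slice_coef (dx2 a) t l * fcoef w (k - l))
      = coupling t k (k - l) * fcoef w (k - l)" for l
    by (simp add: coupling_def slice_coef_dx2[OF smooth_coeff a(1)] field_simps)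
  ultimately have
    "((\<lambda>l. coupling t k (k - l) * fcoef w (k - l)) has_sum weak_generator a t w k) UNIV"
    by (simp add: weak_generator_def)
  moreover have "((\<lambda>l. coupling t k (k - l) * fcoef w (k - l)) has_sum weak_generator a t w k) UNIV
      \<longleftrightarrow> ?thesis"
    by (rule has_sum_reindex_bij_witness[of UNIV "\<lambda>l. k - l" "\<lambda>j. k - j"]) auto
  ultimately show ?thesis by blast
qed

lemma truncated_energy_production_bound:
  assumes s: "s > 1"
  obtains C where "\<And>t w I. t \<in> {0..T} \<Longrightarrow> in_Hs s w \<Longrightarrow> finite I \<Longrightarrow>
    \<bar>\<Sum>k\<in>I. Re (cnj (fcoef w k) * weak_generator a t w k)\<bar>
    \<le> C * sqrt (\<Sum>\<^sub>\<infinity>k\<in>- I. japan k powr (1 - 2 * s)) * (sob_norm s w)\<^sup>2"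
proof -
  obtain C where C: "C \<ge> 0" "\<And>t k j. t \<in> {0..T} \<Longrightarrow>
      cmod (coupling t k j) \<le> C * (japan k powr (1/2) * japan j powr (1/2))"
    using coupling_bound by blast
  define G where "G A = sqrt (\<Sum>\<^sub>\<infinity>k\<in>A. japan k powr (1 - 2 * s))" for A
  have "\<bar>\<Sum>k\<in>I. Re (cnj (fcoef w k) * weak_generator a t w k)\<bar>
      \<le> C * G UNIV * G (- I) * (sob_norm s w)\<^sup>2"
    if t: "t \<in> {0..T}" and w: "in_Hs s w" and I: "finite I" for t w I
  proof -
    let ?S = "\<lambda>A. \<Sum>\<^sub>\<infinity>k\<in>A. japan k powr (1/2) * cmod (fcoef w k)"
    have S: "(\<lambda>k. japan k powr (1/2) * cmod (fcoef w k)) summable_on A"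
      "?S A \<le> G A * sob_norm s w" for A
      using weighted_fcoef_summable[OF w, of "1/2" A] weighted_fcoef_infsum_le[OF w, of "1/2" A] s
      by (simp_all add: G_def algebra_simps)
    have "\<bar>\<Sum>k\<in>I. Re (cnj (fcoef w k) * weak_generator a t w k)\<bar> \<le> C * ?S UNIV * ?S (- I)"
      using C t I S(1)
      by (intro skew_form_truncation_bound[where B="coupling t"] coupling_skew
          weak_generator_has_sum in_Hs_set_integrable[OF w]) auto
    also have "\<dots> \<le> C * (G UNIV * sob_norm s w) * (G (- I) * sob_norm s w)"
      using C(1) by (intro mult_mono mult_left_mono S)
        (auto intro!: infsum_nonneg mult_nonneg_nonneg simp: G_def)
    finally show ?thesis by (simp add: power2_eq_square mult_ac)
  qed
  then show ?thesis using that unfolding G_def by blast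
qed

lemma weak_solution_sob_norm_bounded:
  assumes u: "weak_solution a s u0 u"
  obtains K where "\<And>t. t \<in> {0..T} \<Longrightarrow> sob_norm s (u t) \<le> K"
proof -
  have Hs: "in_Hs s (u t)" if "t \<in> {0..T}" for t
    using u that by (simp add: weak_solution_def)
  have "continuous_on {0..T} (\<lambda>t. sob_norm s (u t))"
    unfolding continuous_on_def
  proof
    fix t0 assume t0: "t0 \<in> {0..T}"
    have "((\<lambda>t. sob_norm s (\<lambda>x. u t x - u t0 x)) \<longlongrightarrow> 0) (at t0 within {0..T})"
      using u t0 by (auto simp: weak_solution_def intro: tendsto_within_subset)
    moreover have "\<forall>\<^sub>F t in at t0 within {0..T}.
        norm (sob_norm s (u t) - sob_norm s (u t0)) \<le> sob_norm s (\<lambda>x. u t x - u t0 x)"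
      using Hs t0 by (auto simp: eventually_at_filter abs_sob_norm_diff_le)
    ultimately have "((\<lambda>t. sob_norm s (u t) - sob_norm s (u t0)) \<longlongrightarrow> 0) (at t0 within {0..T})"
      by (rule Lim_null_comparison[rotated])
    then show "((\<lambda>t. sob_norm s (u t)) \<longlongrightarrow> sob_norm s (u t0)) (at t0 within {0..T})"
      by (rule LIM_zero_cancel)
  qed
  then have "bounded ((\<lambda>t. sob_norm s (u t)) ` {0..T})"
    by (intro compact_imp_bounded compact_continuous_image) auto
  then show ?thesis using that unfolding bounded_iff by fastforce
qed

lemma weak_solution_diff:
  assumes u: "weak_solution a s u0 u" and v: "weak_solution a s v0 v"
  shows "weak_solution a s (\<lambda>x. u0 x - v0 x) (\<lambda>t x. u t x - v t x)"
  unfolding weak_solution_def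
proof (intro conjI allI impI)
  have Hs: "in_Hs s (u t)" "in_Hs s (v t)" if "t \<ge> 0" for t
    using u v that by (auto simp: weak_solution_def)
  show "(\<lambda>x. u 0 x - v 0 x) = (\<lambda>x. u0 x - v0 x)" using u v by (simp add: weak_solution_def)
  show "in_Hs s (\<lambda>x. u t x - v t x)" if "t \<ge> 0" for t using Hs[OF that] by (rule in_Hs_diff)
  show "((\<lambda>t. sob_norm s (\<lambda>x. (u t x - v t x) - (u t0 x - v t0 x))) \<longlongrightarrow> 0) (at t0 within {0..})"
    if t0: "t0 \<ge> 0" for t0
  proof (rule Lim_null_comparison)
    show "((\<lambda>t. sob_norm s (\<lambda>x. u t x - u t0 x) + sob_norm s (\<lambda>x. v t x - v t0 x)) \<longlongrightarrow> 0)
        (at t0 within {0..})"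
      using u v t0 unfolding weak_solution_def by (intro tendsto_add_zero) auto
    show "\<forall>\<^sub>F t in at t0 within {0..}. norm (sob_norm s (\<lambda>x. (u t x - v t x) - (u t0 x - v t0 x)))
        \<le> sob_norm s (\<lambda>x. u t x - u t0 x) + sob_norm s (\<lambda>x. v t x - v t0 x)"
      unfolding eventually_at_filter
    proof (intro always_eventually allI impI)
      fix t :: real assume "t \<in> {0..}"
      then show "norm (sob_norm s (\<lambda>x. (u t x - v t x) - (u t0 x - v t0 x)))
          \<le> sob_norm s (\<lambda>x. u t x - u t0 x) + sob_norm s (\<lambda>x. v t x - v t0 x)"
        using sob_norm_triangle_ineq4[of s "\<lambda>x. u t x - u t0 x" "\<lambda>x. v t x - v t0 x"]
          Hs[of t] Hs[OF t0]
        by (simp add: in_Hs_diff algebra_simps)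
    qed
  qed
  show "((\<lambda>t. fcoef (\<lambda>x. u t x - v t x) k) has_vector_derivative
      weak_generator a t (\<lambda>x. u t x - v t x) k) (at t within {0..})" if t: "t \<ge> 0" for t k
  proof (rule has_vector_derivative_transform)
    show "((\<lambda>t. fcoef (u t) k - fcoef (v t) k) has_vector_derivative
        weak_generator a t (\<lambda>x. u t x - v t x) k) (at t within {0..})"
      using u v t Hs[OF t, THEN in_Hs_set_integrable]
      by (auto simp: weak_solution_def weak_generator_diff smooth_coeff
          intro!: has_vector_derivative_diff)
    show "fcoef (\<lambda>x. u \<tau> x - v \<tau> x) k = fcoef (u \<tau>) k - fcoef (v \<tau>) k" if "\<tau> \<in> {0..}" for \<tau>
      using Hs[of \<tau>, THEN in_Hs_set_integrable] that by (simp add: fcoef_diff)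
  qed (use t in simp)
qed

lemma has_real_derivative_norm_square:
  assumes "(f has_vector_derivative f') (at t within S)"
  shows "((\<lambda>t. (cmod (f t))\<^sup>2) has_real_derivative 2 * Re (cnj (f t) * f')) (at t within S)"
  using bounded_bilinear.has_vector_derivative[OF bounded_bilinear_inner assms assms]
  unfolding has_real_derivative_iff_has_vector_derivative power2_norm_eq_inner
  by (rule has_vector_derivative_eq_rhs) (simp add: inner_complex_def algebra_simps)

lemma truncated_energy_DERIV:
  assumes w: "weak_solution a s w0 w" and t: "t \<in> {0..T}"
  shows "((\<lambda>t. \<Sum>k\<in>I. (cmod (fcoef (w t) k))\<^sup>2) has_real_derivative
    2 * (\<Sum>k\<in>I. Re (cnj (fcoef (w t) k) * weak_generator a t (w t) k))) (at t within {0..T})"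
proof -
  have "((\<lambda>t. fcoef (w t) k) has_vector_derivative weak_generator a t (w t) k)
      (at t within {0..T})" for k
    using w t
    by (intro has_vector_derivative_within_subset[where S="{0..}" and T="{0..T}"])
      (auto simp: weak_solution_def)
  then show ?thesis
    unfolding sum_distrib_left by (intro DERIV_sum has_real_derivative_norm_square)
qed

lemma truncated_energy_bound:
  assumes w: "weak_solution a s (\<lambda>x. 0) w" and s: "s > 1" and T: "T \<ge> 0"
  obtains M where "\<And>I. finite I \<Longrightarrow> (\<Sum>k\<in>I. (cmod (fcoef (w T) k))\<^sup>2)
    \<le> M * sqrt (\<Sum>\<^sub>\<infinity>k\<in>- I. japan k powr (1 - 2 * s))"
proof -
  obtain C where C: "\<And>t w I. t \<in> {0..T} \<Longrightarrow> in_Hs s w \<Longrightarrow> finite I \<Longrightarrow>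
      \<bar>\<Sum>k\<in>I. Re (cnj (fcoef w k) * weak_generator a t w k)\<bar>
      \<le> C * sqrt (\<Sum>\<^sub>\<infinity>k\<in>- I. japan k powr (1 - 2 * s)) * (sob_norm s w)\<^sup>2"
    using truncated_energy_production_bound[OF s] by blast
  obtain K where K: "\<And>t. t \<in> {0..T} \<Longrightarrow> sob_norm s (w t) \<le> K"
    using weak_solution_sob_norm_bounded[OF w] by blast
  have "(\<Sum>k\<in>I. (cmod (fcoef (w T) k))\<^sup>2)
      \<le> 2 * \<bar>C\<bar> * K\<^sup>2 * T * sqrt (\<Sum>\<^sub>\<infinity>k\<in>- I. japan k powr (1 - 2 * s))" if I: "finite I" for I
  proof -
    let ?energy = "\<lambda>t. \<Sum>k\<in>I. (cmod (fcoef (w t) k))\<^sup>2"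
    let ?production = "\<lambda>t. \<Sum>k\<in>I. Re (cnj (fcoef (w t) k) * weak_generator a t (w t) k)"
    define \<tau> where "\<tau> = sqrt (\<Sum>\<^sub>\<infinity>k\<in>- I. japan k powr (1 - 2 * s))"
    have "\<tau> \<ge> 0" by (simp add: \<tau>_def infsum_nonneg)
    have "\<bar>2 * ?production t\<bar> \<le> 2 * \<bar>C\<bar> * K\<^sup>2 * \<tau>" if t: "t \<in> {0..T}" for t
    proof -
      have "\<bar>?production t\<bar> \<le> C * \<tau> * (sob_norm s (w t))\<^sup>2"
        unfolding \<tau>_def using w t I by (intro C) (auto simp: weak_solution_def)
      also have "\<dots> \<le> \<bar>C\<bar> * \<tau> * K\<^sup>2"
        using \<open>\<tau> \<ge> 0\<close> K[OF t] by (intro mult_mono power_mono) auto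
      finally show ?thesis by (simp add: abs_mult mult_ac)
    qed
    then have "norm (?energy T - ?energy 0) \<le> 2 * \<bar>C\<bar> * K\<^sup>2 * \<tau> * norm (T - 0)"
      using T truncated_energy_DERIV[OF w]
      by (intro field_differentiable_bound[of "{0..T}" ?energy "\<lambda>t. 2 * ?production t"]) auto
    moreover have "?energy 0 = 0" using w by (simp add: weak_solution_def fcoef_const)
    ultimately show ?thesis using T by (simp add: \<tau>_def mult_ac)
  qed
  then show ?thesis using that by blast
qed

lemma weak_solution_zero_data:
  assumes w: "weak_solution a s (\<lambda>x. 0) w" and s: "s > 1" and T: "T \<ge> 0"
  shows "fcoef (w T) k = 0"
proof -
  obtain M where M: "\<And>I. finite I \<Longrightarrow> (\<Sum>k\<in>I. (cmod (fcoef (w T) k))\<^sup>2)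
      \<le> M * sqrt (\<Sum>\<^sub>\<infinity>k\<in>- I. japan k powr (1 - 2 * s))"
    using truncated_energy_bound[OF assms] by blast
  have "(\<lambda>k. japan k powr (1 - 2 * s)) summable_on UNIV"
    using summable_on_japan[of "2 * s - 1"] s by simp
  from tendsto_mult[OF tendsto_const[of M] tendsto_real_sqrt[OF infsum_Compl_tendsto_0[OF this]]]
  have "((\<lambda>I. M * sqrt (\<Sum>\<^sub>\<infinity>k\<in>- I. japan k powr (1 - 2 * s))) \<longlongrightarrow> 0)
      (finite_subsets_at_top UNIV)"
    by simp
  moreover have "\<forall>\<^sub>F I in finite_subsets_at_top UNIV.
      (cmod (fcoef (w T) k))\<^sup>2 \<le> M * sqrt (\<Sum>\<^sub>\<infinity>k\<in>- I. japan k powr (1 - 2 * s))"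
    unfolding eventually_finite_subsets_at_top
  proof (intro exI[of _ "{k}"] conjI allI impI)
    fix I assume I: "finite I \<and> {k} \<subseteq> I \<and> I \<subseteq> UNIV"
    then have "(cmod (fcoef (w T) k))\<^sup>2 \<le> (\<Sum>k\<in>I. (cmod (fcoef (w T) k))\<^sup>2)"
      by (intro member_le_sum) auto
    also have "\<dots> \<le> M * sqrt (\<Sum>\<^sub>\<infinity>k\<in>- I. japan k powr (1 - 2 * s))" using I by (intro M) simp
    finally show "(cmod (fcoef (w T) k))\<^sup>2 \<le> M * sqrt (\<Sum>\<^sub>\<infinity>k\<in>- I. japan k powr (1 - 2 * s))" .
  qed auto
  ultimately have "(cmod (fcoef (w T) k))\<^sup>2 \<le> 0" by (rule tendsto_lowerbound) simp
  then show ?thesis by simp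
qed

lemma weak_solution_sob_norm_unique:
  assumes u: "weak_solution a s u0 u" and v: "weak_solution a s u0 v" and "s > 1" "t \<ge> 0"
  shows "sob_norm s (u t) = sob_norm s (v t)"
proof (rule sob_norm_cong)
  fix k
  have "fcoef (\<lambda>x. u t x - v t x) k = 0"
    using weak_solution_diff[OF u v] assms(3,4) by (intro weak_solution_zero_data) auto
  moreover have "set_integrable lborel {0..2*pi} (u t)" "set_integrable lborel {0..2*pi} (v t)"
    using u v \<open>t \<ge> 0\<close> by (auto simp: weak_solution_def intro: in_Hs_set_integrable)
  ultimately show "fcoef (u t) k = fcoef (v t) k" by (simp add: fcoef_diff)
qed

lemma weak_solution_one_lower_bound:
  assumes w: "weak_solution a s (\<lambda>x. 1) w" and s: "s > 1" and t: "t \<ge> 0"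
  shows "exp (- log_jacobian (\<lambda>p. - a p) (t, z) / 2) \<le> sobolev_const * sob_norm s (w t)"
proof -
  let ?u = "\<lambda>t x. complex_of_real (classical_solution (t, x))"
  have "exp (- log_jacobian (\<lambda>p. - a p) (t, z) / 2) = cmod (?u t (flow (\<lambda>p. - a p) (t, z)))"
    by (simp add: classical_solution_flow)
  also have "\<dots> \<le> sobolev_const * sob_norm s (?u t)"
    using s
    by (intro sobolev_embedding[OF slice_in_Hs continuous_on_slice slice_has_vector_derivative]
        smooth2_classical_solution periodic_snd_classical_solution) simp
  also have "sob_norm s (?u t) = sob_norm s (w t)"
    by (rule weak_solution_sob_norm_unique[OF weak_solution_classical w s t])
  finally show ?thesis .
qed

lemma weak_solution_one_growth:
  assumes w: "weak_solution a s (\<lambda>x. 1) w" and s: "s > 1" and t: "t \<ge> 0"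
    and decay: "log_jacobian (\<lambda>p. - a p) (t, z) \<le> M - r * t"
  shows "exp (- M / 2) / sobolev_const * exp (r / 2 * t) \<le> sob_norm s (w t)"
proof -
  have "exp (- M / 2) * exp (r / 2 * t) = exp (- (M - r * t) / 2)"
    by (simp add: field_simps flip: exp_add)
  also have "\<dots> \<le> exp (- log_jacobian (\<lambda>p. - a p) (t, z) / 2)"
    using decay by simp
  also have "\<dots> \<le> sobolev_const * sob_norm s (w t)"
    by (rule weak_solution_one_lower_bound[OF w s t])
  finally show ?thesis using sobolev_const_pos by (simp add: field_simps)
qed

end

section \<open>Averaging\<close>

lemma upcrossing_nonneg_derivative:
  fixes f :: "real \<Rightarrow> real"
  assumes f: "\<And>x. (f has_real_derivative f' x) (at x)" and ends: "f a < c" "c \<le> f b" "a \<le> b"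
  obtains r where "a < r" "r \<le> b" "f r = c" "f' r \<ge> 0"
proof -
  have cont: "continuous_on X f" for X
    using f by (meson DERIV_isCont continuous_at_imp_continuous_on)
  define S where "S = {a..b} \<inter> {x. c \<le> f x}"
  have "compact S"
    unfolding S_def
    by (intro compact_Int_closed compact_Icc closed_Collect_le cont continuous_intros)
  moreover have "S \<noteq> {}" using ends by (auto simp: S_def)
  ultimately obtain r where r: "r \<in> S" "\<And>x. x \<in> S \<Longrightarrow> r \<le> x" using compact_attains_inf by metis
  have "a < r" using r(1) ends by (cases "r = a") (auto simp: S_def)
  obtain x where "a \<le> x" "x \<le> r" "f x = c"
    using IVT'[of f a c r] ends \<open>a < r\<close> cont r(1) by (auto simp: S_def)
  then have "f r = c" using r(2)[of x] r(1) by (auto simp: S_def)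
  moreover have "f' r \<ge> 0"
  proof (rule ccontr)
    assume "\<not> f' r \<ge> 0"
    then obtain d where d: "d > 0" "\<And>h. 0 < h \<Longrightarrow> h < d \<Longrightarrow> f r < f (r - h)"
      using DERIV_neg_dec_left[OF f, of r] by auto
    define h where "h = min (d / 2) (r - a)"
    have "r - h \<in> S"
      using d \<open>a < r\<close> \<open>f r = c\<close> r(1) by (auto simp: S_def h_def intro!: less_imp_le[OF d(2)])
    then show False using r(2)[of "r - h"] d(1) \<open>a < r\<close> by (auto simp: h_def)
  qed
  ultimately show ?thesis using that \<open>a < r\<close> r(1) by (auto simp: S_def)
qed

lemma below_barrier:
  fixes f :: "real \<Rightarrow> real"
  assumes f: "\<And>t. (f has_real_derivative f' t) (at t)" and "f 0 < c"
    and barrier: "\<And>t. t \<ge> 0 \<Longrightarrow> f t = c \<Longrightarrow> f' t < 0" and "t \<ge> 0"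
  shows "f t < c"
proof (rule ccontr)
  assume "\<not> f t < c"
  then obtain r where "0 < r" "f r = c" "f' r \<ge> 0"
    using upcrossing_nonneg_derivative[OF f \<open>f 0 < c\<close> _ \<open>t \<ge> 0\<close>] by auto
  then show False using barrier[of r] by simp
qed

lemma periodic_zero_with_positive_derivative:
  fixes f :: "real \<Rightarrow> real"
  assumes f: "\<And>x. (f has_real_derivative f' x) (at x)" and per: "\<And>x. f (x + p) = f x" and "p > 0"
    and nondegenerate: "\<And>x. f x = 0 \<Longrightarrow> f' x \<noteq> 0" and zero: "f a = 0"
  obtains y where "f y = 0" "f' y > 0"
proof (cases "f' a > 0")
  case True
  then show ?thesis using that zero by blast
next
  case False
  then have "f' a < 0" using nondegenerate[OF zero] by simp
  from DERIV_neg_dec_right[OF f this] obtain d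
    where d: "d > 0" "\<And>h. 0 < h \<Longrightarrow> h < d \<Longrightarrow> f (a + h) < f a"
    by blast
  define b where "b = a + min (d / 2) p"
  have "f b < 0" unfolding b_def zero[symmetric] using d \<open>p > 0\<close> by (intro d(2)) auto
  moreover have "0 \<le> f (a + p)" "b \<le> a + p" using per zero by (auto simp: b_def)
  ultimately obtain y where "f y = 0" "f' y \<ge> 0"
    using upcrossing_nonneg_derivative[OF f] by blast
  with nondegenerate[of y] that show ?thesis by force
qed

lemma mean_value_between:
  fixes f :: "real \<Rightarrow> real"
  assumes f: "\<And>x. (f has_real_derivative f' x) (at x)"
  obtains \<xi> where "\<bar>\<xi> - c\<bar> \<le> \<bar>x - c\<bar>" "f x - f c = f' \<xi> * (x - c)"
proof (cases x c rule: linorder_cases)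
  case less
  then obtain \<xi> where "x < \<xi>" "\<xi> < c" "f c - f x = (c - x) * f' \<xi>" using MVT2[OF _ f] by blast
  then show ?thesis using that[of \<xi>] by (simp add: algebra_simps)
next
  case equal
  then show ?thesis using that[of c] by simp
next
  case greater
  then obtain \<xi> where "c < \<xi>" "\<xi> < x" "f x - f c = (x - c) * f' \<xi>" using MVT2[OF _ f] by blast
  then show ?thesis using that[of \<xi>] by (simp add: algebra_simps)
qed

lemma inward_near_sink:
  fixes f :: "real \<Rightarrow> real"
  assumes f: "\<And>x. (f has_real_derivative f' x) (at x)" "f c = 0"
    and sink: "\<And>x. \<bar>x - c\<bar> \<le> 2 * \<eta> \<Longrightarrow> f' x \<le> - \<kappa>" and "\<kappa> > 0"
    and d: "\<bar>d\<bar> = \<eta>" "\<bar>d - (x - c)\<bar> \<le> \<eta> / 2"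
  shows "d * f x \<le> - \<kappa> * (\<eta>\<^sup>2 / 2)"
proof -
  have "d\<^sup>2 = \<eta>\<^sup>2" using d(1) by (metis power2_abs)
  have "\<bar>d * (d - (x - c))\<bar> \<le> \<eta> * (\<eta> / 2)"
    unfolding abs_mult d(1) using d by (intro mult_left_mono) auto
  then have "d * (d - (x - c)) \<le> \<eta>\<^sup>2 / 2" unfolding power2_eq_square by linarith
  moreover have "d * (x - c) = \<eta>\<^sup>2 - d * (d - (x - c))"
    unfolding \<open>d\<^sup>2 = \<eta>\<^sup>2\<close>[symmetric] by (simp add: power2_eq_square algebra_simps)
  ultimately have inner: "d * (x - c) \<ge> \<eta>\<^sup>2 / 2" by linarith
  obtain \<xi> where \<xi>: "\<bar>\<xi> - c\<bar> \<le> \<bar>x - c\<bar>" "f x = f' \<xi> * (x - c)"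
    using mean_value_between[OF f(1), of c x] f(2) by auto
  have "\<bar>\<xi> - c\<bar> \<le> 2 * \<eta>" using \<xi>(1) d by linarith
  have "d * f x = f' \<xi> * (d * (x - c))" by (simp add: \<xi>(2))
  also have "\<dots> \<le> - \<kappa> * (d * (x - c))"
    using inner sink[OF \<open>\<bar>\<xi> - c\<bar> \<le> 2 * \<eta>\<close>] zero_le_power2[of \<eta>]
    by (intro mult_right_mono) linarith+
  also have "\<dots> \<le> - \<kappa> * (\<eta>\<^sup>2 / 2)"
    using inner \<open>\<kappa> > 0\<close> by (intro mult_left_mono_neg) auto
  finally show ?thesis .
qed

text \<open>The average does not depend on time; it is a function of both variables only so that the
  calculus of \<^const>\<open>smooth2\<close> applies to it.\<close>

definition time_average :: "(real \<times> real \<Rightarrow> real) \<Rightarrow> real \<times> real \<Rightarrow> real" where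
  "time_average F p = 1 / (2 * pi) * primitive_t F (2 * pi, snd p)"

text \<open>Chosen such that along the orbits of \<open>y' = \<epsilon> F (t, y)\<close> the quantity \<open>y + \<epsilon> corrector F (t, y)\<close>
  solves the averaged equation up to \<open>O(\<epsilon>\<^sup>2)\<close>.\<close>

definition corrector :: "(real \<times> real \<Rightarrow> real) \<Rightarrow> real \<times> real \<Rightarrow> real" where
  "corrector F = primitive_t (\<lambda>p. time_average F p - F p)"

lemma smooth2_time_average: "smooth2 F \<Longrightarrow> smooth2 (time_average F)"
  unfolding time_average_def[abs_def]
  by (intro smooth2_mult smooth2_const
      smooth2_compose[OF smooth2_primitive_t smooth2_const smooth2_snd])

lemma time_average_fst: "time_average F (t, x) = time_average F (0, x)"
  by (simp add: time_average_def)

lemma dx2_time_average_fst: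
  assumes "smooth2 F"
  shows "dx2 (time_average F) (t, x) = dx2 (time_average F) (0, x)"
proof -
  have "((\<lambda>x. time_average F (0, x)) has_real_derivative dx2 (time_average F) (t, x)) (at x)"
    using smooth2_DERIV_snd[OF smooth2_time_average[OF assms], of t x UNIV]
    by (simp only: time_average_fst[of F t])
  then show ?thesis
    using smooth2_DERIV_snd[OF smooth2_time_average[OF assms]] DERIV_unique by blast
qed

lemma periodic2_time_average: "periodic2 F \<Longrightarrow> periodic2 (time_average F)"
  by (simp add: periodic2_def time_average_def primitive_t_def)

lemma time_average_eq_integral:
  assumes "continuous_on UNIV F"
  shows "2 * pi * time_average F (t, x) = integral {0..2 * pi} (\<lambda>t. F (t, x))"
  by (simp add: time_average_def primitive_t_eq_integral[OF assms])

lemma time_average_uminus: "time_average (\<lambda>p. - F p) = (\<lambda>p. - time_average F p)"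
  by (simp add: fun_eq_iff time_average_def primitive_t_uminus)

lemma corrector_0 [simp]: "corrector F (0, x) = 0"
  by (simp add: corrector_def)

context periodic_vector_field
begin

lemma smooth2_oscillation: "smooth2 (\<lambda>p. time_average F p - F p)"
  by (intro smooth2_diff smooth2_time_average smooth_field)

lemma smooth2_corrector: "smooth2 (corrector F)"
  unfolding corrector_def by (intro smooth2_primitive_t smooth2_oscillation)

lemma has_partials_corrector:
  "has_partials (corrector F) (\<lambda>p. time_average F p - F p) (dx2 (corrector F))"
  using smooth2_has_partials_primitive_t[OF smooth2_oscillation]
  unfolding corrector_def by (simp add: dx2_eq)

lemma dx2_corrector: "dx2 (corrector F) = primitive_t (\<lambda>p. dx2 (time_average F) p - dx2 F p)"
proof -
  have "dx2 (\<lambda>p. time_average F p - F p) = (\<lambda>p. dx2 (time_average F) p - dx2 F p)"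
    by (rule dx2_eqI[OF smooth2_oscillation])
      (intro DERIV_diff smooth2_DERIV_snd smooth2_time_average smooth_field)
  then show ?thesis
    using dx2_eq[OF smooth2_has_partials_primitive_t[OF smooth2_oscillation]]
    by (simp add: corrector_def)
qed

lemma has_partials_dx2_corrector:
  "has_partials (dx2 (corrector F)) (\<lambda>p. dx2 (time_average F) p - dx2 F p)
     (dx2 (dx2 (corrector F)))"
proof -
  have "smooth2 (\<lambda>p. dx2 (time_average F) p - dx2 F p)"
    by (intro smooth2_diff smooth2_dx2 smooth2_time_average smooth_field)
  from smooth2_has_partials_primitive_t[OF this] show ?thesis
    unfolding dx2_corrector by (simp add: dx2_eq)
qed

lemma periodic2_corrector: "periodic2 (corrector F)"
  unfolding periodic2_def
proof (intro allI conjI)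
  fix t x
  show "corrector F (t, x + 2 * pi) = corrector F (t, x)"
    using periodic_field periodic2_time_average[OF periodic_field]
    by (simp add: corrector_def primitive_t_def periodic2_def)
  have deriv: "((\<lambda>t. corrector F (t, x)) has_real_derivative
      time_average F (0, x) - F (t, x)) (at t)" for t
    using has_partials_DERIV_fst[OF has_partials_corrector, of x t UNIV]
    by (simp add: time_average_fst[of F t])
  have "((\<lambda>t. corrector F (t + 2 * pi, x) - corrector F (t, x)) has_real_derivative 0) (at t)" for t
  proof -
    have "((\<lambda>t. corrector F (t + 2 * pi, x)) has_real_derivative
        time_average F (0, x) - F (t, x)) (at t)"
      using deriv[of "t + 2 * pi"] DERIV_shift[of "\<lambda>t. corrector F (t, x)" _ t "2 * pi"]
        periodic_field by (simp add: periodic2_def)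
    from DERIV_diff[OF this deriv] show ?thesis by simp
  qed
  then have "corrector F (t + 2 * pi, x) - corrector F (t, x)
      = corrector F (0 + 2 * pi, x) - corrector F (0, x)"
    by (meson DERIV_isconst_all)
  moreover have "corrector F (2 * pi, x) - corrector F (0, x) = 0"
  proof (rule has_integral_unique[OF has_integral_derivative[OF deriv]])
    have "((\<lambda>t. time_average F (0, x) - F (t, x)) has_integral
        2 * pi * time_average F (0, x) - integral {0..2 * pi} (\<lambda>t. F (t, x))) {0..2 * pi}"
      using has_integral_const_real[of "time_average F (0, x)" 0 "2 * pi"]
      by (intro has_integral_diff integrable_integral integrable_continuous_interval
          smooth2_continuous_compose[OF smooth_field] continuous_intros) simp
    moreover have "2 * pi * time_average F (0, x) = integral {0..2 * pi} (\<lambda>t. F (t, x))"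
      by (rule time_average_eq_integral[OF smooth2_continuous[OF smooth_field]])
    ultimately show "((\<lambda>t. time_average F (0, x) - F (t, x)) has_integral 0) {0..2 * pi}" by simp
  qed simp
  ultimately show "corrector F (t + 2 * pi, x) = corrector F (t, x)" by simp
qed

lemma corrector_bounds:
  obtains M where "M > 0" "\<And>p. \<bar>F p\<bar> \<le> M" "\<And>p. \<bar>corrector F p\<bar> \<le> M"
    "\<And>p. \<bar>dx2 (corrector F) p\<bar> \<le> M" "\<And>p. \<bar>dx2 (dx2 (corrector F)) p\<bar> \<le> M"
proof -
  have bound: "\<exists>M>0. \<forall>p. \<bar>f p\<bar> \<le> M" if "smooth2 f" "periodic2 f" for f
    using periodic2_bounded[OF that(2) smooth2_continuous[OF that(1)]] by metis
  have dx2: "smooth2 (dx2 (corrector F))" "periodic2 (dx2 (corrector F))"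
    by (intro smooth2_dx2 periodic2_dx2 smooth2_corrector periodic2_corrector)+
  obtain M0 M1 M2 M3 where "M0 > 0" "M1 > 0" "M2 > 0" "M3 > 0"
    and "\<And>p. \<bar>F p\<bar> \<le> M0" "\<And>p. \<bar>corrector F p\<bar> \<le> M1" "\<And>p. \<bar>dx2 (corrector F) p\<bar> \<le> M2"
      "\<And>p. \<bar>dx2 (dx2 (corrector F)) p\<bar> \<le> M3"
    using bound[OF smooth_field periodic_field] bound[OF smooth2_corrector periodic2_corrector]
      bound[OF dx2] bound[OF smooth2_dx2[OF dx2(1)] periodic2_dx2[OF dx2]] by metis
  then show ?thesis
    by (intro that[of "max (max M0 M1) (max M2 M3)"]) (auto simp: le_max_iff_disj less_max_iff_disj)
qed

end

locale slow_orbit = periodic_vector_field +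
  fixes \<epsilon> :: real and y :: "real \<Rightarrow> real"
  assumes \<epsilon>_pos: "\<epsilon> > 0" and orbit: "\<And>t. (y has_real_derivative \<epsilon> * F (t, y t)) (at t)"
begin

definition corrected :: "real \<Rightarrow> real" where
  "corrected t = y t + \<epsilon> * corrector F (t, y t)"

lemma corrected_DERIV:
  "(corrected has_real_derivative
     \<epsilon> * (time_average F (0, y t) + \<epsilon> * (dx2 (corrector F) (t, y t) * F (t, y t)))) (at t)"
  unfolding corrected_def[abs_def]
  by (rule derivative_eq_intros orbit has_partials_DERIV_curve[OF has_partials_corrector] refl)+
    (simp add: time_average_fst[of F t] algebra_simps)

lemma corrected_near_orbit:
  assumes "\<And>p. \<bar>corrector F p\<bar> \<le> M"
  shows "\<bar>corrected t - y t\<bar> \<le> \<epsilon> * M"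
  using \<epsilon>_pos assms by (simp add: corrected_def abs_mult)

lemma orbit_near_averaged_sink:
  assumes M: "\<And>p. \<bar>F p\<bar> \<le> M" "\<And>p. \<bar>corrector F p\<bar> \<le> M" "\<And>p. \<bar>dx2 (corrector F) p\<bar> \<le> M"
    and zero: "time_average F (0, y 0) = 0" and "\<eta> > 0" "\<kappa> > 0"
    and sink: "\<And>x. \<bar>x - y 0\<bar> \<le> 2 * \<eta> \<Longrightarrow> dx2 (time_average F) (0, x) \<le> - \<kappa>"
    and small: "\<epsilon> * M \<le> \<eta> / 2" "\<epsilon> * M\<^sup>2 < \<kappa> * \<eta> / 2"
    and "t \<ge> 0"
  shows "\<bar>y t - y 0\<bar> \<le> 2 * \<eta>"
proof -
  define d where "d t = corrected t - y 0" for t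
  define R where "R t = dx2 (corrector F) (t, y t) * F (t, y t)" for t
  have near: "\<bar>d t - (y t - y 0)\<bar> \<le> \<eta> / 2" for t
    using corrected_near_orbit[OF M(2), of t] small(1) by (simp add: d_def)
  have remainder: "\<bar>d * (\<epsilon> * R t)\<bar> < \<kappa> * (\<eta>\<^sup>2 / 2)" if "\<bar>d\<bar> = \<eta>" for d t
  proof -
    have "\<bar>R t\<bar> \<le> M * M" unfolding R_def abs_mult using M(1)[of 0] by (intro mult_mono M) auto
    then have "\<epsilon> * \<bar>R t\<bar> \<le> \<epsilon> * M\<^sup>2"
      using \<epsilon>_pos by (intro mult_left_mono) (auto simp: power2_eq_square)
    also note small(2)
    finally have "\<bar>d * (\<epsilon> * R t)\<bar> < \<eta> * (\<kappa> * \<eta> / 2)"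
      using \<open>\<eta> > 0\<close> \<epsilon>_pos by (simp add: abs_mult that)
    then show ?thesis by (simp add: power2_eq_square mult_ac)
  qed
  have "(d t)\<^sup>2 < \<eta>\<^sup>2"
  proof (rule below_barrier[OF _ _ _ \<open>t \<ge> 0\<close>])
    show "((\<lambda>t. (d t)\<^sup>2) has_real_derivative
        2 * \<epsilon> * (d t * time_average F (0, y t) + d t * (\<epsilon> * R t))) (at t)" for t
      unfolding d_def R_def
      by (rule derivative_eq_intros corrected_DERIV refl)+ (simp add: algebra_simps)
    show "(d 0)\<^sup>2 < \<eta>\<^sup>2" using \<open>\<eta> > 0\<close> by (simp add: d_def corrected_def)
    fix t assume "(d t)\<^sup>2 = \<eta>\<^sup>2"
    then have d: "\<bar>d t\<bar> = \<eta>" using \<open>\<eta> > 0\<close> by (auto simp: power2_eq_iff)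
    have "d t * time_average F (0, y t) \<le> - \<kappa> * (\<eta>\<^sup>2 / 2)"
      using zero sink \<open>\<kappa> > 0\<close> d near
      by (rule inward_near_sink[OF smooth2_DERIV_snd[OF smooth2_time_average[OF smooth_field]]])
    with remainder[OF d, of t]
    show "2 * \<epsilon> * (d t * time_average F (0, y t) + d t * (\<epsilon> * R t)) < 0"
      using \<epsilon>_pos by (intro mult_pos_neg) linarith+
  qed
  then have "\<bar>d t\<bar> < \<eta>" using power2_less_imp_less[of "\<bar>d t\<bar>" \<eta>] \<open>\<eta> > 0\<close> by simp
  then show ?thesis using near[of t] \<open>\<eta> > 0\<close> by linarith
qed

lemma variation_bound_near_averaged_sink:
  assumes M: "\<And>p. \<bar>F p\<bar> \<le> M" "\<And>p. \<bar>dx2 (corrector F) p\<bar> \<le> M"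
      "\<And>p. \<bar>dx2 (dx2 (corrector F)) p\<bar> \<le> M"
    and sink: "\<And>t. t \<ge> 0 \<Longrightarrow> dx2 (time_average F) (0, y t) \<le> - \<kappa>"
    and small: "\<epsilon> \<le> 1" "\<epsilon> * M\<^sup>2 \<le> \<kappa> / 2"
    and J: "\<And>t. (J has_real_derivative \<epsilon> * dx2 F (t, y t)) (at t)" "J 0 = 0" and "t \<ge> 0"
  shows "J t \<le> M - \<epsilon> * (\<kappa> / 2) * t"
proof -
  define L where "L t = J t + \<epsilon> * dx2 (corrector F) (t, y t) + \<epsilon> * (\<kappa> / 2) * t" for t
  define L' where "L' t = \<epsilon> * (dx2 (time_average F) (0, y t)
      + \<epsilon> * (dx2 (dx2 (corrector F)) (t, y t) * F (t, y t)) + \<kappa> / 2)" for t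
  have "(L has_real_derivative L' t) (at t)" for t
    unfolding L_def[abs_def] L'_def
    by (rule derivative_eq_intros J refl
          has_partials_DERIV_curve[OF has_partials_dx2_corrector orbit])+
      (simp add: dx2_time_average_fst[OF smooth_field, of t] algebra_simps)
  moreover have "L' t \<le> 0" if "t \<ge> 0" for t
  proof -
    have "\<bar>dx2 (dx2 (corrector F)) (t, y t) * F (t, y t)\<bar> \<le> M * M"
      unfolding abs_mult using M(1)[of 0] by (intro mult_mono M) auto
    then have "\<epsilon> * (dx2 (dx2 (corrector F)) (t, y t) * F (t, y t)) \<le> \<epsilon> * M\<^sup>2"
      using \<epsilon>_pos by (intro mult_left_mono) (auto simp: power2_eq_square)
    then show ?thesis
      unfolding L'_def using sink[OF that] small(2) \<epsilon>_pos by (intro mult_nonneg_nonpos) linarith+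
  qed
  ultimately have "L t \<le> L 0"
    by (intro DERIV_nonpos_imp_nonincreasing[OF \<open>t \<ge> 0\<close>]) blast
  moreover have "L 0 = 0" by (simp add: L_def J(2) dx2_corrector)
  moreover have "\<bar>\<epsilon> * dx2 (corrector F) (t, y t)\<bar> \<le> 1 * M"
    unfolding abs_mult using small(1) \<epsilon>_pos by (intro mult_mono M) auto
  ultimately show ?thesis by (simp add: L_def)
qed

end

lemma (in periodic_vector_field) variation_decay_at_averaged_sink:
  assumes zero: "time_average F (0, y0) = 0" and sink: "dx2 (time_average F) (0, y0) < 0"
  obtains \<epsilon>0 \<rho> M where "\<epsilon>0 > 0" "\<rho> > 0"
    "\<And>\<epsilon> y J t. 0 < \<epsilon> \<Longrightarrow> \<epsilon> < \<epsilon>0 \<Longrightarrow>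
      (\<And>t. (y has_real_derivative \<epsilon> * F (t, y t)) (at t)) \<Longrightarrow> y 0 = y0 \<Longrightarrow>
      (\<And>t. (J has_real_derivative \<epsilon> * dx2 F (t, y t)) (at t)) \<Longrightarrow> J 0 = 0 \<Longrightarrow>
      t \<ge> 0 \<Longrightarrow> J t \<le> M - \<epsilon> * \<rho> * t"
proof -
  obtain M where M: "M > 0" "\<And>p. \<bar>F p\<bar> \<le> M" "\<And>p. \<bar>corrector F p\<bar> \<le> M"
    "\<And>p. \<bar>dx2 (corrector F) p\<bar> \<le> M" "\<And>p. \<bar>dx2 (dx2 (corrector F)) p\<bar> \<le> M"
    using corrector_bounds by blast
  define \<kappa> where "\<kappa> = - dx2 (time_average F) (0, y0) / 2"
  have "\<kappa> > 0" using sink by (simp add: \<kappa>_def)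
  have "isCont (\<lambda>x. dx2 (time_average F) (0, x)) y0"
    by (intro continuous_on_interior[of UNIV] continuous_intros
        smooth2_continuous_compose[OF smooth2_dx2[OF smooth2_time_average[OF smooth_field]]]) auto
  then obtain r where r: "r > 0"
    "\<And>x. dist x y0 < r \<Longrightarrow> dist (dx2 (time_average F) (0, x)) (dx2 (time_average F) (0, y0)) < \<kappa>"
    using \<open>\<kappa> > 0\<close> unfolding continuous_at_eps_delta by metis
  define \<eta> where "\<eta> = r / 4"
  have \<eta>: "\<eta> > 0" using r(1) by (simp add: \<eta>_def)
  have sink_nbhd: "dx2 (time_average F) (0, x) \<le> - \<kappa>" if "\<bar>x - y0\<bar> \<le> 2 * \<eta>" for x
    using r(1) r(2)[of x] that unfolding \<kappa>_def \<eta>_def dist_real_def by linarith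
  define \<epsilon>0 where "\<epsilon>0 = Min {1, \<eta> / (2 * M), \<kappa> * \<eta> / (2 * M\<^sup>2), \<kappa> / (2 * M\<^sup>2)}"
  have "\<epsilon>0 > 0" using \<eta> \<open>\<kappa> > 0\<close> M(1) by (simp add: \<epsilon>0_def)
  moreover have "J t \<le> M - \<epsilon> * (\<kappa> / 2) * t"
    if \<epsilon>: "0 < \<epsilon>" "\<epsilon> < \<epsilon>0" and y: "\<And>t. (y has_real_derivative \<epsilon> * F (t, y t)) (at t)" "y 0 = y0"
      and J: "\<And>t. (J has_real_derivative \<epsilon> * dx2 F (t, y t)) (at t)" "J 0 = 0" and "t \<ge> 0"
    for \<epsilon> y J t
  proof -
    interpret slow_orbit F \<epsilon> y by unfold_locales (fact \<epsilon>(1) y(1))+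
    have "\<epsilon> < 1" "\<epsilon> < \<eta> / (2 * M)" "\<epsilon> < \<kappa> * \<eta> / (2 * M\<^sup>2)" "\<epsilon> < \<kappa> / (2 * M\<^sup>2)"
      using \<epsilon>(2) by (auto simp: \<epsilon>0_def)
    then have small: "\<epsilon> \<le> 1" "\<epsilon> * M \<le> \<eta> / 2" "\<epsilon> * M\<^sup>2 < \<kappa> * \<eta> / 2" "\<epsilon> * M\<^sup>2 \<le> \<kappa> / 2"
      using M(1) by (auto simp: field_simps)
    have "\<bar>y t - y 0\<bar> \<le> 2 * \<eta>" if "t \<ge> 0" for t
      using zero sink_nbhd y(2) that
      by (intro orbit_near_averaged_sink[OF M(2,3,4) _ \<eta> \<open>\<kappa> > 0\<close> _ small(2,3)]) auto
    then show ?thesis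
      using sink_nbhd y(2) \<open>t \<ge> 0\<close>
      by (intro variation_bound_near_averaged_sink[OF M(2,4,5) _ small(1,4) J]) auto
  qed
  ultimately show ?thesis using that[of \<epsilon>0 "\<kappa> / 2" M] \<open>\<kappa> > 0\<close> by auto
qed

section \<open>The resonant average\<close>

definition resonant_frame :: "nat \<Rightarrow> (real \<times> real \<Rightarrow> real) \<Rightarrow> real \<times> real \<Rightarrow> real" where
  "resonant_frame m V p = V (fst p, snd p - real m * fst p)"

lemma smooth2_resonant_frame: "smooth2 V \<Longrightarrow> smooth2 (resonant_frame m V)"
  unfolding resonant_frame_def[abs_def]
  by (erule smooth2_compose) (intro smooth2_intros)+

lemma periodic2_resonant_frame:
  assumes "periodic2 V"
  shows "periodic2 (resonant_frame m V)"
  unfolding periodic2_def resonant_frame_def fst_conv snd_conv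
proof (intro allI conjI)
  fix t x
  have "V (t + 2 * pi, x - real m * (t + 2 * pi))
      = V (t + of_int 1 * (2 * pi), x - real m * t + of_int (- int m) * (2 * pi))"
    by (simp add: algebra_simps)
  then show "V (t + 2 * pi, x - real m * (t + 2 * pi)) = V (t, x - real m * t)"
    by (simp only: periodic2_shift[OF assms])
  have "x + 2 * pi - real m * t = (x - real m * t) + 2 * pi" by simp
  then show "V (t, x + 2 * pi - real m * t) = V (t, x - real m * t)"
    using assms unfolding periodic2_def by metis
qed

lemma dx2_resonant_frame:
  assumes "smooth2 V"
  shows "dx2 (resonant_frame m V) = resonant_frame m (dx2 V)"
proof (rule dx2_eqI[OF smooth2_resonant_frame[OF assms]])
  fix t x
  have "((\<lambda>x. V (t, x - real m * t)) has_real_derivative dx2 V (t, x - real m * t) * 1) (at x)"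
    by (rule DERIV_chain2[OF smooth2_DERIV_snd[OF assms]]) (auto intro!: derivative_eq_intros)
  then show "((\<lambda>x. resonant_frame m V (t, x)) has_real_derivative
      resonant_frame m (dx2 V) (t, x)) (at x)"
    by (simp add: resonant_frame_def)
qed

lemma slice_coef_resonant_frame:
  assumes "smooth2 V" "periodic2 V"
  shows "slice_coef (resonant_frame m V) t k = character (- (int m * k)) t * slice_coef V t k"
proof -
  have "fcoef (\<lambda>x. of_real (V (t, x + - real m * t))) k
      = character k (- real m * t) * fcoef (\<lambda>x. of_real (V (t, x))) k"
    using assms by (intro fcoef_shift continuous_on_slice) (auto simp: periodic2_def)
  then show ?thesis
    by (simp add: slice_coef_def resonant_frame_def character_def mult_ac)
qed

lemma slice_coef_time_average:
  assumes F: "smooth2 F"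
  shows "slice_coef (time_average F) t k = integral {0..2*pi} (\<lambda>t. slice_coef F t k) / (2 * pi)"
proof -
  let ?f = "\<lambda>t x. character (- k) x * complex_of_real (F (t, x))"
  note coef = fcoef_eq_integral[OF continuous_on_slice]
  have "integral {0..2*pi} (\<lambda>t. integral {0..2*pi} (?f t))
      = integral {0..2*pi} (\<lambda>x. integral {0..2*pi} (\<lambda>t. ?f t x))"
    using integral_swap_continuous[of 0 0 "2*pi" "2*pi" ?f]
    by (simp add: split_beta continuous_intros smooth2_continuous_compose[OF F])
  also have "\<dots> = integral {0..2*pi}
      (\<lambda>x. 2 * pi * (character (- k) x * of_real (time_average F (t, x))))"
  proof (rule integral_cong)
    fix x
    have "((\<lambda>t. F (t, x)) has_integral 2 * pi * time_average F (t, x)) {0..2*pi}"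
      unfolding time_average_eq_integral[OF smooth2_continuous[OF F]]
      by (intro integrable_integral integrable_continuous_interval smooth2_continuous_compose[OF F]
          continuous_intros)
    from has_integral_mult_right[OF has_integral_of_real[OF this], of "character (- k) x"]
    have "integral {0..2*pi} (\<lambda>t. ?f t x)
        = character (- k) x * of_real (2 * pi * time_average F (t, x))"
      by (rule integral_unique)
    then show "integral {0..2*pi} (\<lambda>t. ?f t x)
        = 2 * pi * (character (- k) x * of_real (time_average F (t, x)))"
      by (simp only: of_real_mult of_real_numeral mult_ac)
  qed
  finally show ?thesis
    by (simp add: slice_coef_def coef F smooth2_time_average)
qed

lemma vcoef_eq_iterated_integral:
  assumes V: "smooth2 V"
  shows "vcoef V k l = integral {0..2*pi} (\<lambda>t. character (- l) t * slice_coef V t k) / (2 * pi)"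
proof -
  define f where "f p = complex_of_real (V p)
      * exp (- \<i> * (of_int k * of_real (snd p) + of_int l * of_real (fst p)))" for p
  have f: "continuous_on X f" for X
    unfolding f_def by (intro continuous_intros smooth2_continuous_compose[OF V])
  have f_eq: "f (t, x) = character (- l) t * (character (- k) x * of_real (V (t, x)))" for t x
    by (simp add: f_def character_def cis_conv_exp algebra_simps flip: exp_add)
  have box: "{0..2*pi} \<times> {0..2*pi} = cbox (0::real, 0::real) (2*pi, 2*pi)"
    by (simp add: cbox_Pair_eq)
  have "(LINT p:{0..2*pi} \<times> {0..2*pi}|lborel. f p) = integral (cbox (0, 0) (2*pi, 2*pi)) f"
    unfolding box
    by (intro set_borel_integral_eq_integral)
      (auto simp: set_integrable_def intro!: borel_integrable_compact f)
  also have "\<dots> = integral {0..2*pi} (\<lambda>t. integral {0..2*pi} (\<lambda>x. f (t, x)))"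
    using integral_prod_continuous[OF f, of 0 0 "2*pi" "2*pi"] by simp
  also have "\<dots> = integral {0..2*pi} (\<lambda>t. 2 * pi * (character (- l) t * slice_coef V t k))"
    by (simp add: f_eq slice_coef_def fcoef_eq_integral[OF continuous_on_slice[OF V]])
  finally show ?thesis
    unfolding vcoef_def f_def[symmetric] by (simp add: power2_eq_square)
qed

lemma res_avg_eq_time_average:
  assumes V: "smooth2 V" "periodic2 V"
  shows "res_avg m V x = of_real (time_average (resonant_frame m V) (0, x))"
proof -
  let ?g = "time_average (resonant_frame m V)"
  have W: "smooth2 (resonant_frame m V)" "periodic2 (resonant_frame m V)"
    using V by (auto intro: smooth2_resonant_frame periodic2_resonant_frame)
  have "vcoef V k (int m * k) * exp (\<i> * of_int k * of_real x)
      = slice_coef ?g 0 k * character k x" for k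
    unfolding vcoef_eq_iterated_integral[OF V(1)] slice_coef_time_average[OF W(1)]
      slice_coef_resonant_frame[OF V]
    by (simp add: character_def cis_conv_exp mult.assoc)
  moreover have "((\<lambda>k. slice_coef ?g 0 k * character k x) has_sum of_real (?g (0, x))) UNIV"
    by (intro slice_has_sum smooth2_time_average periodic2_imp_periodic_snd
        periodic2_time_average W)
  ultimately show ?thesis by (simp add: res_avg_def infsumI)
qed

lemma resonantly_unstable_positive_derivative:
  assumes V: "smooth2 V" "periodic2 V" and unstable: "resonantly_unstable m V"
  obtains y where "time_average (resonant_frame m V) (0, y) = 0"
    "dx2 (time_average (resonant_frame m V)) (0, y) > 0"
proof -
  let ?g = "time_average (resonant_frame m V)"
  have g: "smooth2 ?g" "periodic2 ?g"
    using V by (auto intro: smooth2_time_average periodic2_time_average smooth2_resonant_frame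
        periodic2_resonant_frame)
  have res_avg: "res_avg m V = (\<lambda>x. of_real (?g (0, x)))"
    by (simp add: fun_eq_iff res_avg_eq_time_average[OF V])
  have "vector_derivative (res_avg m V) (at x) = of_real (dx2 ?g (0, x))" for x
    unfolding res_avg by (rule vector_derivative_at[OF slice_has_vector_derivative[OF g(1)]])
  with unstable obtain x0 where "?g (0, x0) = 0" "\<And>x. ?g (0, x) = 0 \<Longrightarrow> dx2 ?g (0, x) \<noteq> 0"
    by (auto simp: resonantly_unstable_def res_avg)
  moreover have "?g (0, x + 2 * pi) = ?g (0, x)" for x using g(2) by (simp add: periodic2_def)
  ultimately obtain y where "?g (0, y) = 0" "dx2 ?g (0, y) > 0"
    using periodic_zero_with_positive_derivative[OF smooth2_DERIV_snd[OF g(1)], of 0 "2 * pi" x0]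
    by auto
  then show ?thesis by (rule that)
qed

lemma log_jacobian_decay:
  assumes V: "smooth2 V" "periodic2 V" and unstable: "resonantly_unstable m V"
  obtains \<epsilon>0 \<rho> y0 M where "\<epsilon>0 > 0" "\<rho> > 0"
    "\<And>\<epsilon> t. 0 < \<epsilon> \<Longrightarrow> \<epsilon> < \<epsilon>0 \<Longrightarrow> t \<ge> 0 \<Longrightarrow>
      log_jacobian (\<lambda>p. - (real m + \<epsilon> * V p)) (t, y0) \<le> M - \<epsilon> * \<rho> * t"
proof -
  define F where "F = (\<lambda>p. - resonant_frame m V p)"
  have W: "smooth2 (resonant_frame m V)" by (rule smooth2_resonant_frame[OF V(1)])
  interpret F: periodic_vector_field F
    using periodic2_resonant_frame[OF V(2), of m] smooth2_uminus[OF W]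
    by unfold_locales (auto simp: F_def periodic2_def)
  have dx2_F: "dx2 F (t, x) = - dx2 V (t, x - real m * t)" for t x
    unfolding F_def dx2_uminus[OF W] dx2_resonant_frame[OF V(1)]
    by (simp add: resonant_frame_def)
  obtain y0 where "time_average (resonant_frame m V) (0, y0) = 0"
    "dx2 (time_average (resonant_frame m V)) (0, y0) > 0"
    using resonantly_unstable_positive_derivative[OF V unstable] .
  then have y0: "time_average F (0, y0) = 0" "dx2 (time_average F) (0, y0) < 0"
    unfolding F_def time_average_uminus dx2_uminus[OF smooth2_time_average[OF W]] by simp_all
  obtain \<epsilon>0 \<rho> M where pos: "\<epsilon>0 > 0" "\<rho> > 0" and decay: "\<And>\<epsilon> y J t. 0 < \<epsilon> \<Longrightarrow> \<epsilon> < \<epsilon>0 \<Longrightarrow>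
      (\<And>t. (y has_real_derivative \<epsilon> * F (t, y t)) (at t)) \<Longrightarrow> y 0 = y0 \<Longrightarrow>
      (\<And>t. (J has_real_derivative \<epsilon> * dx2 F (t, y t)) (at t)) \<Longrightarrow> J 0 = 0 \<Longrightarrow>
      t \<ge> 0 \<Longrightarrow> J t \<le> M - \<epsilon> * \<rho> * t"
    using F.variation_decay_at_averaged_sink[OF y0] by blast
  have "log_jacobian (\<lambda>p. - (real m + \<epsilon> * V p)) (t, y0) \<le> M - \<epsilon> * \<rho> * t"
    if \<epsilon>: "0 < \<epsilon>" "\<epsilon> < \<epsilon>0" and "t \<ge> 0" for \<epsilon> t
  proof -
    interpret transport "\<lambda>p. real m + \<epsilon> * V p" by (rule transport_affine[OF V])
    define y where "y t = flow (\<lambda>p. - (real m + \<epsilon> * V p)) (t, y0) + real m * t" for t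
    have orbit: "(y has_real_derivative \<epsilon> * F (t, y t)) (at t)" for t
      unfolding y_def[abs_def]
      by (rule derivative_eq_intros flow_DERIV_fst refl)+ (simp add: F_def resonant_frame_def)
    have "((\<lambda>t. log_jacobian (\<lambda>p. - (real m + \<epsilon> * V p)) (t, y0)) has_real_derivative
        \<epsilon> * dx2 F (t, y t)) (at t)" for t
      using log_jacobian_DERIV_fst[of y0 t]
      unfolding dx2_uminus[OF smooth_coeff] dx2_affine[OF V(1)] by (simp only: dx2_F y_def) simp
    moreover have "y 0 = y0" unfolding y_def flow_0 by simp
    ultimately show ?thesis by (intro decay[OF \<epsilon> orbit] log_jacobian_0 \<open>t \<ge> 0\<close>)
  qed
  then show ?thesis using that pos by blast
qed

theorem theorem1:
  fixes m :: nat and V :: "real \<times> real \<Rightarrow> real"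
  assumes "m > 0" and "smooth2 V" and "periodic2 V" and "resonantly_unstable m V"
  shows "\<exists>\<epsilon>0>0. \<exists>\<delta>1>0. \<exists>\<delta>2>0. \<forall>\<epsilon>. 0 < \<epsilon> \<and> \<epsilon> < \<epsilon>0 \<longrightarrow>
           (\<forall>s>1. \<exists>u0. in_Hs s u0 \<and> sob_norm s u0 \<noteq> 0 \<and>
              (\<exists>u. is_solution m \<epsilon> V s u0 u) \<and>
              (\<forall>u. is_solution m \<epsilon> V s u0 u \<longrightarrow>
                 (\<forall>t>0. sob_norm s (u t) \<ge> \<delta>1 * exp (\<epsilon> * \<delta>2 * t) * sob_norm s u0)))"
proof -
  obtain \<epsilon>0 \<rho> y0 M where "\<epsilon>0 > 0" "\<rho> > 0" and decay: "\<And>\<epsilon> t. 0 < \<epsilon> \<Longrightarrow> \<epsilon> < \<epsilon>0 \<Longrightarrow> t \<ge> 0 \<Longrightarrow>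
      log_jacobian (\<lambda>p. - (real m + \<epsilon> * V p)) (t, y0) \<le> M - \<epsilon> * \<rho> * t"
    by (rule log_jacobian_decay[OF assms(2-4)]) (rule that)
  define \<delta>1 \<delta>2 where "\<delta>1 = exp (- M / 2) / sobolev_const" and "\<delta>2 = \<rho> / 2"
  have "\<exists>u0. in_Hs s u0 \<and> sob_norm s u0 \<noteq> 0 \<and> (\<exists>u. is_solution m \<epsilon> V s u0 u) \<and>
      (\<forall>u. is_solution m \<epsilon> V s u0 u \<longrightarrow>
        (\<forall>t>0. sob_norm s (u t) \<ge> \<delta>1 * exp (\<epsilon> * \<delta>2 * t) * sob_norm s u0))"
    if \<epsilon>: "0 < \<epsilon>" "\<epsilon> < \<epsilon>0" and s: "s > 1" for \<epsilon> s
  proof -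
    interpret transport "\<lambda>p. real m + \<epsilon> * V p" by (rule transport_affine[OF assms(2,3)])
    have "\<delta>1 * exp (\<epsilon> * \<delta>2 * t) \<le> sob_norm s (u t)"
      if "weak_solution (\<lambda>p. real m + \<epsilon> * V p) s (\<lambda>x. 1) u" "t > 0" for u t
      using weak_solution_one_growth[OF that(1) s _ decay[OF \<epsilon>]] that(2)
      by (simp add: \<delta>1_def \<delta>2_def)
    then show ?thesis
      using weak_solution_classical[of s] weak_solution_initial_in_Hs[OF weak_solution_classical]
      unfolding is_solution_iff_weak_solution[OF assms(2)] by (intro exI[of _ "\<lambda>x. 1"]) auto
  qed
  moreover have "\<delta>1 > 0" "\<delta>2 > 0"
    using sobolev_const_pos \<open>\<rho> > 0\<close> by (simp_all add: \<delta>1_def \<delta>2_def)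
  ultimately show ?thesis using \<open>\<epsilon>0 > 0\<close> by blast
qed

end
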